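(* Assume (SA). (a) Let $x_0\in\mathbb K^\circ$ with $I_0'(x_0)=0$ and $\partial_pH(x_0,0)=0$, let $m=\partial_x\partial_pH(x_0,0)$, $c=\partial_p^2H(x_0,0)$, suppose $I_0$ is $C^2$ on a neighbourhood of $x_0$ with $I_0''(x_0)<\min\{-2m/c,0\}$, and suppose the Hamiltonian flow admits a $C^1$ linearization at $(x_0,0)$. Let $t_0=-\frac1{2m}\log\big(1+(\frac{c}{2m}I_0''(x_0))^{-1}\big)$ if $m\ne0$ and $t_0=-\frac1{cI_0''(x_0)}$ if $m=0$. Then $\mathcal G_t$ has an overhang at $x_0$ for all $t>t_0$. (b) Suppose $H$ is $C^3$ and $m_1<m_2$ are points of $\mathbb K^\circ$ with (i) $\partial_pH(m_1,0)=0=\partial_pH(m_2,0)$ and $\partial_pH(x,0)\neq0$ for all $x\in(m_1,m_2)$, and (ii) $\partial_x\partial_pH(m_1,0)\ne0$ and $\partial_x\partial_pH(m_2,0)\ne0$. If $\mathcal G\cap\{(x,p)\in(m_1,m_2)\times\mathbb R:H(x,p)<0\}\ne\emptyset$, then there are $t_0>0$ and $x_0\in(m_1,m_2)$ such that $\mathcal G_t$ has an overhang at $x_0$ for all $t\ge t_0$.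
   Context: Notation. $\mathbb K$ is either $\mathbb R$ or $[-1,1]$, with interior $\mathbb K^\circ$; set $\partial_-=-\infty,\partial_+=+\infty$ if $\mathbb K=\mathbb R$ and $\partial_-=-1,\partial_+=1$ if $\mathbb K=[-1,1]$. Given $H:\mathbb K\times\mathbb R\to\mathbb R$, the Lagrangian is $\mathcal L(x,v)=\sup_{p\in\mathbb R}(pv-H(x,p))\in(-\infty,+\infty]$. $C^{1,\partial}(\mathbb K)$ is the set of continuous $g:\mathbb K\to\mathbb R$ that are $C^1$ on $\mathbb K^\circ$ with $\lim_{x\to\partial_+}g'(x)=+\infty$ and $\lim_{x\to\partial_-}g'(x)=-\infty$. The Hamilton equations are $\dot X=\partial_pH(X,P)$, $\dot P=-\partial_xH(X,P)$; $s\mapsto(X_s^{x,p},P_s^{x,p})$ is the solution with initial value $(x,p)\in\mathbb K\times\mathbb R$, defined on its maximal interval $[0,t_{x,p})$. Condition (H) on $H:\mathbb K\times\mathbb R\to\mathbb R$: $H(x,0)=0$ for all $x$, and (H1) $H$ is $C^2$ with $\partial_p^2H>0$ on $\mathbb K\times\mathbb R$; if $\mathbb K=[-1,1]$, $H$ is the restriction of a $C^2$ function on $(-1-\epsilon,1+\epsilon)\times\mathbb R$ for some $\epsilon>0$. (H2) for every compact $K\subseteq\mathbb K^\circ$ there is $\theta_K:[0,\infty)\to[0,\infty)$ with $\theta_K(r)/r\to\infty$ as $r\to\infty$; for every $M\ge0$ a constant $k_M$ with $\theta_K(r+m)\le k_M(1+\theta_K(r))$ for all $m\in[0,M]$, $r\ge0$;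 constants $c_K,C_K$ with $\mathcal L(x,v)\ge\theta_K(|v|)-c_K$ and $|\partial_x\mathcal L(x,v)|+|\partial_v\mathcal L(x,v)|\le C_K\theta_K(|v|)$ for all $x\in K,v\in\mathbb R$. (H3) for each compact $K\subseteq\mathbb K^\circ$, $\lim_{|p|\to\infty}\inf_{x\in K}H(x,p)/|p|=\infty$; if $\mathbb K=[-1,1]$ moreover $\lim_{p\to\infty}H(-1,p)/p=\infty$ and $\lim_{p\to-\infty}H(1,p)/(-p)=\infty$. (H4) $\lim_{x\to\partial_-}\operatorname{argmin}_pH(x,p)=-\infty$ and $\lim_{x\to\partial_+}\operatorname{argmin}_pH(x,p)=+\infty$. (H5) there are $(y_n^+,q_n^+)\in\mathbb K^\circ\times(0,\infty)$ converging to $(\partial_+,+\infty)$ with $\partial_pH(y_n^+,q)\ge0$ for $q\ge q_n^+$ and $-\partial_xH(y,q_n^+)\ge0$ for $y\ge y_n^+$, and $(y_n^-,q_n^-)\in\mathbb K^\circ\times(-\infty,0)$ converging to $(\partial_-,-\infty)$ with $\partial_pH(y_n^-,q)\le0$ for $q\le q_n^-$ and $-\partial_xH(y,q_n^-)\le0$ for $y\le y_n^-$. Condition (S) (for $\mathbb K=[-1,1]$): there is $S:[-1,1]\to[0,\infty]$, $C^2$ on $(-1,1)$, such that (i) $t\mapsto S(x(t))$ is nonincreasing for every solution of $\dot x=\partial_pH(x,0)$; (ii) $H(x,S'(x)-p)=H(x,p)$ for $(x,p)\in(-1,1)\times\mathbb R$; (iii) $x\mapsto\mathcal L(x,0)$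 is decreasing on a neighbourhood of $-1$ in $[-1,1]$ and increasing on a neighbourhood of $1$ in $[-1,1]$; (iv) $\lim_{x\downarrow-1}\frac{\mathcal L(x,0)-\mathcal L(-1,0)}{S(x)-S(-1)}=\infty$ and $\lim_{x\uparrow1}\frac{\mathcal L(x,0)-\mathcal L(1,0)}{S(x)-S(1)}=\infty$. Standing Assumption (SA): $I_0\in C^{1,\partial}(\mathbb K)$ and one of: (R-a) $\mathbb K=\mathbb R$, $H(x,p)=\frac12p^2-pW'(x)$ with $W\in C^3(\mathbb R)$ and $-W'$ one-sided Lipschitz (there is $M\ge0$ with $-(W'(x)-W'(y))\le M(x-y)$ for $x>y$); (R-b) $\mathbb K=\mathbb R$, $H$ satisfies (H) and there is a $C^1$ function $\Upsilon:\mathbb R\to\mathbb R$ with compact sublevel sets and $\sup_xH(x,\Upsilon'(x))<\infty$; (C-a) $\mathbb K=[-1,1]$, $H(x,p)=v_+(x)(e^{2p}-1)+v_-(x)(e^{-2p}-1)$ with $v_\pm:[-1,1]\to[0,\infty)$, $v_-(-1)=0$, $v_->0$ on $(-1,1]$, $v_+(1)=0$, $v_+>0$ on $[-1,1)$, $v_\pm$ extendable to $C^2$ functions on an open set containing $[-1,1]$, $v_+'(1)<0$, $v_-'(-1)>0$; (C-b) $\mathbb K=[-1,1]$ and $H$ satisfies (H) and (S). $\mathcal G=\{(x,I_0'(x)):x\in\mathbb K^\circ\}$; for $t>0$, $\mathcal G_t=\{(X_t^{x,p},P_t^{x,p}):(x,p)\in\mathcal G,\ t<t_{x,p}\}$.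 $\mathcal G_t$ has an overhang at $x\in\mathbb K^\circ$ if there are $y_1\neq y_2$ with $(x,y_1),(x,y_2)\in\mathcal G_t$. $C^1$ linearization: for $x_0\in\mathbb K^\circ$ with $\partial_pH(x_0,0)=0$, the flow admits a $C^1$ linearization at $(x_0,0)$ if there are open neighbourhoods $U,V\subseteq\mathbb R^2$ of $(x_0,0)$ and a $C^1$-diffeomorphism $\Psi:U\to V$ with $\Psi(x_0,0)=(x_0,0)$, $D\Psi(x_0,0)$ the identity matrix, such that a trajectory $(\gamma,\eta)$ with values in $U$ solves the Hamilton equations iff $(\xi,\zeta)=\Psi(\gamma,\eta)$ solves $\dot\xi=m(\xi-x_0)+c\zeta$, $\dot\zeta=-m\zeta$, with $m=\partial_x\partial_pH(x_0,0)$, $c=\partial_p^2H(x_0,0)$. *)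

theory Defs
  imports "HOL-Analysis.Analysis"
begin

fun Ck1 :: "nat \<Rightarrow> real set \<Rightarrow> (real \<Rightarrow> real) \<Rightarrow> bool" where
  "Ck1 0 U f = continuous_on U f"
| "Ck1 (Suc k) U f = (\<exists>f'. (\<forall>x\<in>U. (f has_real_derivative f' x) (at x)) \<and> Ck1 k U f')"

fun Ck2 :: "nat \<Rightarrow> (real \<times> real) set \<Rightarrow> (real \<times> real \<Rightarrow> real) \<Rightarrow> bool" where
  "Ck2 0 U f = continuous_on U f"
| "Ck2 (Suc k) U f = (\<exists>fx fp. Ck2 k U fx \<and> Ck2 k U fp \<and>
      (\<forall>z\<in>U. (f has_derivative (\<lambda>h. fx z * fst h + fp z * snd h)) (at z)))"

text \<open>K is either UNIV (= R) or {-1..1}. The filters describing x \<rightarrow> \<partial>_+ and x \<rightarrow> \<partial>_-.\<close>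
definition plus_end :: "real set \<Rightarrow> real filter" where
  "plus_end K = (if K = UNIV then at_top else at_left 1)"

definition minus_end :: "real set \<Rightarrow> real filter" where
  "minus_end K = (if K = UNIV then at_bot else at_right (-1))"

text \<open>x-derivatives are taken within K (one-sided at the boundary points of [-1,1]).\<close>
definition pd_p :: "(real \<Rightarrow> real \<Rightarrow> real) \<Rightarrow> real \<Rightarrow> real \<Rightarrow> real" where
  "pd_p H x p = deriv (\<lambda>q. H x q) p"

definition pd_x :: "real set \<Rightarrow> (real \<Rightarrow> real \<Rightarrow> real) \<Rightarrow> real \<Rightarrow> real \<Rightarrow> real" where
  "pd_x K H x p = (SOME D. ((\<lambda>y. H y p) has_real_derivative D) (at x within K))"

definition pd_pp :: "(real \<Rightarrow> real \<Rightarrow> real) \<Rightarrow> real \<Rightarrow> real \<Rightarrow> real" where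
  "pd_pp H x p = deriv (\<lambda>q. pd_p H x q) p"

definition pd_xp :: "real set \<Rightarrow> (real \<Rightarrow> real \<Rightarrow> real) \<Rightarrow> real \<Rightarrow> real \<Rightarrow> real" where
  "pd_xp K H x p = (SOME D. ((\<lambda>y. pd_p H y p) has_real_derivative D) (at x within K))"

definition Lag :: "(real \<Rightarrow> real \<Rightarrow> real) \<Rightarrow> real \<Rightarrow> real \<Rightarrow> ereal" where
  "Lag H x v = (SUP p. ereal (p * v - H x p))"

definition Lag_x :: "(real \<Rightarrow> real \<Rightarrow> real) \<Rightarrow> real \<Rightarrow> real \<Rightarrow> real" where
  "Lag_x H x v = deriv (\<lambda>y. real_of_ereal (Lag H y v)) x"

definition Lag_v :: "(real \<Rightarrow> real \<Rightarrow> real) \<Rightarrow> real \<Rightarrow> real \<Rightarrow> real" where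
  "Lag_v H x v = deriv (\<lambda>w. real_of_ereal (Lag H x w)) v"

definition H_Ck :: "nat \<Rightarrow> real set \<Rightarrow> (real \<Rightarrow> real \<Rightarrow> real) \<Rightarrow> bool" where
  "H_Ck k K H = (if K = UNIV then Ck2 k UNIV (\<lambda>(x,p). H x p)
     else (\<exists>\<epsilon>>0. \<exists>Ht. Ck2 k ({-1-\<epsilon><..<1+\<epsilon>} \<times> UNIV) Ht \<and>
                  (\<forall>x\<in>K. \<forall>p. Ht (x,p) = H x p)))"

definition cond_H1 :: "real set \<Rightarrow> (real \<Rightarrow> real \<Rightarrow> real) \<Rightarrow> bool" where
  "cond_H1 K H = (H_Ck 2 K H \<and> (\<forall>x\<in>K. \<forall>p. pd_pp H x p > 0))"

definition cond_H2 :: "real set \<Rightarrow> (real \<Rightarrow> real \<Rightarrow> real) \<Rightarrow> bool" where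
  "cond_H2 K H = (\<forall>C. compact C \<and> C \<subseteq> interior K \<longrightarrow>
     (\<exists>\<theta> :: real \<Rightarrow> real.
        (\<forall>r\<ge>0. \<theta> r \<ge> 0) \<and>
        filterlim (\<lambda>r. \<theta> r / r) at_top at_top \<and>
        (\<forall>M\<ge>0. \<exists>kM. \<forall>m\<in>{0..M}. \<forall>r\<ge>0. \<theta> (r + m) \<le> kM * (1 + \<theta> r)) \<and>
        (\<exists>cK CK. \<forall>x\<in>C. \<forall>v.
            Lag H x v \<ge> ereal (\<theta> \<bar>v\<bar> - cK) \<and>
            \<bar>Lag_x H x v\<bar> + \<bar>Lag_v H x v\<bar> \<le> CK * \<theta> \<bar>v\<bar>)))"

definition cond_H3 :: "real set \<Rightarrow> (real \<Rightarrow> real \<Rightarrow> real) \<Rightarrow> bool" where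
  "cond_H3 K H = ((\<forall>C. compact C \<and> C \<subseteq> interior K \<longrightarrow>
       (\<forall>B. eventually (\<lambda>p. \<forall>x\<in>C. H x p / \<bar>p\<bar> \<ge> B) at_infinity)) \<and>
     (K = {-1..1} \<longrightarrow>
       filterlim (\<lambda>p. H (-1) p / p) at_top at_top \<and>
       filterlim (\<lambda>p. H 1 p / (-p)) at_top at_bot))"

definition argminH :: "(real \<Rightarrow> real \<Rightarrow> real) \<Rightarrow> real \<Rightarrow> real" where
  "argminH H x = (THE p. \<forall>q. H x p \<le> H x q)"

definition cond_H4 :: "real set \<Rightarrow> (real \<Rightarrow> real \<Rightarrow> real) \<Rightarrow> bool" where
  "cond_H4 K H = (filterlim (argminH H) at_bot (minus_end K) \<and>
                  filterlim (argminH H) at_top (plus_end K))"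

definition cond_H5 :: "real set \<Rightarrow> (real \<Rightarrow> real \<Rightarrow> real) \<Rightarrow> bool" where
  "cond_H5 K H =
    ((\<exists>y q :: nat \<Rightarrow> real. (\<forall>n. y n \<in> interior K \<and> q n > 0) \<and>
        filterlim y (plus_end K) sequentially \<and> filterlim q at_top sequentially \<and>
        (\<forall>n. \<forall>r\<ge>q n. pd_p H (y n) r \<ge> 0) \<and>
        (\<forall>n. \<forall>z\<in>K. z \<ge> y n \<longrightarrow> - pd_x K H z (q n) \<ge> 0)) \<and>
     (\<exists>y q :: nat \<Rightarrow> real. (\<forall>n. y n \<in> interior K \<and> q n < 0) \<and>
        filterlim y (minus_end K) sequentially \<and> filterlim q at_bot sequentially \<and>
        (\<forall>n. \<forall>r\<le>q n. pd_p H (y n) r \<le> 0) \<and>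
        (\<forall>n. \<forall>z\<in>K. z \<le> y n \<longrightarrow> - pd_x K H z (q n) \<le> 0)))"

definition cond_H :: "real set \<Rightarrow> (real \<Rightarrow> real \<Rightarrow> real) \<Rightarrow> bool" where
  "cond_H K H = ((\<forall>x\<in>K. H x 0 = 0) \<and> cond_H1 K H \<and> cond_H2 K H \<and> cond_H3 K H \<and>
                 cond_H4 K H \<and> cond_H5 K H)"

definition cond_S :: "(real \<Rightarrow> real \<Rightarrow> real) \<Rightarrow> bool" where
  "cond_S H = (\<exists>S :: real \<Rightarrow> ereal.
     (\<forall>x\<in>{-1..1}. S x \<ge> 0) \<and>
     (\<forall>x\<in>{-1<..<1}. S x \<noteq> \<infinity>) \<and>
     Ck1 2 {-1<..<1} (\<lambda>x. real_of_ereal (S x)) \<and>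
     \<comment> \<open>(i)\<close>
     (\<forall>J (x :: real \<Rightarrow> real). is_interval J \<and>
        (\<forall>t\<in>J. x t \<in> {-1..1} \<and> (x has_real_derivative pd_p H (x t) 0) (at t within J))
        \<longrightarrow> (\<forall>s\<in>J. \<forall>t\<in>J. s \<le> t \<longrightarrow> S (x t) \<le> S (x s))) \<and>
     \<comment> \<open>(ii)\<close>
     (\<forall>x\<in>{-1<..<1}. \<forall>p. H x (deriv (\<lambda>y. real_of_ereal (S y)) x - p) = H x p) \<and>
     \<comment> \<open>(iii)\<close>
     (\<exists>\<delta>>0. \<forall>x\<in>{-1..<-1+\<delta>}. \<forall>y\<in>{-1..<-1+\<delta>}. x < y \<longrightarrow> Lag H y 0 < Lag H x 0) \<and>
     (\<exists>\<delta>>0. \<forall>x\<in>{1-\<delta><..1}. \<forall>y\<in>{1-\<delta><..1}. x < y \<longrightarrow> Lag H x 0 < Lag H y 0) \<and>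
     \<comment> \<open>(iv)\<close>
     ((\<lambda>x. (Lag H x 0 - Lag H (-1) 0) / (S x - S (-1))) \<longlongrightarrow> \<infinity>) (at_right (-1)) \<and>
     ((\<lambda>x. (Lag H x 0 - Lag H 1 0) / (S x - S 1)) \<longlongrightarrow> \<infinity>) (at_left 1))"

definition C1_boundary :: "real set \<Rightarrow> (real \<Rightarrow> real) \<Rightarrow> bool" where
  "C1_boundary K g = (continuous_on K g \<and> Ck1 1 (interior K) g \<and>
     filterlim (deriv g) at_top (plus_end K) \<and> filterlim (deriv g) at_bot (minus_end K))"

definition SA :: "real set \<Rightarrow> (real \<Rightarrow> real \<Rightarrow> real) \<Rightarrow> (real \<Rightarrow> real) \<Rightarrow> bool" where
  "SA K H I0 = (C1_boundary K I0 \<and>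
    ( \<comment> \<open>(R-a)\<close>
      (K = UNIV \<and> (\<exists>W. Ck1 3 UNIV W \<and> (\<forall>x p. H x p = p^2/2 - p * deriv W x) \<and>
          (\<exists>M\<ge>0. \<forall>x y. x > y \<longrightarrow> - (deriv W x - deriv W y) \<le> M * (x - y))))
    \<or> \<comment> \<open>(R-b)\<close>
      (K = UNIV \<and> cond_H K H \<and>
        (\<exists>\<Upsilon>. Ck1 1 UNIV \<Upsilon> \<and> (\<forall>c. compact {x. \<Upsilon> x \<le> c}) \<and>
             (\<exists>B. \<forall>x. H x (deriv \<Upsilon> x) \<le> B)))
    \<or> \<comment> \<open>(C-a)\<close>
      (K = {-1..1} \<and> (\<exists>vp vm U. open U \<and> {-1..1} \<subseteq> U \<and> Ck1 2 U vp \<and> Ck1 2 U vm \<and>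
          (\<forall>x\<in>{-1..1}. \<forall>p. H x p = vp x * (exp (2*p) - 1) + vm x * (exp (-2*p) - 1)) \<and>
          (\<forall>x\<in>{-1..1}. vp x \<ge> 0 \<and> vm x \<ge> 0) \<and>
          vm (-1) = 0 \<and> (\<forall>x\<in>{-1<..1}. vm x > 0) \<and>
          vp 1 = 0 \<and> (\<forall>x\<in>{-1..<1}. vp x > 0) \<and>
          deriv vp 1 < 0 \<and> deriv vm (-1) > 0))
    \<or> \<comment> \<open>(C-b)\<close>
      (K = {-1..1} \<and> cond_H K H \<and> cond_S H)))"

definition ham_sol :: "real set \<Rightarrow> (real \<Rightarrow> real \<Rightarrow> real) \<Rightarrow> real set \<Rightarrow>
    (real \<Rightarrow> real) \<Rightarrow> (real \<Rightarrow> real) \<Rightarrow> bool" where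
  "ham_sol K H J X P = (\<forall>t\<in>J. X t \<in> K \<and>
     (X has_real_derivative pd_p H (X t) (P t)) (at t within J) \<and>
     (P has_real_derivative - pd_x K H (X t) (P t)) (at t within J))"

definition Gt :: "real set \<Rightarrow> (real \<Rightarrow> real \<Rightarrow> real) \<Rightarrow> (real \<Rightarrow> real) \<Rightarrow> real \<Rightarrow> (real \<times> real) set" where
  "Gt K H I0 t = {(X t, P t) | X P. \<exists>x\<in>interior K. \<exists>T>t.
      ham_sol K H {0..<T} X P \<and> X 0 = x \<and> P 0 = deriv I0 x}"

definition Gset :: "real set \<Rightarrow> (real \<Rightarrow> real) \<Rightarrow> (real \<times> real) set" where
  "Gset K I0 = {(x, deriv I0 x) | x. x \<in> interior K}"

definition overhang :: "(real \<times> real) set \<Rightarrow> real \<Rightarrow> bool" where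
  "overhang G x = (\<exists>y1 y2. y1 \<noteq> y2 \<and> (x, y1) \<in> G \<and> (x, y2) \<in> G)"

definition C1_linearization :: "real set \<Rightarrow> (real \<Rightarrow> real \<Rightarrow> real) \<Rightarrow> real \<Rightarrow> bool" where
  "C1_linearization K H x0 = (\<exists>U V (\<Psi> :: real \<times> real \<Rightarrow> real \<times> real) \<Phi>.
     open U \<and> open V \<and> (x0, 0) \<in> U \<and> (x0, 0) \<in> V \<and>
     \<Psi> ` U = V \<and> (\<forall>z\<in>U. \<Phi> (\<Psi> z) = z) \<and> (\<forall>w\<in>V. \<Psi> (\<Phi> w) = w) \<and> \<Phi> ` V = U \<and>
     Ck2 1 U (\<lambda>z. fst (\<Psi> z)) \<and> Ck2 1 U (\<lambda>z. snd (\<Psi> z)) \<and>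
     Ck2 1 V (\<lambda>w. fst (\<Phi> w)) \<and> Ck2 1 V (\<lambda>w. snd (\<Phi> w)) \<and>
     \<Psi> (x0, 0) = (x0, 0) \<and> (\<Psi> has_derivative id) (at (x0, 0)) \<and>
     (\<forall>J (\<gamma> :: real \<Rightarrow> real) (\<eta> :: real \<Rightarrow> real). is_interval J \<and> (\<forall>t\<in>J. (\<gamma> t, \<eta> t) \<in> U) \<longrightarrow>
        (ham_sol K H J \<gamma> \<eta> \<longleftrightarrow>
          (let \<xi> = (\<lambda>t. fst (\<Psi> (\<gamma> t, \<eta> t))); \<zeta> = (\<lambda>t. snd (\<Psi> (\<gamma> t, \<eta> t)));
               m = pd_xp K H x0 0; c = pd_pp H x0 0 in
           \<forall>t\<in>J. (\<xi> has_real_derivative m * (\<xi> t - x0) + c * \<zeta> t) (at t within J) \<and>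
                  (\<zeta> has_real_derivative - m * \<zeta> t) (at t within J)))))"

end

theory Submission
  imports Defs
begin

text \<open>
  All trajectories that matter stay in a compact box, so the Hamiltonian field may be replaced by its
  composition with the projection onto that box, which is bounded and globally Lipschitz.

  (a) Let \<open>X\<^sub>t(x)\<close> be the position at time \<open>t\<close> of the trajectory started at \<open>(x, I0'(x))\<close>. The
  linearization gives \<open>X\<^sub>t(x\<^sub>0) = x\<^sub>0\<close> with negative derivative once \<open>t > t\<^sub>0\<close>, while trajectories started
  near the right end, where \<open>I0'\<close> is large, are caught in an invariant corner and stay to the right of
  \<open>x\<^sub>0\<close>. Hence \<open>X\<^sub>t(x) = x\<^sub>0\<close> for some \<open>x > x\<^sub>0\<close>. Both the corner and its mirror image also trap the cut-off
  flow, so this trajectory never entered them; barriers and energy conservation then keep it in the box,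
  and it solves the original equations. Its momentum is nonzero because the equilibrium is a fixed point.

  (b) Energies \<open>H(x, I0'(x))\<close> increase to 0 as \<open>x\<close> decreases to some \<open>a\<close>. The zero-energy orbit of \<open>a\<close>
  crosses a given vertical line at most once, while an orbit of slightly negative energy oscillates between
  two turning points. All crossings are transversal, hence vary continuously with \<open>x\<close>, and for every
  large \<open>t\<close> some orbit performs an upward and another one a downward crossing exactly at time \<open>t\<close>.
\<close>

section \<open>Ordinary differential equations with a bounded Lipschitz field\<close>

text \<open>In (a) the box must be fixed before there is a flow, although a trajectory is confined
  only by what is known about its end. The choices are therefore nested: a starting point
  \<open>xh\<close> in the right corner, then barriers beyond it and beyond the left corner for the
  sides, then the largest energy of the initial graph over [x0, xh] for the height. The trajectory
  from \<open>xh\<close> need not solve the original equations; it only supplies a value for the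
  intermediate value theorem. The linearization describes solutions only while they stay near the
  equilibrium, so it is applied to one trajectory that starts close enough to remain there up to
  time t. The time t0 is the zero of 1 + c I0''(x0) E(t), where E(t) is the integral of exp(-2mr)
  over [0, t]; this factor decides the sign of the slope of the time-t position at x0. In (b)
  confinement comes from the equilibria themselves: over m1 and m2 the energy is nonnegative and
  vanishes only at the fixed point. The two momenta over the common position differ because the
  orbits cross it in opposite directions.\<close>

lemma has_vector_derivative_within_Ici:
  fixes f :: "real \<Rightarrow> 'a::real_normed_vector"
  assumes "(f has_vector_derivative d) (at s within {a..b})" "a \<le> s" "s < b"
  shows "(f has_vector_derivative d) (at s within {a..})"
proof -
  have "at s within {a..b} = at s within {a..}"
    by (rule at_within_nhd[of _ "{..<b}"]) (use assms in auto)
  thus ?thesis using assms(1) by simp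
qed

text \<open>Picard iteration in a weighted supremum norm: the unknown is u(s) = exp(-2Ls) phi(s). A
  bounded field lets phi grow at most linearly, so u is bounded, and the weight makes the Picard
  operator a contraction with factor 1/2 on all of [0, \<infinity>) at once, without gluing local
  solutions.\<close>

lemma lipschitz_bounded_ode_exists:
  fixes f :: "'a::euclidean_space \<Rightarrow> 'a"
  assumes L: "L > 0" and lip: "\<And>z w. norm (f z - f w) \<le> L * norm (z - w)"
    and M: "\<And>z. norm (f z) \<le> M"
  shows "\<exists>\<phi>. \<phi> 0 = z \<and> (\<forall>s\<ge>0. (\<phi> has_vector_derivative f (\<phi> s)) (at s within {0..}))"
proof -
  have M0: "M \<ge> 0" using M[of 0] norm_ge_zero order_trans by blast
  have cf: "continuous_on S f" for S
  proof (rule continuous_on_subset[OF _ subset_UNIV], rule lipschitz_on_continuous_on)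
    show "L-lipschitz_on UNIV f"
      using lip L by (auto simp: lipschitz_on_def dist_norm)
  qed
  \<comment> \<open>\<open>g u\<close> is the field along the unweighted curve and
    \<open>h u\<close> the Picard operator in weighted form. Bounded continuous functions live on
    all reals here, hence \<open>max s 0\<close> freezes the operator at negative times.\<close>
  define g where "g u r = f (exp (2 * L * r) *\<^sub>R apply_bcontfun u r)" for u :: "real \<Rightarrow>\<^sub>C 'a" and r
  define h where "h u s = exp (- (2 * L * max s 0)) *\<^sub>R (z + integral {0..max s 0} (g u))" for u s
  have cg: "continuous_on S (g u)" for S u
    unfolding g_def by (intro continuous_on_compose2[OF cf[of UNIV]] continuous_intros) auto
  have ig: "g u integrable_on {a..b}" for u a b
    by (rule integrable_continuous_real[OF cg])
  have ci: "continuous_on {0..} (\<lambda>s. integral {0..s} (g u))" for u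
  proof -
    have "((\<lambda>s. integral {0..s} (g u)) has_vector_derivative g u s) (at s within {0..})" if "s \<ge> 0" for s
      by (rule has_vector_derivative_within_Ici[of _ _ _ _ "s+1"], rule integral_has_vector_derivative[OF cg])
         (use that in auto)
    thus ?thesis
      using continuous_on_vector_derivative[of "{0..}" "\<lambda>s. integral {0..s} (g u)" "g u"] by auto
  qed
  have ch: "continuous_on UNIV (h u)" for u
    unfolding h_def
    by (intro continuous_intros continuous_on_compose2[OF ci]) auto
  have nh: "norm (h u s) \<le> norm z + M / (2 * L)" for u s
  proof -
    let ?s = "max s 0"
    have "norm (integral {0..?s} (g u)) \<le> integral {0..?s} (\<lambda>r. M)"
      by (intro integral_norm_bound_integral ig) (auto simp: g_def M integrable_const_ivl)
    hence 1: "norm (integral {0..?s} (g u)) \<le> M * ?s" by (simp add: mult.commute)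
    have 2: "2 * L * ?s \<le> exp (2 * L * ?s)"
      using exp_ge_add_one_self[of "2 * L * ?s"] by linarith
    have "norm (h u s) = exp (- (2 * L * ?s)) * norm (z + integral {0..?s} (g u))"
      by (simp add: h_def)
    also have "\<dots> \<le> exp (- (2 * L * ?s)) * (norm z + M * ?s)"
      by (intro mult_left_mono order_trans[OF norm_triangle_ineq] add_left_mono 1) auto
    also have "\<dots> = exp (- (2 * L * ?s)) * norm z + M / (2 * L) * (exp (- (2 * L * ?s)) * (2 * L * ?s))"
      using L by (simp add: field_simps)
    also have "\<dots> \<le> 1 * norm z + M / (2 * L) * 1"
    proof (intro add_mono mult_right_mono mult_left_mono)
      show "exp (- (2 * L * ?s)) * (2 * L * ?s) \<le> 1"
        using 2 by (simp add: exp_minus field_simps)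
    qed (use L M0 in \<open>auto intro!: mult_nonneg_nonneg\<close>)
    finally show ?thesis by simp
  qed
  have hb: "h u \<in> bcontfun" for u by (rule bcontfun_normI[OF ch nh])
  define T where "T u = Bcontfun (h u)" for u
  have Th: "apply_bcontfun (T u) = h u" for u
    unfolding T_def using hb by (rule Bcontfun_inverse)
  have contr: "dist (T u) (T v) \<le> (1/2) * dist u v" for u v
  proof (rule dist_bound)
    fix s :: real
    let ?s = "max s 0"
    have "norm (integral {0..?s} (\<lambda>r. g u r - g v r)) \<le> integral {0..?s} (\<lambda>r. L * exp (2 * L * r) * dist u v)"
    proof (intro integral_norm_bound_integral)
      show "(\<lambda>r. g u r - g v r) integrable_on {0..max s 0}" by (intro integrable_diff ig)
      show "(\<lambda>r. L * exp (2 * L * r) * dist u v) integrable_on {0..max s 0}"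
        by (intro integrable_continuous_real continuous_intros)
      fix r assume "r \<in> {0..max s 0}"
      have "norm (g u r - g v r) \<le> L * norm (exp (2 * L * r) *\<^sub>R apply_bcontfun u r - exp (2 * L * r) *\<^sub>R apply_bcontfun v r)"
        unfolding g_def by (rule lip)
      also have "\<dots> = L * (exp (2 * L * r) * dist (apply_bcontfun u r) (apply_bcontfun v r))"
        by (simp add: scaleR_diff_right[symmetric] dist_norm)
      also have "\<dots> \<le> L * (exp (2 * L * r) * dist u v)"
        using L by (intro mult_left_mono dist_bounded) auto
      finally show "norm (g u r - g v r) \<le> L * exp (2 * L * r) * dist u v" by (simp add: mult.assoc)
    qed
    also have "integral {0..?s} (\<lambda>r. L * exp (2 * L * r) * dist u v) = (exp (2 * L * ?s) * dist u v / 2 - exp (2 * L * 0) * dist u v / 2)"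
    proof (rule integral_unique, rule fundamental_theorem_of_calculus)
      fix r :: real
      show "((\<lambda>r. exp (2 * L * r) * dist u v / 2) has_vector_derivative L * exp (2 * L * r) * dist u v) (at r within {0..?s})"
        unfolding has_real_derivative_iff_has_vector_derivative[symmetric]
        by (auto intro!: derivative_eq_intros)
    qed auto
    also have "\<dots> \<le> exp (2 * L * ?s) * dist u v / 2" by simp
    finally have 1: "norm (integral {0..?s} (g u) - integral {0..?s} (g v)) \<le> exp (2 * L * ?s) * dist u v / 2"
      by (simp add: integral_diff[OF ig ig])
    have "dist (h u s) (h v s) = exp (- (2 * L * ?s)) * norm (integral {0..?s} (g u) - integral {0..?s} (g v))"
      by (simp add: h_def dist_norm scaleR_diff_right[symmetric])
    also have "\<dots> \<le> exp (- (2 * L * ?s)) * (exp (2 * L * ?s) * dist u v / 2)"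
      by (intro mult_left_mono 1) auto
    also have "\<dots> = 1/2 * dist u v" by (simp add: exp_minus field_simps)
    finally show "dist (apply_bcontfun (T u) s) (apply_bcontfun (T v) s) \<le> 1/2 * dist u v"
      by (simp add: Th)
  qed
  obtain u where u: "T u = u"
    using banach_fix_type[of "1/2" T] contr by auto
  have uh: "apply_bcontfun u s = h u s" for s using Th[of u] u by simp
  define \<phi> where "\<phi> s = z + integral {0..s} (g u)" for s
  have "exp (2 * L * s) *\<^sub>R apply_bcontfun u s = \<phi> s" if "s \<ge> 0" for s
    using that by (simp add: uh h_def \<phi>_def max_def exp_minus)
  hence gphi: "g u s = f (\<phi> s)" if "s \<ge> 0" for s using that by (simp add: g_def)
  have "(\<phi> has_vector_derivative f (\<phi> s)) (at s within {0..})" if s: "s \<ge> 0" for s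
  proof -
    have "((\<lambda>s. integral {0..s} (g u)) has_vector_derivative g u s) (at s within {0..})"
      by (rule has_vector_derivative_within_Ici[of _ _ _ _ "s+1"], rule integral_has_vector_derivative[OF cg])
         (use s in auto)
    thus ?thesis
      unfolding \<phi>_def gphi[OF s, unfolded \<phi>_def, symmetric]
      by (auto intro!: derivative_eq_intros)
  qed
  moreover have "\<phi> 0 = z" by (simp add: \<phi>_def)
  ultimately show ?thesis by blast
qed

section \<open>Gronwall estimates, barriers and trapping corners\<close>

lemma nonincreasing_within:
  fixes f :: "real \<Rightarrow> real"
  assumes d: "\<And>s. s \<in> {a..b} \<Longrightarrow> (f has_real_derivative f' s) (at s within {a..b})"
    and neg: "\<And>s. s \<in> {a<..<b} \<Longrightarrow> f' s \<le> 0" and s: "s \<in> {a..b}" "u \<in> {a..b}" "s \<le> u"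
  shows "f u \<le> f s"
proof (cases "s = u")
  case False
  hence su: "s < u" using s by simp
  have "continuous_on {a..b} f" using d by (meson DERIV_continuous continuous_on_eq_continuous_within)
  hence c: "continuous_on {s..u} f" by (rule continuous_on_subset) (use s in auto)
  have "(f has_derivative (*) (f' x)) (at x)" if "s < x" "x < u" for x
  proof -
    have "(f has_real_derivative f' x) (at x within {a..b})" using d[of x] that s by auto
    moreover have "at x within {a..b} = at x" by (rule at_within_interior) (use that s in auto)
    ultimately show ?thesis by (simp add: has_field_derivative_def)
  qed
  from mvt[OF su c this] obtain \<xi> where "s < \<xi>" "\<xi> < u" "f u - f s = f' \<xi> * (u - s)" by auto
  thus ?thesis using neg[of \<xi>] s su mult_nonneg_nonneg[of "- f' \<xi>" "u - s"] by auto
qed auto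

text \<open>Multiply by the integrating factor exp(-C(s-a)). Neither \<open>C\<close> nor
  \<open>d\<close> carries a sign, so the lemma also yields lower bounds when applied to -d.\<close>

lemma gronwall_diff:
  fixes d :: "real \<Rightarrow> real"
  assumes d: "\<And>s. s \<in> {a..b} \<Longrightarrow> (d has_real_derivative d' s) (at s within {a..b})"
    and le: "\<And>s. s \<in> {a..b} \<Longrightarrow> d' s \<le> C * d s" and s: "s \<in> {a..b}"
  shows "d s \<le> exp (C * (s - a)) * d a"
proof -
  have "exp (- C * (s - a)) * d s \<le> exp (- C * (a - a)) * d a"
  proof (rule nonincreasing_within[of a b "\<lambda>s. exp (- C * (s - a)) * d s"])
    fix u assume u: "u \<in> {a..b}"
    show "((\<lambda>s. exp (- C * (s - a)) * d s) has_real_derivative exp (- C * (u - a)) * (d' u - C * d u)) (at u within {a..b})"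
      by (rule derivative_eq_intros d[OF u] refl)+ (simp add: algebra_simps)
  next
    fix u assume "u \<in> {a<..<b}"
    thus "exp (- C * (u - a)) * (d' u - C * d u) \<le> 0"
      using le[of u] by (intro mult_nonneg_nonpos) auto
  qed (use s in auto)
  hence le: "inverse (exp (C * (s - a))) * d s \<le> d a"
    by (simp add: exp_minus)
  have "d s = exp (C * (s - a)) * (inverse (exp (C * (s - a))) * d s)" by simp
  also have "\<dots> \<le> exp (C * (s - a)) * d a" by (intro mult_left_mono le) auto
  finally show ?thesis .
qed

text \<open>The squared distance d satisfies |d'| <= 2Ld, so Gronwall applies to d and to -d. The
  second bound says that solutions cannot merge in finite time and makes the time maps
  injective.\<close>

lemma ode_solution_bounds:
  fixes f :: "'a::euclidean_space \<Rightarrow> 'a"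
  assumes L: "L \<ge> 0" and lip: "\<And>z w. norm (f z - f w) \<le> L * norm (z - w)"
    and p: "\<And>s. s \<in> {0..t} \<Longrightarrow> (\<phi> has_vector_derivative f (\<phi> s)) (at s within {0..t})"
    and q: "\<And>s. s \<in> {0..t} \<Longrightarrow> (\<psi> has_vector_derivative f (\<psi> s)) (at s within {0..t})"
    and t: "0 \<le> t"
  shows "norm (\<phi> t - \<psi> t) \<le> exp (L * t) * norm (\<phi> 0 - \<psi> 0)"
    and "norm (\<phi> 0 - \<psi> 0) \<le> exp (L * t) * norm (\<phi> t - \<psi> t)"
proof -
  define d where "d s = (\<phi> s - \<psi> s) \<bullet> (\<phi> s - \<psi> s)" for s
  define d' where "d' s = 2 * ((\<phi> s - \<psi> s) \<bullet> (f (\<phi> s) - f (\<psi> s)))" for s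
  have dd: "(d has_real_derivative d' s) (at s within {0..t})" if "s \<in> {0..t}" for s
  proof -
    have "((\<lambda>s. \<phi> s - \<psi> s) has_derivative (\<lambda>x. x *\<^sub>R (f (\<phi> s) - f (\<psi> s)))) (at s within {0..t})"
      using has_vector_derivative_diff[OF p[OF that] q[OF that]] by (simp add: has_vector_derivative_def)
    from has_derivative_inner[OF this this]
    have "(d has_derivative (\<lambda>h. (\<phi> s - \<psi> s) \<bullet> h *\<^sub>R (f (\<phi> s) - f (\<psi> s)) + h *\<^sub>R (f (\<phi> s) - f (\<psi> s)) \<bullet> (\<phi> s - \<psi> s))) (at s within {0..t})"
      by (simp add: d_def[abs_def])
    moreover have "(\<lambda>h. (\<phi> s - \<psi> s) \<bullet> h *\<^sub>R (f (\<phi> s) - f (\<psi> s)) + h *\<^sub>R (f (\<phi> s) - f (\<psi> s)) \<bullet> (\<phi> s - \<psi> s)) = (*) (d' s)"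
      by (auto simp: d'_def inner_commute algebra_simps)
    ultimately show ?thesis by (simp add: has_field_derivative_def)
  qed
  have bd: "\<bar>d' s\<bar> \<le> 2 * L * d s" for s
  proof -
    have "\<bar>(\<phi> s - \<psi> s) \<bullet> (f (\<phi> s) - f (\<psi> s))\<bar> \<le> norm (\<phi> s - \<psi> s) * norm (f (\<phi> s) - f (\<psi> s))"
      by (rule Cauchy_Schwarz_ineq2)
    also have "\<dots> \<le> norm (\<phi> s - \<psi> s) * (L * norm (\<phi> s - \<psi> s))"
      by (intro mult_left_mono lip) auto
    also have "\<dots> = L * d s" by (simp add: d_def dot_square_norm power2_eq_square)
    finally show ?thesis by (simp add: d'_def abs_mult)
  qed
  have dn: "d s = (norm (\<phi> s - \<psi> s))\<^sup>2" for s by (simp add: d_def dot_square_norm)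
  have e: "exp (2 * L * t) = (exp (L * t))\<^sup>2" by (simp add: exp_double[symmetric] mult.assoc)
  have "d t \<le> exp (2 * L * (t - 0)) * d 0"
    by (rule gronwall_diff[where d' = d' and b = t]) (use dd bd abs_ge_self t in \<open>auto intro: order_trans\<close>)
  hence "(norm (\<phi> t - \<psi> t))\<^sup>2 \<le> (exp (L * t) * norm (\<phi> 0 - \<psi> 0))\<^sup>2"
    by (simp add: dn e power_mult_distrib)
  thus "norm (\<phi> t - \<psi> t) \<le> exp (L * t) * norm (\<phi> 0 - \<psi> 0)"
    by (rule power2_le_imp_le) auto
  have "- d t \<le> exp (- 2 * L * (t - 0)) * (- d 0)"
  proof (rule gronwall_diff[where d' = "\<lambda>s. - d' s" and b = t])
    show "- d' s \<le> - 2 * L * - d s" for s using bd[of s] by auto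
    show "((\<lambda>s. - d s) has_real_derivative - d' s) (at s within {0..t})" if "s \<in> {0..t}" for s
      using dd[OF that] by (auto intro!: derivative_eq_intros)
  qed (use t in auto)
  hence "exp (- (2 * L * t)) * d 0 \<le> d t" by simp
  hence "d 0 \<le> exp (2 * L * t) * d t" by (simp add: exp_minus field_simps)
  hence "(norm (\<phi> 0 - \<psi> 0))\<^sup>2 \<le> (exp (L * t) * norm (\<phi> t - \<psi> t))\<^sup>2"
    by (simp add: dn e power_mult_distrib)
  thus "norm (\<phi> 0 - \<psi> 0) \<le> exp (L * t) * norm (\<phi> t - \<psi> t)"
    by (rule power2_le_imp_le) auto
qed

text \<open>First contact: if X meets b for the first time at r, the difference has a negative
  derivative there, so it was positive shortly before, against the minimality of r.\<close>

lemma barrier: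
  fixes X b :: "real \<Rightarrow> real"
  assumes X: "\<And>s. s \<in> {a..t} \<Longrightarrow> (X has_real_derivative X' s) (at s within {a..t})"
    and b: "\<And>s. s \<in> {a..t} \<Longrightarrow> (b has_real_derivative b' s) (at s within {a..t})"
    and init: "X a < b a"
    and cross: "\<And>s. s \<in> {a..t} \<Longrightarrow> X s = b s \<Longrightarrow> X' s < b' s"
    and s: "s \<in> {a..t}"
  shows "X s < b s"
proof (rule ccontr)
  assume n: "\<not> X s < b s"
  define f where "f u = X u - b u" for u
  have df: "(f has_real_derivative X' u - b' u) (at u within {a..t})" if "u \<in> {a..t}" for u
    unfolding f_def using X[OF that] b[OF that] by (auto intro!: derivative_eq_intros)
  have cf: "continuous_on {a..t} f" using df by (meson DERIV_continuous continuous_on_eq_continuous_within)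
  define S where "S = {u \<in> {a..t}. f u \<ge> 0}"
  have "closed S" unfolding S_def
    using continuous_closed_preimage[OF cf, of "{0..}"] by (simp add: vimage_def Int_def)
  moreover have sS: "s \<in> S" using s n by (auto simp: S_def f_def)
  moreover have bb: "bdd_below S" by (auto simp: S_def bdd_below_def)
  ultimately have iS: "Inf S \<in> S" by (intro closed_contains_Inf) auto
  define r where "r = Inf S"
  have r: "r \<in> {a..t}" "f r \<ge> 0" using iS by (auto simp: r_def S_def)
  have lt: "f u < 0" if "u \<in> {a..t}" "u < r" for u
    using that bb cInf_lower[of u S] by (force simp: S_def r_def not_le)
  have r0: "r > a" using r init by (cases "r = a") (auto simp: f_def)
  have fr0: "f r = 0"
  proof (rule ccontr)
    assume "f r \<noteq> 0"
    hence "f r > 0" using r by simp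
    moreover have "f a < 0" using init by (simp add: f_def)
    ultimately obtain u where "a \<le> u" "u \<le> r" "f u = 0"
      using IVT'[of f a 0 r] continuous_on_subset[OF cf, of "{a..r}"] r by auto
    with lt[of u] \<open>f r \<noteq> 0\<close> r show False by (cases "u = r") auto
  qed
  have neg: "X' r - b' r < 0" using cross[of r] fr0 r by (auto simp: f_def)
  from has_real_derivative_neg_dec_left[OF df[OF r(1)] neg]
  obtain d where d: "d > 0" "\<And>h. 0 < h \<Longrightarrow> r - h \<in> {a..t} \<Longrightarrow> h < d \<Longrightarrow> f r < f (r - h)" by auto
  \<comment> \<open>The step back is cut at \<open>r - a\<close> so that the earlier time stays in
    the interval.\<close>
  have "f r < f (r - min (d/2) (r - a))" by (rule d(2)) (use d r r0 in auto)
  moreover have "f (r - min (d/2) (r - a)) < 0" by (rule lt) (use d r r0 in auto)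
  ultimately show False using fr0 by simp
qed

text \<open>Squaring removes the kink of the positive part; this makes the squared distance to a
  quadrant differentiable in time.\<close>

lemma has_real_derivative_max_square:
  "((\<lambda>r::real. (max 0 r)\<^sup>2) has_real_derivative 2 * max 0 r) (at r)"
proof -
  consider "r < 0" | "r > 0" | "r = 0" by linarith
  thus ?thesis
  proof cases
    case 1
    have "((\<lambda>r::real. 0) has_real_derivative 2 * max 0 r) (at r)" using 1 by auto
    thus ?thesis
      by (rule has_field_derivative_transform_within_open[of _ _ _ "{..<0}"]) (use 1 in auto)
  next
    case 2
    have "((\<lambda>r::real. r^2) has_real_derivative 2 * max 0 r) (at r)" 
      using 2 by (auto intro!: derivative_eq_intros)
    thus ?thesis
      by (rule has_field_derivative_transform_within_open[of _ _ _ "{0<..}"]) (use 2 in auto)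
  next
    case 3
    have "((\<lambda>h. (max 0 (0 + h))\<^sup>2 / h) \<longlongrightarrow> 0) (at (0::real))"
    proof (rule Lim_null_comparison[of _ "\<lambda>h. \<bar>h\<bar>"])
      show "\<forall>\<^sub>F h in at (0::real). norm ((max 0 (0 + h))\<^sup>2 / h) \<le> \<bar>h\<bar>"
        by (auto simp: max_def power2_eq_square)
      show "((\<lambda>h::real. \<bar>h\<bar>) \<longlongrightarrow> 0) (at 0)" by (auto intro!: tendsto_eq_intros)
    qed
    thus ?thesis using 3 by (simp add: DERIV_def)
  qed
qed

text \<open>The squared distance to the moving corner satisfies a Gronwall inequality, because the
  field at a point outside the corner is Lipschitz-close to the field at its projection.\<close>
lemma corner_trap:
  fixes G1 G2 :: "real \<Rightarrow> real \<Rightarrow> real"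
  assumes L: "L \<ge> 0"
    and l1: "\<And>x p x' p'. \<bar>G1 x p - G1 x' p'\<bar> \<le> L * (\<bar>x - x'\<bar> + \<bar>p - p'\<bar>)"
    and l2: "\<And>x p x' p'. \<bar>G2 x p - G2 x' p'\<bar> \<le> L * (\<bar>x - x'\<bar> + \<bar>p - p'\<bar>)"
    and M: "M \<ge> 0" and q: "q \<ge> 0"
    and T1: "\<And>p. p \<ge> q * exp (- M * (t - u)) \<Longrightarrow> G1 y p \<ge> 0"
    and T2: "\<And>s x. s \<in> {0..t - u} \<Longrightarrow> x \<ge> y \<Longrightarrow> G2 x (q * exp (- M * s)) \<ge> - M * (q * exp (- M * s))"
    and X: "\<And>s. s \<in> {u..t} \<Longrightarrow> (X has_real_derivative G1 (X s) (P s)) (at s within {u..t})"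
    and P: "\<And>s. s \<in> {u..t} \<Longrightarrow> (P has_real_derivative G2 (X s) (P s)) (at s within {u..t})"
    and init: "X u \<ge> y" "P u \<ge> q" and ut: "u \<le> t"
  shows "X t \<ge> y"
proof -
  define Q where "Q s = q * exp (- M * (s - u))" for s
  define a where "a s = max 0 (y - X s)" for s
  define b where "b s = max 0 (Q s - P s)" for s
  define d where "d s = (a s)\<^sup>2 + (b s)\<^sup>2" for s
  define d' where "d' s = 2 * a s * (- G1 (X s) (P s)) + 2 * b s * (- M * Q s - G2 (X s) (P s))" for s
  have Qd: "(Q has_real_derivative - M * Q s) (at s within S)" for s S
    unfolding Q_def by (auto intro!: derivative_eq_intros)
  have dd: "(d has_real_derivative d' s) (at s within {u..t})" if s: "s \<in> {u..t}" for s
  proof -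
    have 1: "((\<lambda>s. y - X s) has_real_derivative - G1 (X s) (P s)) (at s within {u..t})"
      using X[OF s] by (auto intro!: derivative_eq_intros)
    have 2: "((\<lambda>s. Q s - P s) has_real_derivative - M * Q s - G2 (X s) (P s)) (at s within {u..t})"
      using P[OF s] by (auto intro!: derivative_eq_intros Qd)
    show ?thesis unfolding d_def a_def b_def d'_def
      by (rule DERIV_add DERIV_chain2[OF has_real_derivative_max_square] 1 2)+
  qed
  have bd: "d' s \<le> 4 * L * d s" if s: "s \<in> {u..t}" for s
  proof -
    let ?K = "L * (a s + b s)"
    have ab: "a s \<ge> 0" "b s \<ge> 0" by (auto simp: a_def b_def)
    have A: "a s * (- G1 (X s) (P s)) \<le> a s * ?K"
    proof (cases "a s > 0")
      case True
      \<comment> \<open>The level \<open>Q\<close> only decays, so its final value is a threshold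
        above which the field on the edge x = y points right at all times in question.\<close>
      have "Q s \<ge> q * exp (- M * (t - u))" using s q M unfolding Q_def
        by (intro mult_left_mono) (auto intro!: mult_left_mono)
      hence "G1 y (max (P s) (Q s)) \<ge> 0" by (intro T1) auto
      moreover have "\<bar>G1 y (max (P s) (Q s)) - G1 (X s) (P s)\<bar> \<le> L * (\<bar>y - X s\<bar> + \<bar>max (P s) (Q s) - P s\<bar>)" by (rule l1)
      moreover have "\<bar>y - X s\<bar> = a s" "\<bar>max (P s) (Q s) - P s\<bar> = b s"
        using True by (auto simp: a_def b_def max_def split: if_splits)
      ultimately have "- G1 (X s) (P s) \<le> ?K" by auto
      thus ?thesis using ab by (intro mult_left_mono) auto
    next
      case False thus ?thesis using ab by auto
    qed
    have B: "b s * (- M * Q s - G2 (X s) (P s)) \<le> b s * ?K"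
    proof (cases "b s > 0")
      case True
      \<comment> \<open>The point (max (X s) y, Q s) lies on the lower edge of the corner and
        differs from the trajectory by exactly \<open>a s\<close> and \<open>b s\<close>.\<close>
      have "G2 (max (X s) y) (Q s) \<ge> - M * Q s" unfolding Q_def by (rule T2) (use s in auto)
      moreover have "\<bar>G2 (max (X s) y) (Q s) - G2 (X s) (P s)\<bar> \<le> L * (\<bar>max (X s) y - X s\<bar> + \<bar>Q s - P s\<bar>)" by (rule l2)
      moreover have "\<bar>max (X s) y - X s\<bar> = a s" "\<bar>Q s - P s\<bar> = b s"
        using True by (auto simp: a_def b_def max_def split: if_splits)
      ultimately have "- M * Q s - G2 (X s) (P s) \<le> ?K" by auto
      thus ?thesis using ab by (intro mult_left_mono) auto
    next
      case False thus ?thesis using ab by auto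
    qed
    have "d' s \<le> 2 * (a s * ?K) + 2 * (b s * ?K)" using A B by (simp add: d'_def)
    also have "\<dots> = 2 * L * (a s + b s)\<^sup>2" by (simp add: power2_eq_square algebra_simps)
    also have "\<dots> \<le> 2 * L * (2 * d s)"
    proof (intro mult_left_mono)
      have "0 \<le> (a s - b s)\<^sup>2" by simp
      thus "(a s + b s)\<^sup>2 \<le> 2 * d s" unfolding d_def power2_eq_square by (simp add: algebra_simps)
    qed (use L in auto)
    finally show ?thesis by simp
  qed
  have "d t \<le> exp (4 * L * (t - u)) * d u"
    by (rule gronwall_diff[OF dd bd]) (use ut in auto)
  also have "d u = 0" using init by (simp add: d_def a_def b_def Q_def)
  finally have "a t = 0" by (simp add: d_def sum_power2_le_zero_iff)
  thus ?thesis by (simp add: a_def max_def split: if_splits)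
qed

section \<open>The Hamiltonian flow cut off to a box\<close>

text \<open>A continuation argument: \<open>step\<close> may use that the path has stayed in the
  closed set \<open>C\<close> so far, which is where the unclamped equations and conservation laws
  are available. At the first exit from \<open>U\<close> the whole past lies in \<open>C\<close>,
  because \<open>C\<close> is closed.\<close>

lemma stays_inside:
  fixes \<phi> :: "real \<Rightarrow> 'a::topological_space"
  assumes c: "continuous_on {0..t} \<phi>" and U: "open U" and C: "closed C" "U \<subseteq> C"
    and 0: "\<phi> 0 \<in> U"
    and step: "\<And>r. r \<in> {0..t} \<Longrightarrow> (\<forall>s\<in>{0..r}. \<phi> s \<in> C) \<Longrightarrow> \<phi> r \<in> U"
    and s: "s \<in> {0..t}"
  shows "\<phi> s \<in> U"
proof (rule ccontr)
  assume n: "\<phi> s \<notin> U"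
  define S where "S = {u \<in> {0..t}. \<phi> u \<in> - U}"
  have "closed S"
    using continuous_closed_preimage[OF c, of "- U"] U by (simp add: S_def vimage_def Int_def closed_Compl)
  moreover have "s \<in> S" using s n by (simp add: S_def)
  moreover have bb: "bdd_below S" by (auto simp: S_def bdd_below_def)
  ultimately have iS: "Inf S \<in> S" by (intro closed_contains_Inf) auto
  define r where "r = Inf S"
  have r: "r \<in> {0..t}" "\<phi> r \<notin> U" using iS by (auto simp: r_def S_def)
  have lt: "\<phi> u \<in> U" if "u \<in> {0..t}" "u < r" for u
    using that bb cInf_lower[of u S] by (force simp: S_def r_def not_le)
  have r0: "r > 0" using r 0 by (cases "r = 0") auto
  have "\<phi> ` {0..r} \<subseteq> C"
  proof -
    have cl: "closure {0..<r} = {0..r}" using r0 by simp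
    have "\<phi> ` {0..<r} \<subseteq> C" using lt r C(2) by auto
    moreover have "continuous_on (closure {0..<r}) \<phi>"
      unfolding cl by (rule continuous_on_subset[OF c]) (use r in auto)
    ultimately show ?thesis using image_closure_subset[of "{0..<r}" \<phi> C] C(1) cl by auto
  qed
  hence "\<phi> r \<in> U" by (intro step r) auto
  with r show False by simp
qed

definition clamp_box :: "real \<Rightarrow> real \<Rightarrow> real \<Rightarrow> real \<times> real \<Rightarrow> real \<times> real" where
  "clamp_box lo hi B z = (max lo (min hi (fst z)), max (- B) (min B (snd z)))"

lemma clamp_box_in: "lo \<le> hi \<Longrightarrow> 0 \<le> B \<Longrightarrow> clamp_box lo hi B z \<in> {lo..hi} \<times> {-B..B}"
  by (auto simp: clamp_box_def)

lemma clamp_box_id: "z \<in> {lo..hi} \<times> {-B..B} \<Longrightarrow> clamp_box lo hi B z = z"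
  by (auto simp: clamp_box_def max_def min_def)

lemma clamp_box_lipschitz: "norm (clamp_box lo hi B z - clamp_box lo hi B w) \<le> norm (z - w)"
proof -
  have 1: "\<bar>max a (min b x) - max a (min b y)\<bar> \<le> \<bar>x - y\<bar>" for a b x y :: real
    by (auto simp: max_def min_def)
  have "norm (fst (clamp_box lo hi B z - clamp_box lo hi B w)) \<le> norm (fst (z - w))"
    "norm (snd (clamp_box lo hi B z - clamp_box lo hi B w)) \<le> norm (snd (z - w))"
    using 1 by (simp_all add: clamp_box_def)
  thus ?thesis unfolding norm_prod_def by (intro real_sqrt_le_mono add_mono power_mono) auto
qed

lemma partial_derivatives:
  fixes g :: "real \<times> real \<Rightarrow> real"
  assumes "(g has_derivative (\<lambda>h. a * fst h + b * snd h)) (at (x, p))"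
  shows "((\<lambda>p. g (x, p)) has_real_derivative b) (at p)"
    and "((\<lambda>x. g (x, p)) has_real_derivative a) (at x)"
proof -
  have "((\<lambda>p. (x, p)) has_derivative (\<lambda>h. (0, h))) (at p)" by (auto intro!: derivative_eq_intros)
  from has_derivative_compose[OF this assms]
  show "((\<lambda>p. g (x, p)) has_real_derivative b) (at p)" by (simp add: has_field_derivative_def)
  have "((\<lambda>x. (x, p)) has_derivative (\<lambda>h. (h, 0))) (at x)" by (auto intro!: derivative_eq_intros)
  from has_derivative_compose[OF this assms]
  show "((\<lambda>x. g (x, p)) has_real_derivative a) (at x)" by (simp add: has_field_derivative_def)
qed

text \<open>To be used with the interior of K for \<open>I\<close>. \<open>Hxp\<close> and
  \<open>Hpx\<close> are kept apart because the derivatives of \<open>Hx\<close> and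
  \<open>Hp\<close> come with independent witnesses; their agreement is proved on the line p = 0.
  \<open>coercive\<close> is what turns an energy bound into a momentum bound.\<close>

locale hamiltonian =
  fixes I :: "real set" and H Hx Hp Hxx Hxp Hpx Hpp :: "real \<times> real \<Rightarrow> real"
  assumes open_I: "open I" and interval_I: "is_interval I"
    and dH: "\<And>z. fst z \<in> I \<Longrightarrow> (H has_derivative (\<lambda>h. Hx z * fst h + Hp z * snd h)) (at z)"
    and dHx: "\<And>z. fst z \<in> I \<Longrightarrow> (Hx has_derivative (\<lambda>h. Hxx z * fst h + Hxp z * snd h)) (at z)"
    and dHp: "\<And>z. fst z \<in> I \<Longrightarrow> (Hp has_derivative (\<lambda>h. Hpx z * fst h + Hpp z * snd h)) (at z)"
    and cHxx: "continuous_on (I \<times> UNIV) Hxx" and cHxp: "continuous_on (I \<times> UNIV) Hxp"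
    and cHpx: "continuous_on (I \<times> UNIV) Hpx" and cHpp: "continuous_on (I \<times> UNIV) Hpp"
    and H0: "\<And>x. x \<in> I \<Longrightarrow> H (x, 0) = 0"
    and Hpp_pos: "\<And>z. fst z \<in> I \<Longrightarrow> Hpp z > 0"
    and coercive: "\<And>C E. compact C \<Longrightarrow> C \<subseteq> I \<Longrightarrow> \<exists>B. \<forall>x\<in>C. \<forall>p. H (x, p) \<le> E \<longrightarrow> \<bar>p\<bar> < B"
begin

lemma Icc_subset: "lo \<in> I \<Longrightarrow> hi \<in> I \<Longrightarrow> {lo..hi} \<subseteq> I"
  using mem_is_interval_1_I[OF interval_I] by (meson atLeastAtMost_iff subsetI)

lemma cH: "continuous_on (I \<times> UNIV) H" and cHx: "continuous_on (I \<times> UNIV) Hx"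
  and cHp: "continuous_on (I \<times> UNIV) Hp"
proof -
  have g: "continuous_on (I \<times> UNIV) g"
    if "\<And>z. fst z \<in> I \<Longrightarrow> (g has_derivative g' z) (at z)" for g :: "real \<times> real \<Rightarrow> real" and g'
  proof (intro continuous_at_imp_continuous_on ballI)
    fix z assume "z \<in> I \<times> (UNIV :: real set)"
    hence "fst z \<in> I" by auto
    from has_derivative_continuous[OF that[OF this]] show "isCont g z" .
  qed
  show "continuous_on (I \<times> UNIV) H" by (rule g[OF dH])
  show "continuous_on (I \<times> UNIV) Hx" by (rule g[OF dHx])
  show "continuous_on (I \<times> UNIV) Hp" by (rule g[OF dHp])
qed

lemma dH_p: "x \<in> I \<Longrightarrow> ((\<lambda>p. H (x, p)) has_real_derivative Hp (x, p)) (at p)"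
  and dH_x: "x \<in> I \<Longrightarrow> ((\<lambda>x. H (x, p)) has_real_derivative Hx (x, p)) (at x)"
  and dHx_p: "x \<in> I \<Longrightarrow> ((\<lambda>p. Hx (x, p)) has_real_derivative Hxp (x, p)) (at p)"
  and dHp_p: "x \<in> I \<Longrightarrow> ((\<lambda>p. Hp (x, p)) has_real_derivative Hpp (x, p)) (at p)"
  and dHp_x: "x \<in> I \<Longrightarrow> ((\<lambda>x. Hp (x, p)) has_real_derivative Hpx (x, p)) (at x)"
  by (rule partial_derivatives[OF dH] partial_derivatives[OF dHx] partial_derivatives[OF dHp]; simp)+

lemma Hx0: "x \<in> I \<Longrightarrow> Hx (x, 0) = 0"
proof -
  assume x: "x \<in> I"
  have "((\<lambda>x. 0) has_real_derivative Hx (x, 0)) (at x)"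
    by (rule has_field_derivative_transform_within_open[OF dH_x[OF x] open_I x]) (use H0 in auto)
  thus ?thesis using DERIV_const DERIV_unique by blast
qed

lemma Hp_strict_mono: "x \<in> I \<Longrightarrow> p < q \<Longrightarrow> Hp (x, p) < Hp (x, q)"
proof -
  assume x: "x \<in> I" and pq: "p < q"
  show ?thesis
  proof (rule DERIV_pos_imp_increasing[OF pq])
    fix r
    show "\<exists>y. ((\<lambda>p. Hp (x, p)) has_real_derivative y) (at r) \<and> 0 < y"
      using dHp_p[OF x, of r] Hpp_pos[of "(x, r)"] x by auto
  qed
qed

lemma Hp_less_iff: "x \<in> I \<Longrightarrow> Hp (x, p) < Hp (x, q) \<longleftrightarrow> p < q"
  using Hp_strict_mono[of x p q] Hp_strict_mono[of x q p] by (metis less_asym linorder_neqE)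

lemma H_above_tangent:
  assumes x: "x \<in> I" and pq: "p \<noteq> q"
  shows "H (x, q) > H (x, p) + Hp (x, p) * (q - p)"
proof (cases "p < q")
  case True
  from MVT2[OF True, of "\<lambda>p. H (x, p)" "\<lambda>p. Hp (x, p)"] dH_p[OF x]
  obtain r where r: "p < r" "r < q" "H (x, q) - H (x, p) = (q - p) * Hp (x, r)" by auto
  have "(q - p) * Hp (x, p) < (q - p) * Hp (x, r)"
    using Hp_strict_mono[OF x r(1)] True by (intro mult_strict_left_mono) auto
  thus ?thesis using r(3) by (simp add: algebra_simps)
next
  case False
  hence qp: "q < p" using pq by simp
  from MVT2[OF qp, of "\<lambda>p. H (x, p)" "\<lambda>p. Hp (x, p)"] dH_p[OF x]
  obtain r where r: "q < r" "r < p" "H (x, p) - H (x, q) = (p - q) * Hp (x, r)" by auto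
  have "(p - q) * Hp (x, r) < (p - q) * Hp (x, p)"
    using Hp_strict_mono[OF x r(2)] qp by (intro mult_strict_left_mono) auto
  thus ?thesis using r(3) by (simp add: algebra_simps)
qed

definition fld :: "real \<Rightarrow> real \<Rightarrow> real \<Rightarrow> real \<times> real \<Rightarrow> real \<times> real" where
  "fld lo hi B z = (Hp (clamp_box lo hi B z), - Hx (clamp_box lo hi B z))"

lemma C1_lipschitz_on_box:
  fixes g :: "real \<times> real \<Rightarrow> real"
  assumes d: "\<And>z. fst z \<in> I \<Longrightarrow> (g has_derivative (\<lambda>h. a z * fst h + b z * snd h)) (at z)"
    and ca: "continuous_on (I \<times> UNIV) a" and cb: "continuous_on (I \<times> UNIV) b"
    and J: "{lo..hi} \<subseteq> I"
  shows "\<exists>L\<ge>0. \<forall>z\<in>{lo..hi} \<times> {-B..B}. \<forall>w\<in>{lo..hi} \<times> {-B..B}. \<bar>g z - g w\<bar> \<le> L * norm (z - w)"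
proof -
  let ?S = "{lo..hi} \<times> {-B..B}"
  have cS: "compact ?S" by (intro compact_Times) auto
  have sub: "?S \<subseteq> I \<times> UNIV" using J by auto
  have "bounded ((\<lambda>z. \<bar>a z\<bar> + \<bar>b z\<bar>) ` ?S)"
    by (intro compact_imp_bounded compact_continuous_image cS continuous_intros
        continuous_on_subset[OF ca sub] continuous_on_subset[OF cb sub])
  then obtain L where L: "\<And>z. z \<in> ?S \<Longrightarrow> \<bar>\<bar>a z\<bar> + \<bar>b z\<bar>\<bar> \<le> L" by (auto simp: bounded_iff)
  show ?thesis
  proof (intro exI[of _ "max L 0"] conjI ballI)
    fix z w assume zw: "z \<in> ?S" "w \<in> ?S"
    have "norm (g z - g w) \<le> max L 0 * norm (z - w)"
    proof (rule differentiable_bound[of ?S g "\<lambda>z h. a z * fst h + b z * snd h"])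
      show "convex ?S" by (intro convex_Times) auto
      fix v assume v: "v \<in> ?S"
      show "(g has_derivative (\<lambda>h. a v * fst h + b v * snd h)) (at v within ?S)"
        by (rule has_derivative_at_withinI[OF d]) (use v J in auto)
      show "onorm (\<lambda>h. a v * fst h + b v * snd h) \<le> max L 0"
      proof (rule onorm_le)
        fix h :: "real \<times> real"
        have "norm (a v * fst h + b v * snd h) \<le> \<bar>a v\<bar> * \<bar>fst h\<bar> + \<bar>b v\<bar> * \<bar>snd h\<bar>"
          by (simp add: abs_mult[symmetric] abs_triangle_ineq)
        also have "\<dots> \<le> \<bar>a v\<bar> * norm h + \<bar>b v\<bar> * norm h"
          using norm_fst_le[of "fst h" "snd h"] norm_snd_le[of "snd h" "fst h"]
          by (intro add_mono mult_left_mono) auto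
        also have "\<dots> = (\<bar>a v\<bar> + \<bar>b v\<bar>) * norm h" by (simp add: algebra_simps)
        also have "\<dots> \<le> max L 0 * norm h" using L[OF v] by (intro mult_right_mono) auto
        finally show "norm (a v * fst h + b v * snd h) \<le> max L 0 * norm h" .
      qed
    qed (use zw in auto)
    thus "\<bar>g z - g w\<bar> \<le> max L 0 * norm (z - w)" by simp
  qed auto
qed

end

section \<open>The flow of the cut-off field\<close>

locale ham_box = hamiltonian +
  fixes lo hi B :: real
  assumes lohi: "lo \<le> hi" and box_I: "{lo..hi} \<subseteq> I" and B_pos: "B > 0"
begin

abbreviation "cl \<equiv> clamp_box lo hi B"
abbreviation "F \<equiv> fld lo hi B"
abbreviation "bx \<equiv> {lo..hi} \<times> {-B..B}"
abbreviation "obx \<equiv> {lo<..<hi} \<times> {-B<..<B}"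

lemma cl_in: "cl z \<in> bx" using clamp_box_in[OF lohi, of B z] B_pos by simp

lemma F_lipschitz: "\<exists>L>0. \<forall>z w. norm (F z - F w) \<le> L * norm (z - w)"
proof -
  from C1_lipschitz_on_box[OF dHp cHpx cHpp box_I, of B] obtain L1 where
    L1: "L1 \<ge> 0" "\<And>z w. z \<in> bx \<Longrightarrow> w \<in> bx \<Longrightarrow> \<bar>Hp z - Hp w\<bar> \<le> L1 * norm (z - w)" by blast
  from C1_lipschitz_on_box[OF dHx cHxx cHxp box_I, of B] obtain L2 where
    L2: "L2 \<ge> 0" "\<And>z w. z \<in> bx \<Longrightarrow> w \<in> bx \<Longrightarrow> \<bar>Hx z - Hx w\<bar> \<le> L2 * norm (z - w)" by blast
  show ?thesis
  proof (intro exI[of _ "L1 + L2 + 1"] conjI allI)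
    fix z w
    have "norm (F z - F w) \<le> \<bar>Hp (cl z) - Hp (cl w)\<bar> + \<bar>Hx (cl z) - Hx (cl w)\<bar>"
      using norm_Pair_le[of "Hp (cl z) - Hp (cl w)" "- Hx (cl z) + Hx (cl w)"]
      by (simp add: fld_def abs_minus_commute)
    also have "\<dots> \<le> L1 * norm (cl z - cl w) + L2 * norm (cl z - cl w)"
      by (intro add_mono L1 L2 cl_in)
    also have "\<dots> \<le> (L1 + L2 + 1) * norm (cl z - cl w)" by (simp add: algebra_simps)
    also have "\<dots> \<le> (L1 + L2 + 1) * norm (z - w)"
      using L1 L2 by (intro mult_left_mono clamp_box_lipschitz) auto
    finally show "norm (F z - F w) \<le> (L1 + L2 + 1) * norm (z - w)" .
  qed (use L1 L2 in auto)
qed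

lemma F_bounded: "\<exists>M. \<forall>z. norm (F z) \<le> M"
proof -
  have sub: "bx \<subseteq> I \<times> UNIV" using box_I by auto
  have "bounded ((\<lambda>z. (Hp z, - Hx z)) ` bx)"
    by (intro compact_imp_bounded compact_continuous_image compact_Times continuous_intros
        continuous_on_subset[OF cHp sub] continuous_on_subset[OF cHx sub]) auto
  then obtain M where M: "\<And>z. z \<in> bx \<Longrightarrow> norm (Hp z, - Hx z) \<le> M" by (auto simp: bounded_iff)
  have "norm (F z) \<le> M" for z unfolding fld_def by (rule M[OF cl_in])
  thus ?thesis by blast
qed

text \<open>A forward solution picked by choice; \<open>flow_unique\<close> shows that nothing
  depends on the choice. Only times s >= 0 occur, hence the one-sided derivative at 0.\<close>

definition flow :: "real \<times> real \<Rightarrow> real \<Rightarrow> real \<times> real" where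
  "flow z = (SOME \<phi>. \<phi> 0 = z \<and> (\<forall>s\<ge>0. (\<phi> has_vector_derivative F (\<phi> s)) (at s within {0..})))"

lemma flow_0: "flow z 0 = z"
  and flow_deriv: "s \<ge> 0 \<Longrightarrow> (flow z has_vector_derivative F (flow z s)) (at s within {0..})"
proof -
  obtain L where L: "L > 0" "\<And>z w. norm (F z - F w) \<le> L * norm (z - w)" using F_lipschitz by blast
  obtain M where M: "\<And>z. norm (F z) \<le> M" using F_bounded by blast
  from someI_ex[OF lipschitz_bounded_ode_exists[of L F M z, OF L M]]
  show "flow z 0 = z" "s \<ge> 0 \<Longrightarrow> (flow z has_vector_derivative F (flow z s)) (at s within {0..})"
    by (auto simp: flow_def)
qed

lemma flow_deriv_within:
  "s \<ge> 0 \<Longrightarrow> S \<subseteq> {0..} \<Longrightarrow> (flow z has_vector_derivative F (flow z s)) (at s within S)"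
  by (rule has_vector_derivative_within_subset[OF flow_deriv])

lemma flow_X: "s \<ge> 0 \<Longrightarrow> S \<subseteq> {0..} \<Longrightarrow>
    ((\<lambda>s. fst (flow z s)) has_real_derivative Hp (cl (flow z s))) (at s within S)"
  and flow_P: "s \<ge> 0 \<Longrightarrow> S \<subseteq> {0..} \<Longrightarrow>
    ((\<lambda>s. snd (flow z s)) has_real_derivative - Hx (cl (flow z s))) (at s within S)"
proof -
  assume s: "s \<ge> 0" "S \<subseteq> {0..}"
  note d = flow_deriv_within[OF s, of z, unfolded has_vector_derivative_def]
  have "(\<lambda>x. fst (x *\<^sub>R F (flow z s))) = (*) (Hp (cl (flow z s)))"
    "(\<lambda>x. snd (x *\<^sub>R F (flow z s))) = (*) (- Hx (cl (flow z s)))"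
    by (auto simp: fld_def mult.commute)
  with has_derivative_fst[OF d] has_derivative_snd[OF d]
  show "((\<lambda>s. fst (flow z s)) has_real_derivative Hp (cl (flow z s))) (at s within S)"
    "((\<lambda>s. snd (flow z s)) has_real_derivative - Hx (cl (flow z s))) (at s within S)"
    unfolding has_field_derivative_def by simp_all
qed

definition lipc :: real where
  "lipc = (SOME L. L > 0 \<and> (\<forall>z w. norm (F z - F w) \<le> L * norm (z - w)))"

lemma lipc_pos: "lipc > 0" and F_lipc: "norm (F z - F w) \<le> lipc * norm (z - w)"
  using someI_ex[OF F_lipschitz] unfolding lipc_def[symmetric] by blast+

lemma flow_lipschitz:
  assumes s: "s \<ge> 0"
  shows "norm (flow z s - flow w s) \<le> exp (lipc * s) * norm (z - w)"
    and "norm (z - w) \<le> exp (lipc * s) * norm (flow z s - flow w s)"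
proof -
  have d: "(flow v has_vector_derivative F (flow v u)) (at u within {0..s})" if "u \<in> {0..s}" for u v
    by (rule flow_deriv_within) (use that in auto)
  have L: "lipc \<ge> 0" using lipc_pos by simp
  from ode_solution_bounds(1)[where f = F, OF L F_lipc d d s]
  show "norm (flow z s - flow w s) \<le> exp (lipc * s) * norm (z - w)" by (simp add: flow_0)
  from ode_solution_bounds(2)[where f = F, OF L F_lipc d d s]
  show "norm (z - w) \<le> exp (lipc * s) * norm (flow z s - flow w s)" by (simp add: flow_0)
qed

text \<open>Used twice: an orbit cannot reach a fixed point in finite time, and a moving orbit over
  the equilibrium position cannot have momentum 0.\<close>

lemma flow_inj:
  assumes s: "s \<ge> 0" and eq: "flow z s = flow w s"
  shows "z = w"
  using flow_lipschitz(2)[OF s, of z w] eq by simp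

lemma flow_unique:
  assumes \<psi>: "\<And>s. s \<in> {0..t} \<Longrightarrow> (\<psi> has_vector_derivative F (\<psi> s)) (at s within {0..t})" and t: "t \<ge> 0"
  shows "flow (\<psi> 0) t = \<psi> t"
proof -
  have d: "(flow v has_vector_derivative F (flow v u)) (at u within {0..t})" if "u \<in> {0..t}" for u v
    by (rule flow_deriv_within) (use that in auto)
  have L: "lipc \<ge> 0" using lipc_pos by simp
  from ode_solution_bounds(1)[where f = F, OF L F_lipc d \<psi> t, of "\<psi> 0"]
  show ?thesis by (simp add: flow_0)
qed

lemma flow_fixed:
  assumes "F z = 0" "s \<ge> 0" shows "flow z s = z"
  using flow_unique[of s "\<lambda>_. z"] assms by auto

text \<open>Lipschitz dependence on the starting point, with factor at most exp(lipc (s + 1)) for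
  times within 1 of s, is combined with continuity in time.\<close>

lemma flow_cont: "continuous_on (UNIV \<times> {0..}) (\<lambda>(z, s). flow z s)"
proof (unfold continuous_on_iff, intro ballI allI impI)
  fix w :: "(real \<times> real) \<times> real" and e :: real assume w: "w \<in> UNIV \<times> {0..}" and e: "0 < e"
  obtain z s where ws: "w = (z, s)" by (cases w)
  have s: "s \<ge> 0" using w ws by auto
  have "continuous_on {0..} (flow z)"
    by (rule continuous_on_vector_derivative[OF flow_deriv]) auto
  then obtain d where d: "d > 0" "\<And>s'. s' \<ge> 0 \<Longrightarrow> dist s' s < d \<Longrightarrow> dist (flow z s') (flow z s) < e / 2"
    unfolding continuous_on_iff using s half_gt_zero[OF e] by (meson atLeast_iff)
  define d' where "d' = min (min d 1) (e / 2 / exp (lipc * (s + 1)))"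
  have "dist (flow z' s') (flow z s) < e" if s': "0 \<le> s'" and dd: "dist (z', s') (z, s) < d'" for z' s'
  proof -
    have 1: "dist s' s < d'" and 2: "dist z' z < d'"
      using dist_snd_le[of "(z',s')" "(z,s)"] dist_fst_le[of "(z',s')" "(z,s)"] dd by auto
    have "dist (flow z' s') (flow z s') \<le> exp (lipc * s') * norm (z' - z)"
      unfolding dist_norm by (rule flow_lipschitz(1)[OF s'])
    also have "\<dots> \<le> exp (lipc * (s + 1)) * norm (z' - z)"
      using 1 lipc_pos by (intro mult_right_mono) (auto simp: d'_def dist_real_def)
    also have "\<dots> < exp (lipc * (s + 1)) * d'" using 2 by (intro mult_strict_left_mono) (auto simp: dist_norm)
    also have "\<dots> \<le> exp (lipc * (s + 1)) * (e / 2 / exp (lipc * (s + 1)))"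
      by (intro mult_left_mono) (auto simp: d'_def)
    finally have "dist (flow z' s') (flow z s') < e / 2" by simp
    moreover have "dist (flow z s') (flow z s) < e / 2" using d(2)[OF s'] 1 by (simp add: d'_def)
    ultimately show "dist (flow z' s') (flow z s) < e"
      using dist_triangle[of "flow z' s'" "flow z s" "flow z s'"] by linarith
  qed
  moreover have "d' > 0" using d e by (simp add: d'_def)
  ultimately show "\<exists>d>0. \<forall>x'\<in>UNIV \<times> {0..}. dist x' w < d \<longrightarrow>
      dist (case x' of (z, s) \<Rightarrow> flow z s) (case w of (z, s) \<Rightarrow> flow z s) < e"
    unfolding ws by (intro exI[of _ d']) auto
qed

lemma flow_cont_s: "continuous_on {0..} (flow z)"
  by (rule continuous_on_vector_derivative[OF flow_deriv]) auto

lemma flow_deriv_in_box: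
  assumes "s \<ge> 0" "S \<subseteq> {0..}" "flow z s \<in> bx"
  shows "((\<lambda>s. fst (flow z s)) has_real_derivative Hp (flow z s)) (at s within S)"
    and "((\<lambda>s. snd (flow z s)) has_real_derivative - Hx (flow z s)) (at s within S)"
  using flow_X[OF assms(1,2), of z] flow_P[OF assms(1,2), of z] clamp_box_id[OF assms(3)] by auto

text \<open>The right-hand side is the Poisson bracket of g and H. The formula holds while the orbit
  is in the box, where the clamp is the identity.\<close>

lemma deriv_along_flow:
  assumes g: "\<And>z. fst z \<in> I \<Longrightarrow> (g has_derivative (\<lambda>h. a z * fst h + b z * snd h)) (at z)"
    and s: "s \<ge> 0" "S \<subseteq> {0..}" and b: "flow z s \<in> bx"
  shows "((\<lambda>s. g (flow z s)) has_real_derivative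
     a (flow z s) * Hp (flow z s) - b (flow z s) * Hx (flow z s)) (at s within S)"
proof -
  have "fst (flow z s) \<in> I" using b box_I by (cases "flow z s") auto
  from has_derivative_compose[OF flow_deriv_within[OF s, unfolded has_vector_derivative_def] g[OF this]]
  have "((\<lambda>s. g (flow z s)) has_derivative
     (\<lambda>x. a (flow z s) * fst (x *\<^sub>R F (flow z s)) + b (flow z s) * snd (x *\<^sub>R F (flow z s)))) (at s within S)" .
  moreover have "(\<lambda>x. a (flow z s) * fst (x *\<^sub>R F (flow z s)) + b (flow z s) * snd (x *\<^sub>R F (flow z s)))
     = (*) (a (flow z s) * Hp (flow z s) - b (flow z s) * Hx (flow z s))"
    using clamp_box_id[OF b] by (auto simp: fld_def algebra_simps)
  ultimately show ?thesis by (simp add: has_field_derivative_def)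
qed

lemma energy_conserved:
  assumes t: "t \<ge> 0" and b: "\<And>s. s \<in> {0..t} \<Longrightarrow> flow z s \<in> bx"
  shows "H (flow z t) = H z"
proof -
  have "((\<lambda>s. H (flow z s)) has_real_derivative 0) (at s within {0..t})" if s: "s \<in> {0..t}" for s
    using deriv_along_flow[OF dH, of s "{0..t}" z] b[OF s] s by (simp add: mult.commute)
  then obtain c where "\<And>s. s \<in> {0..t} \<Longrightarrow> H (flow z s) = c"
    using has_field_derivative_zero_constant[of "{0..t}" "\<lambda>s. H (flow z s)"] by auto
  from this[of t] this[of 0] t show ?thesis by (simp add: flow_0)
qed

end

section \<open>Transversal crossings\<close>

lemma continuous_on_uncurry:
  assumes "continuous_on S (\<lambda>(x, s). X x s)" "continuous_on T f" "continuous_on T g"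
    and "\<And>y. y \<in> T \<Longrightarrow> (f y, g y) \<in> S"
  shows "continuous_on T (\<lambda>y. X (f y) (g y))"
  using continuous_on_compose2[OF assms(1) continuous_on_Pair[OF assms(2,3)]] assms(4) by auto

text \<open>An implicit function argument by signs: in a time window where V stays positive, X
  passes strictly from below c to above c. Both strict inequalities survive a small change of the
  parameter, and the intermediate value theorem gives the new crossing in the same window.\<close>

lemma transversal_zero_persists:
  fixes X V :: "real \<Rightarrow> real \<Rightarrow> real"
  assumes cX: "continuous_on ({a..b} \<times> {0..}) (\<lambda>(x, s). X x s)"
    and cV: "continuous_on ({a..b} \<times> {0..}) (\<lambda>(x, s). V x s)"
    and d: "\<And>x s. x \<in> {a..b} \<Longrightarrow> s \<ge> 0 \<Longrightarrow> (X x has_real_derivative V x s) (at s within {0..})"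
    and x: "x \<in> {a..b}" and u: "u > 0" and z: "X x u = c" and v: "V x u > 0" and e: "e > 0"
  shows "\<exists>\<delta>>0. \<forall>y\<in>{a..b}. \<bar>y - x\<bar> < \<delta> \<longrightarrow> (\<exists>u'>0. \<bar>u' - u\<bar> < e \<and> X y u' = c \<and> V y u' > 0)"
proof -
  have xu: "(x, u) \<in> {a..b} \<times> {0..}" using x u by auto
  obtain r where r0: "r > 0" and r': "\<forall>w\<in>{a..b} \<times> {0..}. dist w (x, u) < r \<longrightarrow>
      dist ((\<lambda>(x, s). V x s) w) ((\<lambda>(x, s). V x s) (x, u)) < V x u"
    using cV[unfolded continuous_on_iff, rule_format, OF xu v] by blast
  have r: "r > 0"
    "\<And>y s. y \<in> {a..b} \<Longrightarrow> s \<ge> 0 \<Longrightarrow> dist (y, s) (x, u) < r \<Longrightarrow> dist (V y s) (V x u) < V x u"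
  proof -
    show "r > 0" by (rule r0)
    fix y s :: real assume "y \<in> {a..b}" "s \<ge> 0" "dist (y, s) (x, u) < r"
    thus "dist (V y s) (V x u) < V x u" using r'[rule_format, of "(y, s)"] by simp
  qed
  \<comment> \<open>\<open>r / 2\<close> leaves room for the parameter shift \<open>r / 4\<close>
    inside the ball where V is positive, \<open>u / 2\<close> keeps the times positive, and
    \<open>e / 2\<close> gives the required closeness.\<close>
  define k where "k = min (min (r / 2) (u / 2)) (e / 2)"
  have k: "k > 0" "k \<le> r/2" "k \<le> u / 2" "k \<le> e / 2" using r u e by (auto simp: k_def)
  have pos: "V y s > 0" if "y \<in> {a..b}" "\<bar>y - x\<bar> \<le> r / 4" "\<bar>s - u\<bar> \<le> k" for y s
  proof -
    have "dist (y, s) (x, u) \<le> \<bar>y - x\<bar> + \<bar>s - u\<bar>"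
      using sqrt_sum_squares_le_sum_abs[of "y - x" "s - u"] by (simp add: dist_Pair_Pair dist_real_def)
    also have "\<dots> < r" using that k r by simp
    finally have "dist (V y s) (V x u) < V x u" using that k by (intro r) auto
    thus ?thesis by (simp add: dist_real_def abs_less_iff)
  qed
  have mvt: "\<exists>\<xi>>s. \<xi> < s' \<and> X x s' - X x s = (s' - s) * V x \<xi>" if "0 < s" "s < s'" for s s'
  proof (rule MVT2[OF that(2), of "X x" "V x"])
    fix w assume w: "s \<le> w"
    hence "at w within {0..} = at w" using that by (intro at_within_interior) auto
    thus "(X x has_real_derivative V x w) (at w)" using d[OF x, of w] w that by simp
  qed
  have m1: "X x (u - k) < c"
  proof -
    from mvt[of "u - k" u] k u obtain \<xi> where "u - k < \<xi>" "\<xi> < u" "X x u - X x (u - k) = k * V x \<xi>" by auto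
    moreover have "V x \<xi> > 0" by (rule pos) (use calculation x r in auto)
    ultimately show ?thesis using z k by (metis diff_gt_0_iff_gt mult_pos_pos)
  qed
  have m2: "X x (u + k) > c"
  proof -
    from mvt[of u "u + k"] k u obtain \<xi> where "u < \<xi>" "\<xi> < u + k" "X x (u + k) - X x u = k * V x \<xi>" by auto
    moreover have "V x \<xi> > 0" by (rule pos) (use calculation x r in auto)
    ultimately show ?thesis using z k by (metis diff_gt_0_iff_gt mult_pos_pos)
  qed
  have near: "\<exists>\<delta>>0. \<forall>y\<in>{a..b}. \<bar>y - x\<bar> < \<delta> \<longrightarrow> dist (X y s) (X x s) < h" if "s \<ge> 0" "h > 0" for s h
  proof -
    have "continuous_on {a..b} (\<lambda>y. (\<lambda>(x, s). X x s) (y, s))"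
      by (rule continuous_on_compose2[OF cX]) (use that in \<open>auto intro!: continuous_intros\<close>)
    thus ?thesis using x that unfolding continuous_on_iff by (auto simp: dist_real_def)
  qed
  from near[of "u - k" "c - X x (u - k)"] k u m1 obtain d1 where d1: "d1 > 0"
    "\<And>y. y \<in> {a..b} \<Longrightarrow> \<bar>y - x\<bar> < d1 \<Longrightarrow> dist (X y (u - k)) (X x (u - k)) < c - X x (u - k)" by auto
  from near[of "u + k" "X x (u + k) - c"] k u m2 obtain d2 where d2: "d2 > 0"
    "\<And>y. y \<in> {a..b} \<Longrightarrow> \<bar>y - x\<bar> < d2 \<Longrightarrow> dist (X y (u + k)) (X x (u + k)) < X x (u + k) - c" by auto
  show ?thesis
  proof (rule exI[of _ "min (min d1 d2) (r / 4)"], intro conjI ballI impI)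
    fix y assume y: "y \<in> {a..b}" and yx: "\<bar>y - x\<bar> < min (min d1 d2) (r / 4)"
    have 1: "X y (u - k) < c" using d1(2)[OF y] yx by (auto simp: dist_real_def abs_less_iff)
    have 2: "X y (u + k) > c" using d2(2)[OF y] yx by (auto simp: dist_real_def abs_less_iff)
    have "continuous_on {0..} (X y)" using d[OF y] by (meson DERIV_continuous continuous_on_eq_continuous_within atLeast_iff)
    hence "continuous_on {u - k..u + k} (X y)" by (rule continuous_on_subset) (use k u in auto)
    with IVT'[of "X y" "u - k" c "u + k"] 1 2 k obtain u' where u': "u - k \<le> u'" "u' \<le> u + k" "X y u' = c" by auto
    hence "V y u' > 0" using y yx by (intro pos) auto
    thus "\<exists>u'>0. \<bar>u' - u\<bar> < e \<and> X y u' = c \<and> V y u' > 0"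
      using u' k u e by (intro exI[of _ u']) auto
  qed (use d1 d2 r in auto)
qed

text \<open>Among all parameters whose curve shows the crossing pattern before time \<open>t\<close> there is a
  smallest one; since transversal crossings persist, its last crossing happens exactly at time \<open>t\<close>.\<close>
lemma crossings_at_time:
  fixes X V :: "real \<Rightarrow> real \<Rightarrow> real"
  assumes cX: "continuous_on ({a..b} \<times> {0..}) (\<lambda>(x, s). X x s)"
    and cV: "continuous_on ({a..b} \<times> {0..}) (\<lambda>(x, s). V x s)"
    and d: "\<And>x s. x \<in> {a..b} \<Longrightarrow> s \<ge> 0 \<Longrightarrow> (X x has_real_derivative V x s) (at s within {0..})"
    and trans: "\<And>x s. x \<in> {a..b} \<Longrightarrow> s \<ge> 0 \<Longrightarrow> X x s = c \<Longrightarrow> V x s \<noteq> 0"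
    and init: "\<And>x. x \<in> {a..b} \<Longrightarrow> X x 0 < c"
    and left: "\<And>s. s \<ge> 0 \<Longrightarrow> X a s = c \<Longrightarrow> V a s > 0"
    and ab: "a \<le> b"
    and pat: "0 \<le> u0" "u0 \<le> w0" "w0 \<le> v0" "v0 \<le> t" "X b u0 = c" "X b w0 = c" "X b v0 = c"
      "V b u0 > 0" "V b w0 < 0" "V b v0 > 0"
  shows "\<exists>x\<in>{a..b}. X x t = c \<and> V x t > 0" "\<exists>x\<in>{a..b}. X x t = c \<and> V x t < 0"
proof -
  have persP: "\<exists>\<delta>>0. \<forall>y\<in>{a..b}. \<bar>y - x\<bar> < \<delta> \<longrightarrow> (\<exists>u'>0. \<bar>u' - u\<bar> < e \<and> X y u' = c \<and> V y u' > 0)"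
    if "x \<in> {a..b}" "u > 0" "X x u = c" "V x u > 0" "e > 0" for x u e
    by (rule transversal_zero_persists[OF cX cV d that]) auto
  have persN: "\<exists>\<delta>>0. \<forall>y\<in>{a..b}. \<bar>y - x\<bar> < \<delta> \<longrightarrow> (\<exists>u'>0. \<bar>u' - u\<bar> < e \<and> X y u' = c \<and> V y u' < 0)"
    if "x \<in> {a..b}" "u > 0" "X x u = c" "V x u < 0" "e > 0" for x u e
    using transversal_zero_persists[of a b "\<lambda>x s. - X x s" "\<lambda>x s. - V x s" x u "- c" e]
      continuous_on_minus[OF cX] continuous_on_minus[OF cV] DERIV_minus[OF d] that
    by (auto simp: case_prod_unfold)
  let ?R = "{a..b} \<times> {0..t}"
  have t0: "t \<ge> 0" using pat by simp
  show "\<exists>x\<in>{a..b}. X x t = c \<and> V x t < 0"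
  proof -
    \<comment> \<open>The velocity condition is weakened to V <= 0 to make the set closed;
      \<open>trans\<close> restores strictness at the minimiser.\<close>
    define C where "C = {z \<in> ?R. X (fst z) (snd z) = c \<and> V (fst z) (snd z) \<le> 0}"
    have "closed C"
    proof -
      have cl: "closed ?R" by (intro closed_Times) auto
      have c: "continuous_on ?R (\<lambda>z. X (fst z) (snd z))" "continuous_on ?R (\<lambda>z. V (fst z) (snd z))"
        by (rule continuous_on_uncurry[OF cX] continuous_on_uncurry[OF cV];
            auto intro!: continuous_intros)+
      have "C = (?R \<inter> (\<lambda>z. X (fst z) (snd z)) -` {c}) \<inter> (?R \<inter> (\<lambda>z. V (fst z) (snd z)) -` {..0})"
        by (auto simp: C_def)
      thus ?thesis
        by (simp only:) (intro closed_Int continuous_closed_preimage c cl; simp)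
    qed
    moreover have "C = ?R \<inter> C" by (auto simp: C_def)
    moreover have "compact ?R" by (intro compact_Times compact_Icc)
    ultimately have "compact C" using compact_Int_closed[of ?R C] by simp
    moreover have "(b, w0) \<in> C" using pat ab by (auto simp: C_def)
    hence "C \<noteq> {}" by blast
    moreover have "continuous_on C fst" by (intro continuous_intros)
    ultimately obtain z where z: "z \<in> C" "\<And>y. y \<in> C \<Longrightarrow> fst z \<le> fst y"
      using continuous_attains_inf[of C fst] by blast
    obtain x u where zz: "z = (x, u)" by (cases z)
    have xu: "x \<in> {a..b}" "0 \<le> u" "u \<le> t" "X x u = c" "V x u \<le> 0" using z(1) by (auto simp: C_def zz)
    have V: "V x u < 0" using trans[of x u] xu by auto
    have u0: "u > 0" using init[of x] xu by (cases "u = 0") auto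
    \<comment> \<open>The curve of parameter \<open>a\<close> crosses only upward, so the minimiser
      is not \<open>a\<close> and smaller parameters are available.\<close>
    have xa: "x > a" using left[of u] xu V by (cases "x = a") auto
    show ?thesis
    proof (cases "u = t")
      case False
      hence tu: "t - u > 0" using xu by simp
      from persN[OF xu(1) u0 xu(4) V tu] obtain \<delta> where \<delta>: "\<delta> > 0"
        "\<And>y. y \<in> {a..b} \<Longrightarrow> \<bar>y - x\<bar> < \<delta> \<Longrightarrow> \<exists>u'>0. \<bar>u' - u\<bar> < t - u \<and> X y u' = c \<and> V y u' < 0" by blast
      define y where "y = max a (x - \<delta> / 2)"
      have y: "y \<in> {a..b}" "\<bar>y - x\<bar> < \<delta>" "y < x" using \<delta> xa xu by (auto simp: y_def)
      from \<delta>(2)[OF y(1,2)] obtain u' where "u' > 0" "\<bar>u' - u\<bar> < t - u" "X y u' = c" "V y u' < 0" by auto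
      hence "(y, u') \<in> C" using y by (auto simp: C_def)
      from z(2)[OF this] y show ?thesis by (simp add: zz)
    qed (use xu V in auto)
  qed
  show "\<exists>x\<in>{a..b}. X x t = c \<and> V x t > 0"
  proof -
    let ?Q = "{a..b} \<times> {0..t} \<times> {0..t} \<times> {0..t}"
    define x1 :: "real \<times> real \<times> real \<times> real \<Rightarrow> real" where "x1 = fst"
    define p1 :: "real \<times> real \<times> real \<times> real \<Rightarrow> real" where "p1 = (\<lambda>z. fst (snd z))"
    define p2 :: "real \<times> real \<times> real \<times> real \<Rightarrow> real" where "p2 = (\<lambda>z. fst (snd (snd z)))"
    define p3 :: "real \<times> real \<times> real \<times> real \<Rightarrow> real" where "p3 = (\<lambda>z. snd (snd (snd z)))"
    have cp: "continuous_on T x1" "continuous_on T p1" "continuous_on T p2" "continuous_on T p3" for T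
      by (auto simp: x1_def p1_def p2_def p3_def intro!: continuous_intros)
    \<comment> \<open>A single upward crossing would not exclude the parameter \<open>a\<close>,
      whose curve may cross upward. The downward crossing in the middle does, and the three ordered
      crossings persist together.\<close>
    define C where "C = {z \<in> ?Q. p1 z \<le> p2 z \<and> p2 z \<le> p3 z \<and>
       X (x1 z) (p1 z) = c \<and> X (x1 z) (p2 z) = c \<and> X (x1 z) (p3 z) = c \<and>
       V (x1 z) (p1 z) \<ge> 0 \<and> V (x1 z) (p2 z) \<le> 0 \<and> V (x1 z) (p3 z) \<ge> 0}"
    have "closed C"
    proof -
      have cl: "closed ?Q" by (intro closed_Times) auto
      have in1: "(x1 z, p1 z) \<in> {a..b} \<times> {0..}" "(x1 z, p2 z) \<in> {a..b} \<times> {0..}"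
        "(x1 z, p3 z) \<in> {a..b} \<times> {0..}" if "z \<in> ?Q" for z
        using that by (auto simp: x1_def p1_def p2_def p3_def)
      have c: "continuous_on ?Q (\<lambda>z. X (x1 z) (p1 z))" "continuous_on ?Q (\<lambda>z. V (x1 z) (p1 z))"
        "continuous_on ?Q (\<lambda>z. X (x1 z) (p2 z))" "continuous_on ?Q (\<lambda>z. V (x1 z) (p2 z))"
        "continuous_on ?Q (\<lambda>z. X (x1 z) (p3 z))" "continuous_on ?Q (\<lambda>z. V (x1 z) (p3 z))"
        by (rule continuous_on_uncurry[OF cX cp(1) cp(2) in1(1)] continuous_on_uncurry[OF cV cp(1) cp(2) in1(1)]
            continuous_on_uncurry[OF cX cp(1) cp(3) in1(2)] continuous_on_uncurry[OF cV cp(1) cp(3) in1(2)]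
            continuous_on_uncurry[OF cX cp(1) cp(4) in1(3)] continuous_on_uncurry[OF cV cp(1) cp(4) in1(3)]; assumption)+
      have "C = (?Q \<inter> (\<lambda>z. p2 z - p1 z) -` {0..}) \<inter> (?Q \<inter> (\<lambda>z. p3 z - p2 z) -` {0..})
        \<inter> (?Q \<inter> (\<lambda>z. X (x1 z) (p1 z)) -` {c}) \<inter> (?Q \<inter> (\<lambda>z. X (x1 z) (p2 z)) -` {c})
        \<inter> (?Q \<inter> (\<lambda>z. X (x1 z) (p3 z)) -` {c})
        \<inter> (?Q \<inter> (\<lambda>z. V (x1 z) (p1 z)) -` {0..}) \<inter> (?Q \<inter> (\<lambda>z. V (x1 z) (p2 z)) -` {..0})
        \<inter> (?Q \<inter> (\<lambda>z. V (x1 z) (p3 z)) -` {0..})"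
        by (auto simp: C_def)
      thus ?thesis
        by (simp only:) (intro closed_Int continuous_closed_preimage c cl continuous_on_diff cp; simp)
    qed
    moreover have "C = ?Q \<inter> C" by (auto simp: C_def)
    moreover have "compact ?Q" by (intro compact_Times compact_Icc)
    ultimately have "compact C" using compact_Int_closed[of ?Q C] by simp
    moreover have "(b, u0, w0, v0) \<in> C"
      using pat ab by (auto simp: C_def x1_def p1_def p2_def p3_def)
    hence "C \<noteq> {}" by blast
    ultimately obtain z where z: "z \<in> C" "\<And>y. y \<in> C \<Longrightarrow> x1 z \<le> x1 y"
      using continuous_attains_inf[OF _ _ cp(1)[of C]] by blast
    obtain x u w v where zz: "z = (x, u, w, v)" by (cases z)
    have xu: "x \<in> {a..b}" "0 \<le> u" "u \<le> w" "w \<le> v" "v \<le> t" "X x u = c" "X x w = c" "X x v = c"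
      "V x u \<ge> 0" "V x w \<le> 0" "V x v \<ge> 0"
      using z(1) by (auto simp: C_def zz x1_def p1_def p2_def p3_def)
    have V: "V x u > 0" "V x w < 0" "V x v > 0" using trans[of x u] trans[of x w] trans[of x v] xu by auto
    have lt: "u < w" "w < v" using xu V by (auto simp: less_le)
    have u0: "u > 0" using init[of x] xu by (cases "u = 0") auto
    have xa: "x > a" using left[of w] xu V by (cases "x = a") auto
    show ?thesis
    proof (cases "v = t")
      case False
      \<comment> \<open>Half gaps keep the three perturbed crossings in order; \<open>t - v\<close>
        keeps the last one before time t.\<close>
      define e where "e = min (t - v) (min ((w - u) / 2) ((v - w) / 2))"
      have e: "e > 0" "e \<le> t - v" "e \<le> (w - u) / 2" "e \<le> (v - w) / 2" using lt False xu(5) by (auto simp: e_def min_def)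
      from persP[OF xu(1) u0 xu(6) V(1) e(1)] obtain d1 where d1: "d1 > 0"
        "\<And>y. y \<in> {a..b} \<Longrightarrow> \<bar>y - x\<bar> < d1 \<Longrightarrow> \<exists>u'>0. \<bar>u' - u\<bar> < e \<and> X y u' = c \<and> V y u' > 0" by blast
      from persN[OF xu(1) less_trans[OF u0 lt(1)] xu(7) V(2) e(1)] obtain d2 where d2: "d2 > 0"
        "\<And>y. y \<in> {a..b} \<Longrightarrow> \<bar>y - x\<bar> < d2 \<Longrightarrow> \<exists>u'>0. \<bar>u' - w\<bar> < e \<and> X y u' = c \<and> V y u' < 0" by blast
      from persP[OF xu(1) less_trans[OF less_trans[OF u0 lt(1)] lt(2)] xu(8) V(3) e(1)] obtain d3 where d3: "d3 > 0"
        "\<And>y. y \<in> {a..b} \<Longrightarrow> \<bar>y - x\<bar> < d3 \<Longrightarrow> \<exists>u'>0. \<bar>u' - v\<bar> < e \<and> X y u' = c \<and> V y u' > 0" by blast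
      define \<delta> where "\<delta> = min d1 (min d2 d3)"
      have \<delta>: "\<delta> > 0" "\<delta> \<le> d1" "\<delta> \<le> d2" "\<delta> \<le> d3" using d1 d2 d3 by (auto simp: \<delta>_def)
      define y where "y = max a (x - \<delta> / 2)"
      have y: "y \<in> {a..b}" "\<bar>y - x\<bar> < \<delta>" "y < x" using \<delta> xa xu by (auto simp: y_def)
      obtain u' where u': "u' > 0" "\<bar>u' - u\<bar> < e" "X y u' = c" "V y u' > 0" using d1(2)[OF y(1) less_le_trans[OF y(2) \<delta>(2)]] by blast
      obtain w' where w': "w' > 0" "\<bar>w' - w\<bar> < e" "X y w' = c" "V y w' < 0" using d2(2)[OF y(1) less_le_trans[OF y(2) \<delta>(3)]] by blast
      obtain v' where v': "v' > 0" "\<bar>v' - v\<bar> < e" "X y v' = c" "V y v' > 0" using d3(2)[OF y(1) less_le_trans[OF y(2) \<delta>(4)]] by blast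
      have ord: "u' \<le> w'" "w' \<le> v'" "v' \<le> t"
        using u'(2) w'(2) v'(2) e lt by (auto simp: abs_less_iff)
      have "(y, u', w', v') \<in> C"
        using y u' w' v' ord by (auto simp: C_def x1_def p1_def p2_def p3_def)
      from z(2)[OF this] y show ?thesis by (simp add: zz x1_def)
    qed (use xu V in auto)
  qed
qed

text \<open>The velocity is pushed down whenever it lies in the band |V| <= \<delta>. Either it
  never drops below \<delta>, or it falls through the band and stays below -\<delta>. In both cases
  the position drifts out of every bounded interval.\<close>

lemma decelerating_escapes:
  fixes X V A :: "real \<Rightarrow> real"
  assumes X: "\<And>s. s \<ge> s0 \<Longrightarrow> (X has_real_derivative V s) (at s within {s0..})"
    and V: "\<And>s. s \<ge> s0 \<Longrightarrow> (V has_real_derivative A s) (at s within {s0..})"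
    and k: "\<delta> > 0" "\<kappa> > 0" "\<And>s. s \<ge> s0 \<Longrightarrow> \<bar>V s\<bar> \<le> \<delta> \<Longrightarrow> A s \<le> - \<kappa>"
    and bd: "\<And>s. s \<ge> s0 \<Longrightarrow> \<bar>X s\<bar> \<le> R"
  shows False
proof -
  have Xw: "(X has_real_derivative V s) (at s within {u..t})" if "s0 \<le> u" "s \<in> {u..t}" for u t s
    by (rule DERIV_subset[OF X]) (use that in auto)
  have Vw: "(V has_real_derivative A s) (at s within {u..t})" if "s0 \<le> u" "s \<in> {u..t}" for u t s
    by (rule DERIV_subset[OF V]) (use that in auto)
  have no_drift: False if s1: "s1 \<ge> s0" and \<sigma>: "\<sigma> = 1 \<or> \<sigma> = -1" and f: "\<And>s. s \<ge> s1 \<Longrightarrow> \<sigma> * V s \<ge> \<delta>" for s1 \<sigma>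
  proof -
    \<comment> \<open>At speed at least \<delta> this time suffices to cover more than 2R, the
      diameter allowed by \<open>bd\<close>.\<close>
    define t where "t = s1 + (2 * R + 1) / \<delta>"
    have "R \<ge> 0" using bd[of s0] by auto
    hence t: "t \<ge> s1" using k by (simp add: t_def)
    have "\<delta> * t - \<sigma> * X t \<le> \<delta> * s1 - \<sigma> * X s1"
    proof (rule nonincreasing_within[of s1 t "\<lambda>s. \<delta> * s - \<sigma> * X s" "\<lambda>s. \<delta> - \<sigma> * V s"])
      fix s assume s: "s \<in> {s1..t}"
      show "((\<lambda>s. \<delta> * s - \<sigma> * X s) has_real_derivative \<delta> - \<sigma> * V s) (at s within {s1..t})"
        using Xw[OF s1 s] by (auto intro!: derivative_eq_intros)
    qed (use f t in auto)
    moreover have "\<delta> * t = \<delta> * s1 + (2 * R + 1)" using k by (simp add: t_def field_simps)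
    moreover have "\<bar>X t\<bar> \<le> R" "\<bar>X s1\<bar> \<le> R" using bd t s1 by auto
    ultimately show False using \<sigma> by auto
  qed
  show False
  proof (cases "\<forall>s\<ge>s0. V s \<ge> \<delta>")
    case True thus False using no_drift[of s0 1] by auto
  next
    case False
    then obtain s1 where s1: "s1 \<ge> s0" "V s1 < \<delta>" by auto
    \<comment> \<open>A barrier of slope -\<kappa>/2 takes the time 4\<delta>/\<kappa> from \<delta>
      to -\<delta>; halving the slope makes the inequality strict at contacts.\<close>
    define s2 where "s2 = s1 + 4 * \<delta> / \<kappa>"
    have s2: "s2 \<ge> s1" using k by (simp add: s2_def)
    have "V s2 < \<delta> - \<kappa> / 2 * (s2 - s1)"
    proof (rule barrier[of s1 s2 V A "\<lambda>s. \<delta> - \<kappa> / 2 * (s - s1)" "\<lambda>_. - \<kappa> / 2"])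
      fix s assume s: "s \<in> {s1..s2}"
      show "(V has_real_derivative A s) (at s within {s1..s2})" using Vw[OF s1(1) s] .
      show "((\<lambda>s. \<delta> - \<kappa> / 2 * (s - s1)) has_real_derivative - \<kappa> / 2) (at s within {s1..s2})"
        by (auto intro!: derivative_eq_intros)
      assume eq: "V s = \<delta> - \<kappa> / 2 * (s - s1)"
      have "\<kappa> / 2 * (s - s1) \<le> \<kappa> / 2 * (s2 - s1)" "0 \<le> \<kappa> / 2 * (s - s1)" using s k by auto
      moreover have "\<kappa> / 2 * (s2 - s1) = 2 * \<delta>" using k by (simp add: s2_def)
      ultimately have "\<bar>V s\<bar> \<le> \<delta>" unfolding eq by auto
      hence "A s \<le> - \<kappa>" using k s s1 by auto
      thus "A s < - \<kappa> / 2" using k by auto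
    qed (use s1 s2 in auto)
    moreover have "\<kappa> / 2 * (s2 - s1) = 2 * \<delta>" using k by (simp add: s2_def)
    ultimately have Vs2: "V s2 < - \<delta>" by simp
    have "V t < - \<delta>" if t: "t \<ge> s2" for t
    proof (rule barrier[of s2 t V A "\<lambda>s. - \<delta>" "\<lambda>_. 0"])
      fix s assume s: "s \<in> {s2..t}"
      show "(V has_real_derivative A s) (at s within {s2..t})" using Vw[OF _ s] s1 s2 by auto
      assume "V s = - \<delta>"
      hence "A s \<le> - \<kappa>" using k s s1 s2 by auto
      thus "A s < 0" using k by auto
    qed (use Vs2 t in auto)
    thus False using no_drift[of s2 "-1"] s1 s2 by force
  qed
qed

text \<open>The minimum k of the larger of |f| and -A over the compact set is positive, because -A >
  0 wherever f vanishes. With \<delta> = k/2 a small |f| cannot be the larger one, so -A >=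
  k.\<close>

lemma compact_sign_gap:
  fixes f A :: "'a::topological_space \<Rightarrow> real"
  assumes M: "compact M" and f: "continuous_on M f" and A: "continuous_on M A"
    and neg: "\<And>z. z \<in> M \<Longrightarrow> f z = 0 \<Longrightarrow> A z < 0"
  shows "\<exists>\<delta>>0. \<exists>\<kappa>>0. \<forall>z\<in>M. \<bar>f z\<bar> \<le> \<delta> \<longrightarrow> A z \<le> - \<kappa>"
proof (cases "M = {}")
  case True thus ?thesis by (auto intro!: exI[of _ "1::real"])
next
  case False
  have "continuous_on M (\<lambda>z. max \<bar>f z\<bar> (- A z))" by (intro continuous_intros f A)
  from continuous_attains_inf[OF M False this] obtain z where
    z: "z \<in> M" "\<And>y. y \<in> M \<Longrightarrow> max \<bar>f z\<bar> (- A z) \<le> max \<bar>f y\<bar> (- A y)" by auto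
  define k where "k = max \<bar>f z\<bar> (- A z)"
  have k: "k > 0" using neg[OF z(1)] by (auto simp: k_def less_max_iff_disj)
  have "A y \<le> - k" if "y \<in> M" "\<bar>f y\<bar> \<le> k / 2" for y
    using z(2)[OF that(1)] that(2) k unfolding k_def[symmetric] by (auto simp: max_def split: if_splits)
  thus ?thesis using k by (intro exI[of _ "k / 2"] conjI exI[of _ k]) auto
qed

section \<open>Equilibria and turning points\<close>

context hamiltonian
begin

text \<open>Schwarz's argument: the second difference of H over a square of side h is h^2 times
  either mixed derivative at some point of the square. H vanishes on the line p = 0, so only the
  upper side of the square contributes.\<close>

lemma mixed_partials_eq:
  assumes m: "m \<in> I"
  shows "Hxp (m, 0) = Hpx (m, 0)"
proof -
  have nb: "\<exists>r>0. \<forall>z. fst z \<in> I \<longrightarrow> dist z (m, 0) < r \<longrightarrow> dist (f z) (f (m, 0)) < e"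
    if "continuous_on (I \<times> UNIV) f" "e > 0" for f :: "real \<times> real \<Rightarrow> real" and e
    using that m unfolding continuous_on_iff by (fastforce simp: mem_Times_iff)
  have "\<bar>Hxp (m, 0) - Hpx (m, 0)\<bar> \<le> e" if e: "e > 0" for e
  proof -
    obtain r1 where r1: "r1 > 0" "\<And>z. fst z \<in> I \<Longrightarrow> dist z (m, 0) < r1 \<Longrightarrow> dist (Hxp z) (Hxp (m, 0)) < e / 2"
      using nb[OF cHxp, of "e/2"] e by auto
    obtain r2 where r2: "r2 > 0" "\<And>z. fst z \<in> I \<Longrightarrow> dist z (m, 0) < r2 \<Longrightarrow> dist (Hpx z) (Hpx (m, 0)) < e / 2"
      using nb[OF cHpx, of "e/2"] e by auto
    obtain r3 where r3: "r3 > 0" "ball m r3 \<subseteq> I" using open_I m by (meson open_contains_ball)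
    \<comment> \<open>Points of the square are within 2h of its vertex (m, 0); dividing by 3 brings
      this below the radii of continuity.\<close>
    define h where "h = min r3 (min r1 r2) / 3"
    have h: "h > 0" "h < r3" "2 * h < r1" "2 * h < r2" using r1 r2 r3 by (auto simp: h_def min_def)
    have inI: "y \<in> I" if "m \<le> y" "y \<le> m + h" for y using r3 that h by (auto simp: dist_real_def subset_iff)
    have close: "dist (y, p) (m, 0) \<le> 2 * h" if "m \<le> y" "y \<le> m + h" "0 \<le> p" "p \<le> h" for y p
      using sqrt_sum_squares_le_sum_abs[of "y - m" p] that by (simp add: dist_Pair_Pair dist_real_def)
    have mh: "m < m + h" using h by simp
    have "\<exists>y>m. y < m + h \<and> H (m + h, h) - H (m, h) = (m + h - m) * Hx (y, h)"
      by (rule MVT2[OF mh, of "\<lambda>y. H (y, h)" "\<lambda>y. Hx (y, h)"]) (use dH_x inI in auto)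
    then obtain y where y: "m < y" "y < m + h" "H (m + h, h) - H (m, h) = h * Hx (y, h)" by auto
    have yI: "y \<in> I" using inI y by auto
    have "\<exists>p>0. p < h \<and> Hx (y, h) - Hx (y, 0) = (h - 0) * Hxp (y, p)"
      by (rule MVT2[OF h(1), of "\<lambda>p. Hx (y, p)" "\<lambda>p. Hxp (y, p)"]) (use dHx_p yI in auto)
    then obtain p where p: "0 < p" "p < h" "Hx (y, h) = h * Hxp (y, p)" using Hx0[OF yI] by auto
    have I2: "m \<in> I" "m + h \<in> I" using inI h by auto
    have "\<exists>q>0. q < h \<and> (H (m + h, h) - H (m, h)) - (H (m + h, 0) - H (m, 0)) = (h - 0) * (Hp (m + h, q) - Hp (m, q))"
      by (rule MVT2[OF h(1), of "\<lambda>q. H (m + h, q) - H (m, q)" "\<lambda>q. Hp (m + h, q) - Hp (m, q)"])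
         (use dH_p I2 in \<open>auto intro!: derivative_eq_intros\<close>)
    then obtain q where q: "0 < q" "q < h" "H (m + h, h) - H (m, h) = h * (Hp (m + h, q) - Hp (m, q))"
      using H0 I2 by auto
    have "\<exists>x>m. x < m + h \<and> Hp (m + h, q) - Hp (m, q) = (m + h - m) * Hpx (x, q)"
      by (rule MVT2[OF mh, of "\<lambda>y. Hp (y, q)" "\<lambda>y. Hpx (y, q)"]) (use dHp_x inI in auto)
    then obtain x where x: "m < x" "x < m + h" "Hp (m + h, q) - Hp (m, q) = h * Hpx (x, q)" by auto
    have eq: "Hxp (y, p) = Hpx (x, q)" using y(3) p(3) q(3) x(3) h(1) by simp
    have "dist (Hxp (y, p)) (Hxp (m, 0)) < e / 2"
      by (rule r1) (use yI close[of y p] y p h in auto)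
    moreover have "dist (Hpx (x, q)) (Hpx (m, 0)) < e / 2"
      by (rule r2) (use inI[of x] close[of x q] x q h in auto)
    ultimately show ?thesis unfolding eq dist_real_def by linarith
  qed
  from this[of "\<bar>Hxp (m, 0) - Hpx (m, 0)\<bar> / 2"] show ?thesis by (cases "Hxp (m, 0) = Hpx (m, 0)") auto
qed

text \<open>At a zero of \<open>\<lambda>p. Hp (x, p)\<close> one has \<open>Hx (x, p) = p * Hxp (x, r)\<close>, so the sign of \<open>Hx\<close> is that of
  \<open>p\<close> times the mixed derivative at the equilibrium.\<close>
lemma Hx_sign_near_equilibrium:
  assumes m: "m \<in> I" "Hp (m, 0) = 0" and \<sigma>: "\<sigma> = 1 \<or> \<sigma> = -1" and \<tau>: "\<tau> * \<sigma> * Hpx (m, 0) > 0"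
  shows "\<exists>\<delta>>0. \<forall>x\<in>I. \<forall>p. \<bar>x - m\<bar> < \<delta> \<longrightarrow> \<sigma> * Hp (x, 0) > 0 \<longrightarrow> Hp (x, p) = 0 \<longrightarrow> \<tau> * Hx (x, p) < 0"
proof -
  have cf: "continuous_on (I \<times> UNIV) (\<lambda>z. \<tau> * \<sigma> * Hxp z)" by (intro continuous_intros cHxp)
  have pos: "\<tau> * \<sigma> * Hxp (m, 0) > 0" using \<tau> mixed_partials_eq[OF m(1)] by simp
  have mI: "(m, 0) \<in> I \<times> UNIV" using m by auto
  obtain r where r: "r > 0" and r': "\<forall>z\<in>I \<times> UNIV. dist z (m, 0) < r \<longrightarrow>
      dist (\<tau> * \<sigma> * Hxp z) (\<tau> * \<sigma> * Hxp (m, 0)) < \<tau> * \<sigma> * Hxp (m, 0)"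
    using cf[unfolded continuous_on_iff, rule_format, OF mI pos] by blast
  have rp: "\<tau> * \<sigma> * Hxp (x, p) > 0" if "x \<in> I" "\<bar>x - m\<bar> < r / 2" "\<bar>p\<bar> < r / 2" for x p
  proof -
    have "dist (x, p) (m, 0) \<le> \<bar>x - m\<bar> + \<bar>p\<bar>"
      using sqrt_sum_squares_le_sum_abs[of "x - m" p] by (simp add: dist_Pair_Pair dist_real_def)
    hence "dist (x, p) (m, 0) < r" using that by simp
    hence "dist (\<tau> * \<sigma> * Hxp (x, p)) (\<tau> * \<sigma> * Hxp (m, 0)) < \<tau> * \<sigma> * Hxp (m, 0)" using r' that by auto
    thus ?thesis by (simp add: dist_real_def abs_less_iff)
  qed
  have near: "\<exists>\<delta>>0. \<forall>x\<in>I. \<bar>x - m\<bar> < \<delta> \<longrightarrow> dist (Hp (x, q)) (Hp (m, q)) < h" if "h > 0" for q h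
  proof -
    have "continuous_on I (\<lambda>x. Hp (x, q))"
      by (intro continuous_at_imp_continuous_on ballI DERIV_isCont[OF dHp_x])
    thus ?thesis using m that unfolding continuous_on_iff by (auto simp: dist_real_def)
  qed
  \<comment> \<open>These signs persist for x near m, so the zero of Hp(x, .) is trapped in (-r/2,
    r/2), where the mixed derivative keeps its sign.\<close>
  have s1: "Hp (m, r / 2) > 0" "Hp (m, - r / 2) < 0"
    using Hp_strict_mono[OF m(1), of 0 "r / 2"] Hp_strict_mono[OF m(1), of "- r / 2" 0] m r by auto
  obtain d1 where d1: "d1 > 0" "\<And>x. x \<in> I \<Longrightarrow> \<bar>x - m\<bar> < d1 \<Longrightarrow> dist (Hp (x, r / 2)) (Hp (m, r / 2)) < Hp (m, r / 2)"
    using near[of "Hp (m, r / 2)" "r / 2"] s1 by auto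
  obtain d2 where d2: "d2 > 0" "\<And>x. x \<in> I \<Longrightarrow> \<bar>x - m\<bar> < d2 \<Longrightarrow> dist (Hp (x, - r / 2)) (Hp (m, - r / 2)) < - Hp (m, - r / 2)"
    using near[of "- Hp (m, - r / 2)" "- r / 2"] s1 by auto
  show ?thesis
  proof (rule exI[of _ "min (r / 2) (min d1 d2)"], intro conjI ballI allI impI)
    fix x p assume x: "x \<in> I" "\<bar>x - m\<bar> < min (r / 2) (min d1 d2)" and b: "\<sigma> * Hp (x, 0) > 0" and z: "Hp (x, p) = 0"
    have "Hp (x, r / 2) > 0" using d1(2)[OF x(1)] x(2) by (auto simp: dist_real_def abs_less_iff)
    hence p1: "p < r / 2" using Hp_less_iff[OF x(1), of p "r / 2"] z by simp
    have "Hp (x, - r / 2) < 0" using d2(2)[OF x(1)] x(2) by (auto simp: dist_real_def abs_less_iff)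
    hence p2: "- r / 2 < p" using Hp_less_iff[OF x(1), of "- r / 2" p] z by simp
    \<comment> \<open>Hp increases in p, so its zero lies on the side of 0 opposite to the sign of
      Hp(x, 0).\<close>
    have sp: "\<sigma> * p < 0" using \<sigma> b z Hp_less_iff[OF x(1), of p 0] Hp_less_iff[OF x(1), of 0 p] by auto
    have "\<exists>q. \<bar>q\<bar> < r / 2 \<and> Hx (x, p) = p * Hxp (x, q)"
    proof (cases "p > 0")
      case True
      have "\<exists>q>0. q < p \<and> Hx (x, p) - Hx (x, 0) = (p - 0) * Hxp (x, q)"
        by (rule MVT2[OF True, of "\<lambda>q. Hx (x, q)" "\<lambda>q. Hxp (x, q)"]) (use dHx_p x in auto)
      then obtain q where "0 < q" "q < p" "Hx (x, p) = p * Hxp (x, q)" using Hx0[OF x(1)] by auto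
      thus ?thesis using p1 by (intro exI[of _ q]) auto
    next
      case False
      hence p: "p < 0" using sp by (cases "p = 0") auto
      have "\<exists>q>p. q < 0 \<and> Hx (x, 0) - Hx (x, p) = (0 - p) * Hxp (x, q)"
        by (rule MVT2[OF p, of "\<lambda>q. Hx (x, q)" "\<lambda>q. Hxp (x, q)"]) (use dHx_p x in auto)
      then obtain q where "p < q" "q < 0" "Hx (x, p) = p * Hxp (x, q)" using Hx0[OF x(1)] by auto
      thus ?thesis using p2 by (intro exI[of _ q]) auto
    qed
    then obtain q where q: "\<bar>q\<bar> < r / 2" "Hx (x, p) = p * Hxp (x, q)" by auto
    have "\<sigma> * \<sigma> = 1" using \<sigma> by auto
    hence "\<tau> * Hx (x, p) = (\<sigma> * p) * (\<tau> * \<sigma> * Hxp (x, q))" unfolding q(2) by (metis (no_types) mult.commute mult.left_commute mult_1)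
    also have "\<dots> < 0" using mult_neg_pos[OF sp rp[OF x(1) _ q(1)]] x(2) by simp
    finally show "\<tau> * Hx (x, p) < 0" .
  qed (use r d1 d2 in auto)
qed

text \<open>The minimiser of the strictly convex H(x, .) is not 0 here, so the value 0 at p = 0 lies
  strictly above the minimum.\<close>

lemma H_critical_neg: "x \<in> I \<Longrightarrow> Hp (x, p) = 0 \<Longrightarrow> Hp (x, 0) \<noteq> 0 \<Longrightarrow> H (x, p) < 0"
  using H_above_tangent[of x p 0] H0[of x] by (cases "p = 0") auto

text \<open>At an equilibrium the tangent at p = 0 is horizontal, so 0 is the strict
  minimiser.\<close>

lemma H_equilibrium_nonneg: "m \<in> I \<Longrightarrow> Hp (m, 0) = 0 \<Longrightarrow> H (m, p) \<ge> 0"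
  and H_equilibrium_pos: "m \<in> I \<Longrightarrow> Hp (m, 0) = 0 \<Longrightarrow> p \<noteq> 0 \<Longrightarrow> H (m, p) > 0"
  using H_above_tangent[of m 0 p] H0[of m] by (cases "p = 0"; force)+

text \<open>Near the two equilibria the minimal energy \<open>min\<^sub>p H (x, p)\<close> is strictly monotone in \<open>x\<close>, so for
  energies close to 0 every turning point to the right of \<open>c\<close> pushes back to the left and conversely.\<close>
lemma turning_points:
  assumes m: "m1 \<in> I" "m2 \<in> I" "Hp (m1, 0) = 0" "Hp (m2, 0) = 0"
    and b: "\<And>x. x \<in> {m1<..<m2} \<Longrightarrow> Hp (x, 0) \<noteq> 0"
    and nd: "Hpx (m1, 0) \<noteq> 0" "Hpx (m2, 0) \<noteq> 0" and c: "c \<in> {m1<..<m2}"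
  shows "\<exists>h>0. \<forall>x\<in>{m1<..<m2}. \<forall>p. Hp (x, p) = 0 \<longrightarrow> H (x, p) > - h \<longrightarrow>
     (x > c \<and> Hx (x, p) > 0) \<or> (x < c \<and> Hx (x, p) < 0)"
proof -
  have sub: "{m1..m2} \<subseteq> I" by (rule Icc_subset[OF m(1,2)])
  have contb: "continuous_on {m1..m2} (\<lambda>x. Hp (x, 0))"
    by (intro continuous_at_imp_continuous_on ballI DERIV_isCont[OF dHp_x]) (use sub in auto)
  \<comment> \<open>\<open>\<sigma>\<close> is the sign of the drift Hp(x, 0), constant on (m1, m2)
    because the drift has no zero there.\<close>
  define \<sigma> :: real where "\<sigma> = (if Hp (c, 0) > 0 then 1 else -1)"
  have \<sigma>: "\<sigma> = 1 \<or> \<sigma> = -1" by (simp add: \<sigma>_def)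
  have sb: "\<sigma> * Hp (x, 0) > 0" if x: "x \<in> {m1<..<m2}" for x
  proof (rule ccontr)
    assume n: "\<not> ?thesis"
    have 1: "\<sigma> * Hp (c, 0) > 0" using b[OF c] by (auto simp: \<sigma>_def)
    have 2: "\<sigma> * Hp (x, 0) < 0" using n b[OF x] \<sigma> by auto
    have cc: "continuous_on {m1..m2} (\<lambda>x. \<sigma> * Hp (x, 0))" by (intro continuous_intros contb)
    have "\<exists>y. min x c \<le> y \<and> y \<le> max x c \<and> \<sigma> * Hp (y, 0) = 0"
    proof (cases "x \<le> c")
      case True
      have "continuous_on {x..c} (\<lambda>x. \<sigma> * Hp (x, 0))" by (rule continuous_on_subset[OF cc]) (use x c in auto)
      from IVT'[of "\<lambda>x. \<sigma> * Hp (x, 0)" x 0 c, OF _ _ True this] 1 2 show ?thesis using True by auto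
    next
      case False
      have "continuous_on {c..x} (\<lambda>x. \<sigma> * Hp (x, 0))" by (rule continuous_on_subset[OF cc]) (use x c in auto)
      from IVT2'[of "\<lambda>x. \<sigma> * Hp (x, 0)" x 0 c, OF _ _ _ this] 1 2 show ?thesis using False by auto
    qed
    then obtain y where "min x c \<le> y" "y \<le> max x c" "\<sigma> * Hp (y, 0) = 0" by auto
    moreover from this have "y \<in> {m1<..<m2}" using x c by auto
    ultimately show False using b[of y] \<sigma> by auto
  qed
  have ds: "((\<lambda>x. \<sigma> * Hp (x, 0)) has_real_derivative \<sigma> * Hpx (x, 0)) (at x)" if "x \<in> I" for x
    by (rule DERIV_cmult[OF dHp_x[OF that]])
  \<comment> \<open>\<sigma> times the drift vanishes at m1 and is positive to its right, so its
    slope there cannot be negative; at m2 the same reasoning from the left gives the opposite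
    sign.\<close>
  have n1: "1 * \<sigma> * Hpx (m1, 0) > 0"
  proof (rule ccontr)
    assume "\<not> ?thesis"
    hence "\<sigma> * Hpx (m1, 0) < 0" using nd \<sigma> by auto
    from DERIV_neg_dec_right[OF ds[OF m(1)] this] obtain d where
      d: "d > 0" "\<And>h. 0 < h \<Longrightarrow> h < d \<Longrightarrow> \<sigma> * Hp (m1, 0) > \<sigma> * Hp (m1 + h, 0)" by auto
    define h where "h = min (d / 2) (c - m1)"
    have "0 < h" "h < d" "m1 + h \<in> {m1<..<m2}" using d c by (auto simp: h_def min_def)
    thus False using d(2)[of h] sb[of "m1 + h"] m by simp
  qed
  have n2: "- 1 * \<sigma> * Hpx (m2, 0) > 0"
  proof (rule ccontr)
    assume "\<not> ?thesis"
    hence "\<sigma> * Hpx (m2, 0) > 0" using nd \<sigma> by auto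
    from DERIV_pos_inc_left[OF ds[OF m(2)] this] obtain d where
      d: "d > 0" "\<And>h. 0 < h \<Longrightarrow> h < d \<Longrightarrow> \<sigma> * Hp (m2 - h, 0) < \<sigma> * Hp (m2, 0)" by auto
    define h where "h = min (d / 2) (m2 - c)"
    have "0 < h" "h < d" "m2 - h \<in> {m1<..<m2}" using d c by (auto simp: h_def min_def)
    thus False using d(2)[of h] sb[of "m2 - h"] m by simp
  qed
  obtain d1 where d1: "d1 > 0" "\<And>x p. x \<in> I \<Longrightarrow> \<bar>x - m1\<bar> < d1 \<Longrightarrow> \<sigma> * Hp (x, 0) > 0 \<Longrightarrow> Hp (x, p) = 0 \<Longrightarrow> Hx (x, p) < 0"
    using Hx_sign_near_equilibrium[OF m(1,3) \<sigma> n1] by auto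
  obtain d2 where d2: "d2 > 0" "\<And>x p. x \<in> I \<Longrightarrow> \<bar>x - m2\<bar> < d2 \<Longrightarrow> \<sigma> * Hp (x, 0) > 0 \<Longrightarrow> Hp (x, p) = 0 \<Longrightarrow> Hx (x, p) > 0"
    using Hx_sign_near_equilibrium[OF m(2,4) \<sigma> n2] by auto
  \<comment> \<open>Including the distances to c puts the two end zones on different sides of
    c.\<close>
  define \<delta> where "\<delta> = min (min d1 d2) (min (c - m1) (m2 - c))"
  have \<delta>: "\<delta> > 0" "\<delta> \<le> d1" "\<delta> \<le> d2" "\<delta> \<le> c - m1" "\<delta> \<le> m2 - c" using d1 d2 c by (auto simp: \<delta>_def)
  define J where "J = {m1 + \<delta>..m2 - \<delta>}"
  have JI: "J \<subseteq> {m1<..<m2}" using \<delta> by (auto simp: J_def)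
  have "J \<subseteq> {m1..m2}" using \<delta> by (auto simp: J_def)
  hence JI': "J \<subseteq> I" using sub by (rule order_trans)
  obtain B where B: "\<And>x p. x \<in> J \<Longrightarrow> H (x, p) \<le> 0 \<Longrightarrow> \<bar>p\<bar> < B"
    using coercive[OF _ JI', of 0] unfolding J_def by (metis compact_Icc)
  \<comment> \<open>The critical points away from the end zones form a compact set on which H is
    negative, hence bounded by some -h < 0. Energies above -h then have turning points in the end
    zones only.\<close>
  define C where "C = {z \<in> J \<times> {-B..B}. Hp z = 0}"
  have neg: "H (x, p) < 0" if "x \<in> J" "Hp (x, p) = 0" for x p
    by (rule H_critical_neg[OF subsetD[OF JI' that(1)] that(2) b[OF subsetD[OF JI that(1)]]])
  have sJ: "J \<times> {-B..B} \<subseteq> I \<times> UNIV" using JI' by auto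
  have "C = (J \<times> {-B..B}) \<inter> Hp -` {0}" by (auto simp: C_def)
  moreover have "closed ((J \<times> {-B..B}) \<inter> Hp -` {0})"
    by (intro continuous_closed_preimage continuous_on_subset[OF cHp sJ] closed_Times) (auto simp: J_def)
  moreover have "compact (J \<times> {-B..B})" by (auto simp: J_def intro!: compact_Times)
  ultimately have cC: "compact C" by (metis compact_Int_closed inf.left_idem)
  have "\<exists>h>0. \<forall>z\<in>C. H z \<le> - h"
  proof (cases "C = {}")
    case True thus ?thesis by (auto intro!: exI[of _ "1::real"])
  next
    case False
    have "continuous_on C H" by (rule continuous_on_subset[OF cH]) (use sJ in \<open>auto simp: C_def\<close>)
    from continuous_attains_sup[OF cC False this] obtain z where z: "z \<in> C" "\<And>y. y \<in> C \<Longrightarrow> H y \<le> H z" by auto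
    have "H z < 0" using neg[of "fst z" "snd z"] z(1) by (auto simp: C_def)
    thus ?thesis using z by (intro exI[of _ "- H z"]) auto
  qed
  then obtain h where h: "h > 0" "\<And>z. z \<in> C \<Longrightarrow> H z \<le> - h" by auto
  show ?thesis
  proof (intro exI[of _ h] conjI h(1) ballI allI impI)
    fix x p assume x: "x \<in> {m1<..<m2}" and z: "Hp (x, p) = 0" and e: "H (x, p) > - h"
    have xI: "x \<in> I" using x sub by auto
    have "x \<notin> J"
    proof
      assume "x \<in> J"
      hence "(x, p) \<in> C" using B[of x p] neg[of x p] z by (auto simp: C_def abs_less_iff)
      thus False using h(2) e by fastforce
    qed
    then consider "x < m1 + \<delta>" | "x > m2 - \<delta>" by (auto simp: J_def)
    thus "(x > c \<and> Hx (x, p) > 0) \<or> (x < c \<and> Hx (x, p) < 0)"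
    proof cases
      case 1
      hence "Hx (x, p) < 0" using x \<delta> by (intro d1(2) xI sb z) auto
      thus ?thesis using 1 \<delta> by auto
    next
      case 2
      hence "Hx (x, p) > 0" using x \<delta> by (intro d2(2) xI sb z) auto
      thus ?thesis using 2 \<delta> by auto
    qed
  qed
qed

definition traj :: "real \<Rightarrow> (real \<Rightarrow> real) \<Rightarrow> (real \<Rightarrow> real) \<Rightarrow> bool" where
  "traj T X P \<longleftrightarrow> (\<forall>s\<in>{0..<T}. X s \<in> I \<and>
     (X has_real_derivative Hp (X s, P s)) (at s within {0..<T}) \<and>
     (P has_real_derivative - Hx (X s, P s)) (at s within {0..<T}))"

text \<open>The counterpart of \<open>Gt\<close> inside the locale. Trajectories are asked to stay
  in the open set \<open>I\<close>, so \<open>reach\<close> is contained in \<open>Gt\<close>, and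
  this inclusion is enough for exhibiting overhangs.\<close>

definition reach :: "(real \<Rightarrow> real) \<Rightarrow> real \<Rightarrow> (real \<times> real) set" where
  "reach g t = {(X t, P t) | X P. \<exists>x\<in>I. \<exists>T>t. traj T X P \<and> X 0 = x \<and> P 0 = g x}"

end

text \<open>As long as it stays in the box, the cut-off flow solves the original equations. The
  strict bound on t fits the half-open life span used in \<open>reach\<close> and
  \<open>Gt\<close>.\<close>

lemma (in ham_box) flow_in_reach:
  assumes b: "\<And>s. s \<in> {0..<T} \<Longrightarrow> flow (x, g x) s \<in> bx" and t: "0 \<le> t" "t < T" and x: "x \<in> I"
  shows "flow (x, g x) t \<in> reach g t"
proof -
  have "traj T (\<lambda>s. fst (flow (x, g x) s)) (\<lambda>s. snd (flow (x, g x) s))"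
    unfolding traj_def
  proof (intro ballI conjI)
    fix s assume s: "s \<in> {0..<T}"
    show "fst (flow (x, g x) s) \<in> I" using b[OF s] box_I by (cases "flow (x, g x) s") auto
    have "s \<ge> 0" "{0..<T} \<subseteq> {0..}" using s by auto
    from flow_deriv_in_box[OF this b[OF s]]
    show "((\<lambda>s. fst (flow (x, g x) s)) has_real_derivative Hp (fst (flow (x, g x) s), snd (flow (x, g x) s))) (at s within {0..<T})"
     "((\<lambda>s. snd (flow (x, g x) s)) has_real_derivative - Hx (fst (flow (x, g x) s), snd (flow (x, g x) s))) (at s within {0..<T})"
      by auto
  qed
  thus ?thesis unfolding reach_def
    using x t by (intro CollectI exI[of _ "\<lambda>s. fst (flow (x, g x) s)"] exI[of _ "\<lambda>s. snd (flow (x, g x) s)"])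
      (auto simp: flow_0)
qed

section \<open>Overhangs between two equilibria\<close>

text \<open>If V were negative at every contact, the constant c would be a barrier.\<close>

lemma up_crossing:
  fixes X V :: "real \<Rightarrow> real"
  assumes d: "\<And>s. s \<ge> 0 \<Longrightarrow> (X has_real_derivative V s) (at s within {0..})"
    and s: "0 \<le> s" "s \<le> s'" "X s < c" "X s' > c"
  shows "\<exists>u\<in>{s..s'}. X u = c \<and> V u \<ge> 0"
proof (rule ccontr)
  assume n: "\<not> ?thesis"
  have "X s' < c"
  proof (rule barrier[of s s' X V "\<lambda>_. c" "\<lambda>_. 0"])
    fix r assume r: "r \<in> {s..s'}"
    show "(X has_real_derivative V r) (at r within {s..s'})" by (rule DERIV_subset[OF d]) (use r s in auto)
    show "V r < 0" if "X r = c" using n r that by auto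
  qed (use s in auto)
  thus False using s by simp
qed

context ham_box
begin

text \<open>Over the two equilibria H is nonnegative and zero only at p = 0, so an orbit of
  nonpositive energy could leave sideways only through a fixed point, which no other orbit reaches
  in finite time. The momentum is bounded by the energy.\<close>

lemma confined_nonpositive_energy:
  assumes m: "Hp (lo, 0) = 0" "Hp (hi, 0) = 0"
    and B: "\<And>x p. x \<in> {lo..hi} \<Longrightarrow> H (x, p) \<le> 0 \<Longrightarrow> \<bar>p\<bar> < B"
    and z: "z \<in> obx" "H z \<le> 0" and t: "t \<ge> 0"
  shows "flow z t \<in> obx"
proof (rule stays_inside[of t "flow z" obx bx])
  show "continuous_on {0..t} (flow z)" by (rule continuous_on_subset[OF flow_cont_s]) auto
  show "open obx" by (intro open_Times) auto
  show "closed bx" by (intro closed_Times) auto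
  show "obx \<subseteq> bx" by auto
  show "flow z 0 \<in> obx" using z by (simp add: flow_0)
  fix r assume r: "r \<in> {0..t}" "\<forall>s\<in>{0..r}. flow z s \<in> bx"
  have e: "H (flow z r) \<le> 0" using energy_conserved[of r z] r z by auto
  obtain x p where xp: "flow z r = (x, p)" by (cases "flow z r")
  have x: "x \<in> {lo..hi}" using r xp by (metis atLeastAtMost_iff mem_Sigma_iff order.refl)
  have I: "lo \<in> I" "hi \<in> I" using box_I lohi by auto
  have fixed: False if "x = m" "m \<in> {lo, hi}" for m
  proof -
    have p0: "p = 0"
    proof (rule ccontr)
      assume "p \<noteq> 0"
      thus False using H_equilibrium_pos[OF I(1) m(1), of p] H_equilibrium_pos[OF I(2) m(2), of p] e xp that by auto
    qed
    have "(x, p) \<in> bx" using that p0 lohi B_pos by auto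
    hence "F (x, p) = 0" using clamp_box_id[of "(x, p)" lo hi B] that m p0 Hx0[OF I(1)] Hx0[OF I(2)]
      by (auto simp: fld_def zero_prod_def)
    hence "flow (x, p) r = flow z r" using flow_fixed[of "(x, p)" r] r xp by auto
    from flow_inj[OF _ this] r have "(x, p) = z" by auto
    thus False using z(1) that by auto
  qed
  have "x \<noteq> lo" "x \<noteq> hi" using fixed[of lo] fixed[of hi] by auto
  moreover have "\<bar>p\<bar> < B" using B[OF x, of p] e xp by auto
  ultimately show "flow z r \<in> obx" using x xp by auto
qed (use t in auto)

end

context hamiltonian
begin

theorem overhang_between_equilibria:
  assumes m: "m1 \<in> I" "m2 \<in> I" "m1 < m2" "Hp (m1, 0) = 0" "Hp (m2, 0) = 0"
    and b: "\<And>x. x \<in> {m1<..<m2} \<Longrightarrow> Hp (x, 0) \<noteq> 0"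
    and nd: "Hpx (m1, 0) \<noteq> 0" "Hpx (m2, 0) \<noteq> 0"
    and g: "continuous_on I g" and y: "y \<in> {m1<..<m2}" "H (y, g y) < 0"
  shows "\<exists>t0>0. \<exists>c\<in>{m1<..<m2}. \<forall>t\<ge>t0. overhang (reach g t) c"
proof -
  have sub: "{m1..m2} \<subseteq> I" by (rule Icc_subset[OF m(1,2)])
  define e where "e x = H (x, g x)" for x
  have ce: "continuous_on {m1..m2} e"
    unfolding e_def
    by (rule continuous_on_compose2[OF cH]) (use sub in \<open>auto intro!: continuous_intros continuous_on_subset[OF g]\<close>)
  \<comment> \<open>The last point before y with nonnegative energy will be \<open>a\<close>; the
    set contains m1 because H is nonnegative over an equilibrium.\<close>
  define S where "S = {x \<in> {m1..y}. e x \<in> {0..}}"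
  have "continuous_on {m1..y} e" by (rule continuous_on_subset[OF ce]) (use y in auto)
  hence "closed ({m1..y} \<inter> e -` {0..})" by (intro continuous_closed_preimage) auto
  moreover have "S = {m1..y} \<inter> e -` {0..}" by (auto simp: S_def)
  moreover have "m1 \<in> S" using y H_equilibrium_nonneg[OF m(1,4)] by (auto simp: S_def e_def)
  moreover have bdS: "bdd_above S" by (auto simp: S_def bdd_above_def)
  ultimately have "Sup S \<in> S" by (intro closed_contains_Sup) auto
  define a where "a = Sup S"
  have a: "m1 \<le> a" "a \<le> y" "e a \<ge> 0" using \<open>Sup S \<in> S\<close> by (auto simp: a_def S_def)
  have ay: "a < y" using a y by (cases "a = y") (auto simp: e_def)
  have neg: "e x < 0" if "a < x" "x \<le> y" for x
    using cSup_upper[OF _ bdS, of x] that a by (force simp: S_def a_def not_le)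
  have ea: "e a = 0"
  proof (rule ccontr)
    assume "e a \<noteq> 0"
    hence "e a > 0" using a by simp
    moreover have "continuous_on {a..y} e" by (rule continuous_on_subset[OF ce]) (use a y in auto)
    ultimately obtain x where "a \<le> x" "x \<le> y" "e x = 0" using IVT2'[of e y 0 a] neg[of y] ay by auto
    thus False using neg[of x] \<open>e a \<noteq> 0\<close> by (cases "x = a") auto
  qed
  \<comment> \<open>The line is placed to the right of \<open>a\<close>, so that every curve with
    parameter near \<open>a\<close> starts to its left.\<close>
  define c where "c = (a + m2) / 2"
  have c: "c \<in> {m1<..<m2}" "a < c" using a ay y by (auto simp: c_def)
  obtain h where h: "h > 0" "\<And>x p. x \<in> {m1<..<m2} \<Longrightarrow> Hp (x, p) = 0 \<Longrightarrow> H (x, p) > - h \<Longrightarrow>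
     (x > c \<and> Hx (x, p) > 0) \<or> (x < c \<and> Hx (x, p) < 0)"
    using turning_points[OF m(1,2,4,5) b nd c(1)] by blast
  have "a \<in> {m1..m2}" using a y by auto
  with ce h(1) obtain d where d: "d > 0" "\<And>x. x \<in> {m1..m2} \<Longrightarrow> dist x a < d \<Longrightarrow> dist (e x) (e a) < h"
    unfolding continuous_on_iff by meson
  \<comment> \<open>\<open>d / 2\<close> keeps the energies above -h, \<open>y - a\<close> keeps
    them negative beyond \<open>a\<close>, and \<open>(c - a) / 2\<close> keeps the starting points
    left of c.\<close>
  define w where "w = a + min (d / 2) (min (y - a) ((c - a) / 2))"
  have w: "a < w" "w \<le> y" "w < c" "w - a < d" using d(1) ay c by (auto simp: w_def min_def field_simps)
  have e_low: "e x > - h" if "a \<le> x" "x \<le> w" for x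
    using d(2)[of x] that w a y by (auto simp: dist_real_def ea abs_less_iff)
  obtain B0 where B0: "\<And>x p. x \<in> {m1..m2} \<Longrightarrow> H (x, p) \<le> 0 \<Longrightarrow> \<bar>p\<bar> < B0"
    using coercive[OF compact_Icc sub, of 0] by blast
  define B where "B = max B0 1"
  have B: "\<And>x p. x \<in> {m1..m2} \<Longrightarrow> H (x, p) \<le> 0 \<Longrightarrow> \<bar>p\<bar> < B" using B0 by (fastforce simp: B_def)
  interpret X: ham_box I H Hx Hp Hxx Hxp Hpx Hpp m1 m2 B
    by unfold_locales (use m sub in \<open>auto simp: B_def\<close>)
  define Z where "Z x s = X.flow (x, g x) s" for x s
  have conf: "Z x s \<in> X.obx" if "a < x" "x \<le> w" "s \<ge> 0" for x s
    unfolding Z_def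
  proof (rule X.confined_nonpositive_energy[OF m(4,5) B])
    have "x \<in> {m1<..<m2}" "e x < 0" using that w a y neg[of x] by auto
    thus "(x, g x) \<in> X.obx" "H (x, g x) \<le> 0" using B[of x "g x"] by (auto simp: e_def)
  qed (use that in auto)
  \<comment> \<open>If a = m1, the orbit of \<open>a\<close> is the fixed point itself, on the
    boundary of the box, so strict confinement is replaced by this alternative.\<close>
  have confa: "(a = m1 \<and> Z a s = (a, 0)) \<or> (a > m1 \<and> Z a s \<in> X.obx)" if s: "s \<ge> 0" for s
  proof (cases "a = m1")
    case True
    have "g a = 0" using H_equilibrium_pos[OF m(1,4), of "g a"] ea True by (auto simp: e_def)
    moreover have "X.F (a, 0) = 0" using clamp_box_id[of "(a, 0)" m1 m2 B] True m X.B_pos Hx0[OF m(1)]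
      by (auto simp: fld_def zero_prod_def)
    ultimately show ?thesis using True X.flow_fixed[of "(a, 0)" s] s by (auto simp: Z_def)
  next
    case False
    have "Z a s \<in> X.obx" unfolding Z_def
    proof (rule X.confined_nonpositive_energy[OF m(4,5) B])
      have "a \<in> {m1<..<m2}" using False a y by auto
      thus "(a, g a) \<in> X.obx" "H (a, g a) \<le> 0" using B[of a "g a"] ea by (auto simp: e_def)
    qed (use s in auto)
    thus ?thesis using False a by auto
  qed
  have inbx: "Z x s \<in> X.bx" if "x \<in> {a..w}" "s \<ge> 0" for x s
  proof (cases "x = a")
    case True
    from confa[OF that(2)] show ?thesis using True X.B_pos m by auto
  next
    case False
    have "Z x s \<in> X.obx" using conf[of x s] that False by auto
    thus ?thesis by auto
  qed
  have energy: "H (Z x s) = e x" if "x \<in> {a..w}" "s \<ge> 0" for x s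
    unfolding Z_def e_def by (rule X.energy_conserved) (use inbx that in \<open>auto simp: Z_def\<close>)
  define XX where "XX x s = fst (Z x s)" for x s
  \<comment> \<open>With the clamp inside, \<open>V\<close> is the derivative of \<open>XX\<close>
    for all parameters and all s >= 0; on [a, w] it is the true velocity.\<close>
  define V where "V x s = Hp (clamp_box m1 m2 B (Z x s))" for x s
  have V: "V x s = Hp (Z x s)" if "x \<in> {a..w}" "s \<ge> 0" for x s
    using clamp_box_id[OF inbx[OF that]] by (simp add: V_def)
  have gc: "continuous_on {a..w} g" by (rule continuous_on_subset[OF g]) (use sub a y w in auto)
  have cZ: "continuous_on ({a..w} \<times> {0..}) (\<lambda>(x, s). Z x s)"
  proof -
    have "continuous_on ({a..w} \<times> {0..}) (\<lambda>q. X.flow (fst q, g (fst q)) (snd q))"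
      by (rule continuous_on_uncurry[OF X.flow_cont])
         (auto intro!: continuous_intros continuous_on_compose2[OF gc])
    thus ?thesis by (simp add: Z_def case_prod_unfold)
  qed
  have cX: "continuous_on ({a..w} \<times> {0..}) (\<lambda>(x, s). XX x s)"
    using continuous_on_fst[OF cZ] by (simp add: XX_def case_prod_unfold)
  have cV: "continuous_on ({a..w} \<times> {0..}) (\<lambda>(x, s). V x s)"
  proof -
    have "continuous_on ({a..w} \<times> {0..}) (\<lambda>q. Hp ((\<lambda>(x, s). Z x s) q))"
    proof (rule continuous_on_compose2[OF cHp cZ])
      show "(\<lambda>(x, s). Z x s) ` ({a..w} \<times> {0..}) \<subseteq> I \<times> UNIV"
        using inbx sub by fastforce
    qed
    moreover have "Hp ((\<lambda>(x, s). Z x s) q) = (\<lambda>(x, s). V x s) q" if "q \<in> {a..w} \<times> {0..}" for q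
      using that V by (cases q) auto
    ultimately show ?thesis by (simp cong: continuous_on_cong)
  qed
  have dX: "(XX x has_real_derivative V x s) (at s within {0..})" if "s \<ge> 0" for x s
    unfolding XX_def V_def Z_def using X.flow_X[OF that order.refl] by blast
  \<comment> \<open>A tangency would be a turning point over c itself with energy above -h, but such
    turning points lie strictly to one side of c.\<close>
  have trans: "V x s \<noteq> 0" if "x \<in> {a..w}" "s \<ge> 0" "XX x s = c" for x s
  proof
    assume v0: "V x s = 0"
    have Zc: "(c, snd (Z x s)) = Z x s" using that(3) by (simp add: XX_def prod_eq_iff)
    have "Hp (c, snd (Z x s)) = 0" using V[OF that(1,2)] v0 unfolding Zc by simp
    moreover have "H (c, snd (Z x s)) > - h" using energy[OF that(1,2)] that(1) e_low[of x] unfolding Zc by auto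
    ultimately show False using h(2)[OF c(1)] by blast
  qed
  have init: "XX x 0 < c" if "x \<in> {a..w}" for x using that w by (simp add: XX_def Z_def X.flow_0)
  \<comment> \<open>A moving zero-energy orbit has no turning points, since critical energies are
    negative. Its velocity keeps one sign, and an orbit that starts left of c and reaches c moves to
    the right.\<close>
  have left: "V a s > 0" if s: "s \<ge> 0" "XX a s = c" for s
  proof (rule ccontr)
    assume n: "\<not> V a s > 0"
    have am: "a > m1" using confa[OF s(1)] s c by (auto simp: XX_def)
    have aw: "a \<in> {a..w}" using w by auto
    have nz: "V a u \<noteq> 0" if "u \<ge> 0" for u
    proof
      assume v0: "V a u = 0"
      obtain x p where xp: "Z a u = (x, p)" by (cases "Z a u")
      have "x \<in> {m1<..<m2}" using confa[OF that] am xp by auto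
      moreover have "x \<in> I" using calculation sub by auto
      moreover have "Hp (x, p) = 0" using V[OF aw that] v0 xp by simp
      ultimately have "H (x, p) < 0" using b by (intro H_critical_neg) auto
      thus False using energy[OF aw that] ea xp by simp
    qed
    have Vs: "V a s < 0" using n nz[OF s(1)] by simp
    have "\<exists>\<xi>>0. \<xi> < s \<and> V a \<xi> \<ge> 0"
    proof (rule ccontr)
      assume k: "\<not> ?thesis"
      have "XX a s \<le> XX a 0"
        by (rule nonincreasing_within[of 0 s "XX a" "V a"])
           (use k s in \<open>auto intro!: DERIV_subset[OF dX] simp: not_le less_imp_le\<close>)
      thus False using init[OF aw] s by simp
    qed
    then obtain \<xi> where \<xi>: "\<xi> > 0" "\<xi> < s" "V a \<xi> \<ge> 0" by auto
    have "continuous_on {\<xi>..s} (V a)"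
      using continuous_on_uncurry[OF cV continuous_on_const continuous_on_id, of "{\<xi>..s}" a] aw \<xi> by auto
    then obtain u where "\<xi> \<le> u" "u \<le> s" "V a u = 0" using IVT2'[of "V a" s 0 \<xi>] \<xi> Vs by auto
    thus False using nz[of u] \<xi> by auto
  qed
  have ww: "w \<in> {a..w}" using w by auto
  \<comment> \<open>The acceleration along an orbit. At a turning point it reduces to -Hpp Hx with
    Hpp > 0, so it points towards c.\<close>
  define A where "A z = Hpx z * Hp z - Hpp z * Hx z" for z
  have cA: "continuous_on (I \<times> UNIV) A" unfolding A_def by (intro continuous_intros cHpx cHp cHpp cHx)
  have dV: "(V w has_real_derivative A (Z w s)) (at s within {s0..})" if "s \<ge> s0" "s0 \<ge> 0" for s s0
  proof -
    have "((\<lambda>s. Hp (Z w s)) has_real_derivative A (Z w s)) (at s within {s0..})"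
      unfolding Z_def A_def by (rule X.deriv_along_flow[OF dHp]) (use that inbx[OF ww] in \<open>auto simp: Z_def\<close>)
    thus ?thesis
      by (rule has_field_derivative_transform_within[of _ _ _ _ 1]) (use that V[OF ww] in auto)
  qed
  have dXw: "(XX w has_real_derivative V w s) (at s within {s0..})" if "s \<ge> s0" "s0 \<ge> 0" for s s0
    by (rule DERIV_subset[OF dX]) (use that in auto)
  have Xb: "\<bar>XX w s\<bar> \<le> \<bar>m1\<bar> + \<bar>m2\<bar>" if "s \<ge> 0" for s
    using inbx[OF ww that] by (cases "Z w s") (auto simp: XX_def)
  define M where "M = {z \<in> X.bx. H z = e w}"
  have sbx: "X.bx \<subseteq> I \<times> UNIV" using sub by auto
  have cM: "compact (M \<inter> J)" if "closed J" for J
  proof -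
    have "M \<inter> J = X.bx \<inter> ((X.bx \<inter> H -` {e w}) \<inter> J)" by (auto simp: M_def)
    moreover have "closed ((X.bx \<inter> H -` {e w}) \<inter> J)"
      by (intro closed_Int continuous_closed_preimage continuous_on_subset[OF cH sbx] closed_Times that) auto
    ultimately show ?thesis by (metis compact_Int_closed compact_Times compact_Icc)
  qed
  have ZM: "Z w s \<in> M" if "s \<ge> 0" for s using inbx[OF ww that] energy[OF ww that] by (simp add: M_def)
  have crit: "(fst z > c \<and> A z < 0) \<or> (fst z < c \<and> A z > 0)" if z: "z \<in> M" "Hp z = 0" for z
  proof -
    obtain x p where zz: "z = (x, p)" by (cases z)
    have ew: "e w < 0" "e w > - h" using neg[of w] e_low[of w] w by auto
    have xb: "x \<in> {m1..m2}" and Hz: "H (x, p) = e w" using z zz by (auto simp: M_def)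
    have "x \<noteq> m1" "x \<noteq> m2"
      using H_equilibrium_nonneg[OF m(1,4), of p] H_equilibrium_nonneg[OF m(2,5), of p] Hz ew by auto
    hence x: "x \<in> {m1<..<m2}" using xb by auto
    have Az: "A (x, p) = - (Hpp (x, p) * Hx (x, p))" using z zz by (simp add: A_def)
    have pp: "Hpp (x, p) > 0" using x sub by (intro Hpp_pos) auto
    have "(x > c \<and> Hx (x, p) > 0) \<or> (x < c \<and> Hx (x, p) < 0)" using h(2)[OF x, of p] z ew Hz zz by auto
    thus ?thesis using pp by (auto simp: zz Az mult_less_0_iff zero_less_mult_iff)
  qed
  \<comment> \<open>An orbit that stays on the right of c would be pushed left whenever it is slow,
    uniformly by compactness of the energy level; this contradicts its boundedness.\<close>
  have osc_left: "\<exists>s\<ge>s0. XX w s < c" if s0: "s0 \<ge> 0" for s0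
  proof (rule ccontr)
    assume n: "\<not> ?thesis"
    let ?M = "M \<inter> {z. fst z \<ge> c}"
    have cl: "closed {z :: real \<times> real. fst z \<ge> c}" by (intro closed_Collect_le continuous_intros)
    have sM: "?M \<subseteq> I \<times> UNIV" using sbx by (auto simp: M_def)
    have "A z < 0" if "z \<in> ?M" "Hp z = 0" for z using crit[of z] that by auto
    from compact_sign_gap[OF cM[OF cl] continuous_on_subset[OF cHp sM] continuous_on_subset[OF cA sM] this]
    obtain \<delta> \<kappa> where k: "\<delta> > 0" "\<kappa> > 0" "\<And>z. z \<in> ?M \<Longrightarrow> \<bar>Hp z\<bar> \<le> \<delta> \<Longrightarrow> A z \<le> - \<kappa>"
      by blast
    show False
    proof (rule decelerating_escapes[OF dXw dV k(1,2), where R = "\<bar>m1\<bar> + \<bar>m2\<bar>"])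
      fix s assume s: "s0 \<le> s" "\<bar>V w s\<bar> \<le> \<delta>"
      have "Z w s \<in> ?M" using ZM[of s] n s s0 by (auto simp: XX_def not_less)
      thus "A (Z w s) \<le> - \<kappa>" using s s0 V[OF ww] by (intro k(3)) auto
    qed (use s0 Xb in auto)
  qed
  have osc_right: "\<exists>s\<ge>s0. XX w s > c" if s0: "s0 \<ge> 0" for s0
  proof (rule ccontr)
    assume n: "\<not> ?thesis"
    let ?M = "M \<inter> {z. fst z \<le> c}"
    have cl: "closed {z :: real \<times> real. fst z \<le> c}" by (intro closed_Collect_le continuous_intros)
    have sM: "?M \<subseteq> I \<times> UNIV" using sbx by (auto simp: M_def)
    have cm: "continuous_on ?M (\<lambda>z. - A z)" by (intro continuous_intros continuous_on_subset[OF cA sM])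
    have "- A z < 0" if "z \<in> ?M" "Hp z = 0" for z using crit[of z] that by auto
    from compact_sign_gap[OF cM[OF cl] continuous_on_subset[OF cHp sM] cm this]
    obtain \<delta> \<kappa> where k: "\<delta> > 0" "\<kappa> > 0" "\<And>z. z \<in> ?M \<Longrightarrow> \<bar>Hp z\<bar> \<le> \<delta> \<Longrightarrow> - A z \<le> - \<kappa>"
      by blast
    show False
    proof (rule decelerating_escapes[OF DERIV_minus[OF dXw] DERIV_minus[OF dV] k(1,2), where R = "\<bar>m1\<bar> + \<bar>m2\<bar>"])
      fix s assume s: "s0 \<le> s" "\<bar>- V w s\<bar> \<le> \<delta>"
      have "Z w s \<in> ?M" using ZM[of s] n s s0 by (auto simp: XX_def not_less)
      thus "- A (Z w s) \<le> - \<kappa>" using s s0 V[OF ww] by (intro k(3)) auto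
    qed (use s0 Xb in auto)
  qed
  \<comment> \<open>Right, left and right again: this forces an upward, a downward and an upward
    crossing. The last of them, \<open>u3\<close>, serves as t0.\<close>
  obtain s1 where s1: "s1 \<ge> 0" "XX w s1 > c" using osc_right[of 0] by auto
  obtain s2 where s2: "s2 \<ge> s1" "XX w s2 < c" using osc_left[of s1] s1 by auto
  obtain s3 where s3: "s3 \<ge> s2" "XX w s3 > c" using osc_right[of s2] s1 s2 by auto
  obtain u1 where u1: "0 \<le> u1" "u1 \<le> s1" "XX w u1 = c" "V w u1 \<ge> 0"
    using up_crossing[of "XX w" "V w" 0 s1 c] dX init[OF ww] s1 by auto
  obtain u2 where u2: "s1 \<le> u2" "u2 \<le> s2" "XX w u2 = c" "V w u2 \<le> 0"
    using up_crossing[of "\<lambda>s. - XX w s" "\<lambda>s. - V w s" s1 s2 "- c"] DERIV_minus[OF dX] s1 s2 by auto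
  obtain u3 where u3: "s2 \<le> u3" "u3 \<le> s3" "XX w u3 = c" "V w u3 \<ge> 0"
    using up_crossing[of "XX w" "V w" s2 s3 c] dX s1 s2 s3 by auto
  have vv: "V w u1 > 0" "V w u2 < 0" "V w u3 > 0"
    using trans[OF ww, of u1] trans[OF ww, of u2] trans[OF ww, of u3] u1 u2 u3 s1 s2 by auto
  have u3p: "u3 > 0" using u3 init[OF ww] s1 s2 by (cases "u3 = 0") auto
  have over: "overhang (reach g t) c" if t: "t \<ge> u3" for t
  proof -
    have ord: "0 \<le> u1" "u1 \<le> u2" "u2 \<le> u3" "u3 \<le> t" using u1 u2 u3 t by auto
    have aw: "a \<le> w" using w by simp
    note cr = crossings_at_time[OF cX cV dX trans init left aw ord u1(3) u2(3) u3(3) vv]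
    obtain x1 where x1: "x1 \<in> {a..w}" "XX x1 t = c" "V x1 t > 0" using cr(1) by blast
    obtain x2 where x2: "x2 \<in> {a..w}" "XX x2 t = c" "V x2 t < 0" using cr(2) by blast
    have t0: "t \<ge> 0" using t u3p by simp
    have rr: "Z x t \<in> reach g t" if "x \<in> {a..w}" for x
      unfolding Z_def by (rule X.flow_in_reach[of "t + 1"]) (use inbx[OF that] t0 that sub a y w in \<open>auto simp: Z_def\<close>)
    have "(c, snd (Z x1 t)) = Z x1 t" "(c, snd (Z x2 t)) = Z x2 t"
      using x1 x2 by (auto simp: XX_def prod_eq_iff)
    hence "(c, snd (Z x1 t)) \<in> reach g t" "(c, snd (Z x2 t)) \<in> reach g t"
      using rr[OF x1(1)] rr[OF x2(1)] by simp_all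
    \<comment> \<open>Equal momenta over the same position would give equal velocities, but these
      have opposite signs.\<close>
    moreover have "snd (Z x1 t) \<noteq> snd (Z x2 t)"
    proof
      assume "snd (Z x1 t) = snd (Z x2 t)"
      hence "Z x1 t = Z x2 t" using x1 x2 by (auto simp: XX_def prod_eq_iff)
      thus False using V[OF x1(1) t0] V[OF x2(1) t0] x1 x2 by simp
    qed
    ultimately show ?thesis unfolding overhang_def by blast
  qed
  show ?thesis using u3p c(1) over by blast
qed

end

section \<open>Traps and barriers near the ends of the interval\<close>

text \<open>For the field \<open>(F1, F2)\<close> on \<open>I\<close>, the corner \<open>x \<ge> y, p \<ge> q\<close> traps solutions up to time \<open>t\<close>
  (its lower edge may decay at rate \<open>M\<close>), and solutions that avoid it stay below the barrier \<open>b\<close>.\<close>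
definition corner :: "real set \<Rightarrow> (real \<Rightarrow> real \<Rightarrow> real) \<Rightarrow> (real \<Rightarrow> real \<Rightarrow> real) \<Rightarrow> real \<Rightarrow> real \<Rightarrow> real \<Rightarrow> real \<Rightarrow> bool" where
  "corner I F1 F2 t y q M \<longleftrightarrow> y \<in> I \<and> q > 0 \<and> M \<ge> 0 \<and>
     (\<forall>p\<ge>q * exp (- M * t). F1 y p \<ge> 0) \<and>
     (\<forall>s\<in>{0..t}. \<forall>x\<in>I. x \<ge> y \<longrightarrow> F2 x (q * exp (- M * s)) \<ge> - M * (q * exp (- M * s))) \<and>
     (\<forall>x\<in>I. \<exists>b b'. \<forall>s\<in>{0..t}. (b has_real_derivative b' s) (at s within {0..t}) \<and>
        b s \<in> I \<and> b s > x \<and> (\<forall>p\<le>q. F1 (b s) p < b' s))"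

text \<open>The horizon t comes first so that the starting level q may depend on it, which makes a
  decaying lower edge usable. The left end is treated by the same predicate after the reflection (x,
  p) -> (-x, -p), which turns the Hamiltonian field into (-Hp(-x, -p), Hx(-x, -p)).\<close>

definition end_trap :: "real set \<Rightarrow> (real \<Rightarrow> real \<Rightarrow> real) \<Rightarrow> (real \<Rightarrow> real \<Rightarrow> real) \<Rightarrow> bool" where
  "end_trap I F1 F2 \<longleftrightarrow> (\<forall>t>0. \<forall>z\<in>I. \<exists>y q M. y > z \<and> corner I F1 F2 t y q M)"

lemma barrier_range:
  fixes b :: "real \<Rightarrow> real"
  assumes I: "is_interval I" and t: "t \<ge> 0"
    and b: "\<And>s. s \<in> {0..t} \<Longrightarrow> (b has_real_derivative b' s) (at s within {0..t})" "\<And>s. s \<in> {0..t} \<Longrightarrow> b s \<in> I"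
  shows "\<exists>l u. l \<in> I \<and> u \<in> I \<and> (\<forall>s\<in>{0..t}. l \<le> b s \<and> b s \<le> u)"
proof -
  have c: "continuous_on {0..t} b" using b(1) by (meson DERIV_continuous continuous_on_eq_continuous_within)
  have ne: "{0..t} \<noteq> {}" using t by auto
  obtain s1 where "s1 \<in> {0..t}" "\<forall>s\<in>{0..t}. b s1 \<le> b s" using continuous_attains_inf[OF compact_Icc ne c] by auto
  moreover obtain s2 where "s2 \<in> {0..t}" "\<forall>s\<in>{0..t}. b s \<le> b s2" using continuous_attains_sup[OF compact_Icc ne c] by auto
  ultimately show ?thesis using b(2) by (intro exI[of _ "b s1"] exI[of _ "b s2"]) auto
qed

context ham_box
begin

lemma clamped_field_lipschitz:
  "\<bar>Hp (cl (x, p)) - Hp (cl (x', p'))\<bar> \<le> lipc * (\<bar>x - x'\<bar> + \<bar>p - p'\<bar>)"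
  "\<bar>- Hx (cl (x, p)) - - Hx (cl (x', p'))\<bar> \<le> lipc * (\<bar>x - x'\<bar> + \<bar>p - p'\<bar>)"
proof -
  have "norm (F (x, p) - F (x', p')) \<le> lipc * norm ((x, p) - (x', p'))" by (rule F_lipc)
  also have "\<dots> \<le> lipc * (\<bar>x - x'\<bar> + \<bar>p - p'\<bar>)"
    using lipc_pos norm_Pair_le[of "x - x'" "p - p'"] by (intro mult_left_mono) auto
  finally have n: "norm (F (x, p) - F (x', p')) \<le> lipc * (\<bar>x - x'\<bar> + \<bar>p - p'\<bar>)" .
  have 1: "\<bar>Hp (cl (x, p)) - Hp (cl (x', p'))\<bar> = norm (fst (F (x, p) - F (x', p')))" by (simp add: fld_def)
  have 2: "\<bar>- Hx (cl (x, p)) - - Hx (cl (x', p'))\<bar> = norm (snd (F (x, p) - F (x', p')))" by (simp add: fld_def)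
  have 3: "norm (fst w) \<le> norm w" "norm (snd w) \<le> norm w" for w :: "real \<times> real"
    using norm_fst_le[of "fst w" "snd w"] norm_snd_le[of "snd w" "fst w"] by simp_all
  show "\<bar>Hp (cl (x, p)) - Hp (cl (x', p'))\<bar> \<le> lipc * (\<bar>x - x'\<bar> + \<bar>p - p'\<bar>)"
    unfolding 1 using 3(1) n by (rule order_trans)
  show "\<bar>- Hx (cl (x, p)) - - Hx (cl (x', p'))\<bar> \<le> lipc * (\<bar>x - x'\<bar> + \<bar>p - p'\<bar>)"
    unfolding 2 using 3(2) n by (rule order_trans)
qed

lemma decaying_level_bounds:
  assumes q: "0 < q" "q \<le> B" and M: "M \<ge> 0" and s: "s \<ge> 0"
  shows "0 < q * exp (- M * s)" and "q * exp (- M * s) \<le> B"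
proof -
  show "0 < q * exp (- M * s)" using q by simp
  have "q * exp (- M * s) \<le> q" using q M s by (intro mult_left_le) auto
  thus "q * exp (- M * s) \<le> B" using q(2) by (rule order_trans)
qed

text \<open>\<open>corner_trap\<close> for the clamped field. The corner sits over a point of the
  box and its levels do not exceed \<open>B\<close>, so clamping a point on one of the two edges
  gives a point on the same edge, where the conditions on the original field apply.\<close>

lemma right_trap:
  assumes y: "y \<in> {lo..hi}" and q: "0 < q" "q \<le> B" and M: "M \<ge> 0"
    and T1: "\<And>p. p \<ge> q * exp (- M * t) \<Longrightarrow> Hp (y, p) \<ge> 0"
    and T2: "\<And>s x. s \<in> {0..t} \<Longrightarrow> x \<in> I \<Longrightarrow> x \<ge> y \<Longrightarrow> - Hx (x, q * exp (- M * s)) \<ge> - M * (q * exp (- M * s))"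
    and u: "u \<in> {0..t}" and init: "fst (flow z u) \<ge> y" "snd (flow z u) \<ge> q"
  shows "fst (flow z t) \<ge> y"
proof (rule corner_trap[where ?G1.0 = "\<lambda>x p. Hp (cl (x, p))" and ?G2.0 = "\<lambda>x p. - Hx (cl (x, p))"
      and X = "\<lambda>s. fst (flow z s)" and P = "\<lambda>s. snd (flow z s)" and u = u and L = lipc and M = M and q = q])
  note qe = decaying_level_bounds[OF q M]
  show "0 \<le> Hp (cl (y, p))" if p: "p \<ge> q * exp (- M * (t - u))" for p
  proof -
    \<comment> \<open>Entry at time u leaves only t - u for the level to decay, so the threshold for
      the full time t is passed as well.\<close>
    have tu: "q * exp (- M * t) \<le> q * exp (- M * (t - u))" using q M u by (intro mult_left_mono) (auto simp: algebra_simps)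
    have "cl (y, p) = (y, max (- B) (min B p))" using y by (auto simp: clamp_box_def)
    moreover have "q * exp (- M * t) \<le> max (- B) (min B p)" using p tu qe[of t] u by auto
    ultimately show ?thesis using T1 by simp
  qed
  show "- M * (q * exp (- M * s)) \<le> - Hx (cl (x, q * exp (- M * s)))" if s: "s \<in> {0..t - u}" and x: "y \<le> x" for s x
  proof -
    have "cl (x, q * exp (- M * s)) = (min hi x, q * exp (- M * s))" using y x qe[of s] s B_pos by (auto simp: clamp_box_def)
    moreover have "min hi x \<in> I" "min hi x \<ge> y" using y x box_I by (auto simp: min_def)
    ultimately show ?thesis using T2[of s "min hi x"] s u by simp
  qed
  show "\<And>s. s \<in> {u..t} \<Longrightarrow> ((\<lambda>s. fst (flow z s)) has_real_derivative Hp (cl (fst (flow z s), snd (flow z s)))) (at s within {u..t})"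
    using flow_X[of _ "{u..t}" z] u by auto
  show "\<And>s. s \<in> {u..t} \<Longrightarrow> ((\<lambda>s. snd (flow z s)) has_real_derivative - Hx (cl (fst (flow z s), snd (flow z s)))) (at s within {u..t})"
    using flow_P[of _ "{u..t}" z] u by auto
qed (use clamped_field_lipschitz lipc_pos M q u init in auto)

text \<open>The mirror image of \<open>right_trap\<close> under (x, p) -> (-x, -p).\<close>

lemma left_trap:
  assumes y: "- y \<in> {lo..hi}" and q: "0 < q" "q \<le> B" and M: "M \<ge> 0"
    and T1: "\<And>p. p \<ge> q * exp (- M * t) \<Longrightarrow> - Hp (- y, - p) \<ge> 0"
    and T2: "\<And>s x. s \<in> {0..t} \<Longrightarrow> - x \<in> I \<Longrightarrow> x \<ge> y \<Longrightarrow> Hx (- x, - (q * exp (- M * s))) \<ge> - M * (q * exp (- M * s))"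
    and u: "u \<in> {0..t}" and init: "- fst (flow z u) \<ge> y" "- snd (flow z u) \<ge> q"
  shows "- fst (flow z t) \<ge> y"
proof (rule corner_trap[where ?G1.0 = "\<lambda>x p. - Hp (cl (- x, - p))" and ?G2.0 = "\<lambda>x p. Hx (cl (- x, - p))"
      and X = "\<lambda>s. - fst (flow z s)" and P = "\<lambda>s. - snd (flow z s)" and u = u and L = lipc and M = M and q = q])
  note qe = decaying_level_bounds[OF q M]
  show "0 \<le> - Hp (cl (- y, - p))" if p: "p \<ge> q * exp (- M * (t - u))" for p
  proof -
    have tu: "q * exp (- M * t) \<le> q * exp (- M * (t - u))" using q M u by (intro mult_left_mono) (auto simp: algebra_simps)
    have "cl (- y, - p) = (- y, - (max (- B) (min B p)))" using y B_pos by (auto simp: clamp_box_def min_def max_def)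
    moreover have "q * exp (- M * t) \<le> max (- B) (min B p)" using p tu qe[of t] u by auto
    ultimately show ?thesis using T1[of "max (- B) (min B p)"] by simp
  qed
  show "- M * (q * exp (- M * s)) \<le> Hx (cl (- x, - (q * exp (- M * s))))" if s: "s \<in> {0..t - u}" and x: "y \<le> x" for s x
  proof -
    have "cl (- x, - (q * exp (- M * s))) = (- (min (- lo) x), - (q * exp (- M * s)))"
      using y x qe[of s] s B_pos by (auto simp: clamp_box_def min_def max_def)
    moreover have "- (min (- lo) x) \<in> I" "min (- lo) x \<ge> y" using y x box_I by (auto simp: min_def)
    ultimately show ?thesis using T2[of s "min (- lo) x"] s u by simp
  qed
  show "\<bar>- Hp (cl (- x, - p)) - - Hp (cl (- x', - p'))\<bar> \<le> lipc * (\<bar>x - x'\<bar> + \<bar>p - p'\<bar>)" for x p x' p'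
    using clamped_field_lipschitz(1)[of "- x" "- p" "- x'" "- p'"] by (simp add: abs_minus_commute)
  show "\<bar>Hx (cl (- x, - p)) - Hx (cl (- x', - p'))\<bar> \<le> lipc * (\<bar>x - x'\<bar> + \<bar>p - p'\<bar>)" for x p x' p'
    using clamped_field_lipschitz(2)[of "- x" "- p" "- x'" "- p'"] by (simp add: abs_minus_commute)
  show "\<And>s. s \<in> {u..t} \<Longrightarrow> ((\<lambda>s. - fst (flow z s)) has_real_derivative - Hp (cl (- (- fst (flow z s)), - (- snd (flow z s))))) (at s within {u..t})"
    using DERIV_minus[OF flow_X[of _ "{u..t}" z]] u by auto
  show "\<And>s. s \<in> {u..t} \<Longrightarrow> ((\<lambda>s. - snd (flow z s)) has_real_derivative Hx (cl (- (- fst (flow z s)), - (- snd (flow z s))))) (at s within {u..t})"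
    using DERIV_minus[OF flow_P[of _ "{u..t}" z]] u by auto
qed (use lipc_pos M q u init in auto)

text \<open>Energy bounds the momentum but is conserved only while the orbit is in the box;
  \<open>stays_inside\<close> breaks this circle.\<close>

lemma stays_in_box_by_energy:
  assumes X: "\<And>s. s \<in> {0..t} \<Longrightarrow> fst (flow z s) \<in> {lo<..<hi}"
    and E: "H z \<le> E" and B: "\<And>x p. x \<in> {lo..hi} \<Longrightarrow> H (x, p) \<le> E \<Longrightarrow> \<bar>p\<bar> < B" and s: "s \<in> {0..t}"
  shows "flow z s \<in> obx"
proof (rule stays_inside[of t "flow z" obx bx])
  have step: "w \<in> obx" if "fst w \<in> {lo<..<hi}" "H w \<le> E" for w
    using B[of "fst w" "snd w"] that by (cases w) auto
  show "continuous_on {0..t} (flow z)" by (rule continuous_on_subset[OF flow_cont_s]) auto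
  show "open obx" by (intro open_Times) auto
  show "closed bx" by (intro closed_Times) auto
  show "obx \<subseteq> bx" by auto
  show "flow z 0 \<in> obx" by (rule step) (use X[of 0] s E in \<open>auto simp: flow_0\<close>)
  fix r assume r: "r \<in> {0..t}" "\<forall>s\<in>{0..r}. flow z s \<in> bx"
  have "H (flow z r) = H z" using energy_conserved[of r z] r by auto
  thus "flow z r \<in> obx" using X[OF r(1)] E by (intro step) auto
qed (use s in auto)

end

section \<open>Overhang over an equilibrium\<close>

context hamiltonian
begin

definition solves_on :: "real \<Rightarrow> (real \<Rightarrow> real) \<Rightarrow> (real \<Rightarrow> real) \<Rightarrow> bool" where
  "solves_on t X P \<longleftrightarrow> (\<forall>s\<in>{0..t}. X s \<in> I \<and>
     (X has_real_derivative Hp (X s, P s)) (at s within {0..t}) \<and>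
     (P has_real_derivative - Hx (X s, P s)) (at s within {0..t}))"

text \<open>\<open>f\<close> stands for the time-t position map read off from the linearization:
  \<open>local\<close> asks it to be right only for solutions that stay in \<open>W\<close>, and of
  its slope at x0 only the negative sign enters.\<close>

theorem overhang_at_equilibrium:
  assumes x0: "x0 \<in> I" "Hp (x0, 0) = 0" and g: "continuous_on I g" "g x0 = 0" and t: "t > 0"
    and right: "end_trap I (\<lambda>x p. Hp (x, p)) (\<lambda>x p. - Hx (x, p))"
    and left: "end_trap (uminus ` I) (\<lambda>x p. - Hp (- x, - p)) (\<lambda>x p. Hx (- x, - p))"
    and steep: "\<And>z q. z \<in> I \<Longrightarrow> \<exists>x\<in>I. x > z \<and> g x \<ge> q"
    and W: "open W" "(x0, 0) \<in> W"
    and f: "(f has_real_derivative D) (at x0)" "D < 0" "f x0 = x0"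
    and local: "\<And>X P. solves_on t X P \<Longrightarrow> (\<forall>s\<in>{0..t}. (X s, P s) \<in> W) \<Longrightarrow> P 0 = g (X 0) \<Longrightarrow> X t = f (X 0)"
  shows "overhang (reach g t) x0"
proof -
  obtain y q M where "y > x0" "corner I (\<lambda>x p. Hp (x, p)) (\<lambda>x p. - Hx (x, p)) t y q M"
    using right t x0(1) unfolding end_trap_def by blast
  hence R: "y \<in> I" "q > 0" "M \<ge> 0" "y > x0"
    "\<And>p. p \<ge> q * exp (- M * t) \<Longrightarrow> Hp (y, p) \<ge> 0"
    "\<And>s x. s \<in> {0..t} \<Longrightarrow> x \<in> I \<Longrightarrow> x \<ge> y \<Longrightarrow> - Hx (x, q * exp (- M * s)) \<ge> - M * (q * exp (- M * s))"
    "\<And>x. x \<in> I \<Longrightarrow> \<exists>b b'. \<forall>s\<in>{0..t}. (b has_real_derivative b' s) (at s within {0..t}) \<and>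
        b s \<in> I \<and> b s > x \<and> (\<forall>p\<le>q. Hp (b s, p) < b' s)"
    unfolding corner_def by blast+
  have mx0: "- x0 \<in> uminus ` I" using x0 by auto
  obtain y' q' M' where "y' > - x0" "corner (uminus ` I) (\<lambda>x p. - Hp (- x, - p)) (\<lambda>x p. Hx (- x, - p)) t y' q' M'"
    using left t mx0 unfolding end_trap_def by blast
  hence L: "y' \<in> uminus ` I" "q' > 0" "M' \<ge> 0" "y' > - x0"
    "\<And>p. p \<ge> q' * exp (- M' * t) \<Longrightarrow> - Hp (- y', - p) \<ge> 0"
    "\<And>s x. s \<in> {0..t} \<Longrightarrow> x \<in> uminus ` I \<Longrightarrow> x \<ge> y' \<Longrightarrow> Hx (- x, - (q' * exp (- M' * s))) \<ge> - M' * (q' * exp (- M' * s))"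
    "\<And>x. x \<in> uminus ` I \<Longrightarrow> \<exists>b b'. \<forall>s\<in>{0..t}. (b has_real_derivative b' s) (at s within {0..t}) \<and>
        b s \<in> uminus ` I \<and> b s > x \<and> (\<forall>p\<le>q'. - Hp (- b s, - p) < b' s)"
    unfolding corner_def by blast+
  obtain xh where xh: "xh \<in> I" "xh > y" "g xh \<ge> q" using steep[OF R(1)] by blast
  \<comment> \<open>The barrier starts to the right of \<open>xh\<close>, hence of every starting
    point considered.\<close>
  obtain b b' where b: "\<And>s. s \<in> {0..t} \<Longrightarrow> (b has_real_derivative b' s) (at s within {0..t})"
    "\<And>s. s \<in> {0..t} \<Longrightarrow> b s \<in> I" "\<And>s. s \<in> {0..t} \<Longrightarrow> b s > xh" "\<And>s p. s \<in> {0..t} \<Longrightarrow> p \<le> q \<Longrightarrow> Hp (b s, p) < b' s"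
    using R(7)[OF xh(1)] by blast
  obtain k k' where k: "\<And>s. s \<in> {0..t} \<Longrightarrow> (k has_real_derivative k' s) (at s within {0..t})"
    "\<And>s. s \<in> {0..t} \<Longrightarrow> k s \<in> uminus ` I" "\<And>s. s \<in> {0..t} \<Longrightarrow> k s > y'" "\<And>s p. s \<in> {0..t} \<Longrightarrow> p \<le> q' \<Longrightarrow> - Hp (- k s, - p) < k' s"
    using L(7)[OF L(1)] by blast
  have mk: "- k s \<in> I" if "s \<in> {0..t}" for s using k(2)[OF that] by auto
  obtain l1 u1 where lu1: "l1 \<in> I" "u1 \<in> I" "\<And>s. s \<in> {0..t} \<Longrightarrow> l1 \<le> b s \<and> b s \<le> u1"
    using barrier_range[of I t b b', OF interval_I] t b by auto
  obtain l2 u2 where lu2: "l2 \<in> I" "u2 \<in> I" "\<And>s. s \<in> {0..t} \<Longrightarrow> l2 \<le> - k s \<and> - k s \<le> u2"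
    using barrier_range[of I t "\<lambda>s. - k s" "\<lambda>s. - k' s", OF interval_I] t DERIV_minus[OF k(1)] mk by auto
  \<comment> \<open>The sides enclose the whole range of both barriers, so the clamp leaves
    positions on a barrier unchanged.\<close>
  define lo where "lo = min l1 l2"
  define hi where "hi = max u1 u2"
  have box_I: "{lo..hi} \<subseteq> I" by (rule Icc_subset) (use lu1 lu2 in \<open>auto simp: lo_def hi_def min_def max_def\<close>)
  have b_in: "b s \<in> {lo..hi}" if "s \<in> {0..t}" for s using lu1(3)[OF that] by (auto simp: lo_def hi_def)
  have k_in: "- k s \<in> {lo..hi}" if "s \<in> {0..t}" for s using lu2(3)[OF that] by (auto simp: lo_def hi_def)
  have t0: "0 \<in> {0..t}" using t by auto
  have ord: "lo < - y'" "- y' < x0" "x0 < y" "y < xh" "xh < hi"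
    using b_in[OF t0] k_in[OF t0] b(3)[OF t0] k(3)[OF t0] xh R(4) L(4) by auto
  have subx: "{x0..xh} \<subseteq> I" by (rule Icc_subset[OF x0(1) xh(1)])
  have gc: "continuous_on {x0..xh} g" by (rule continuous_on_subset[OF g(1) subx])
  have "continuous_on {x0..xh} (\<lambda>x. H (x, g x))"
    by (rule continuous_on_compose2[OF cH]) (use subx in \<open>auto intro!: continuous_intros gc\<close>)
  then obtain xm where "\<forall>x\<in>{x0..xh}. H (x, g x) \<le> H (xm, g xm)"
    using continuous_attains_sup[OF compact_Icc, of x0 xh "\<lambda>x. H (x, g x)"] ord by fastforce
  then obtain E where E: "\<And>x. x \<in> {x0..xh} \<Longrightarrow> H (x, g x) \<le> E" by blast
  obtain B0 where B0: "\<And>x p. x \<in> {lo..hi} \<Longrightarrow> H (x, p) \<le> E \<Longrightarrow> \<bar>p\<bar> < B0"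
    using coercive[OF compact_Icc box_I, of E] by blast
  \<comment> \<open>The momentum bound also covers both corner levels, since otherwise clamping
    would destroy the traps.\<close>
  define B where "B = max B0 (max q q')"
  have B: "\<And>x p. x \<in> {lo..hi} \<Longrightarrow> H (x, p) \<le> E \<Longrightarrow> \<bar>p\<bar> < B" and Bq: "q \<le> B" "q' \<le> B"
    using B0 by (fastforce simp: B_def)+
  have Bpos: "B > 0" using Bq R by simp
  interpret X: ham_box I H Hx Hp Hxx Hxp Hpx Hpp lo hi B
    by unfold_locales (use ord box_I Bpos in auto)
  define Z where "Z x s = X.flow (x, g x) s" for x s
  have rtrap: "fst (Z x t) \<ge> y" if "u \<in> {0..t}" "fst (Z x u) \<ge> y" "snd (Z x u) \<ge> q" for x u
    unfolding Z_def
    by (rule X.right_trap[OF _ R(2) Bq(1) R(3) R(5,6) that[unfolded Z_def]]) (use ord in auto)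
  have ltrap: "- fst (Z x t) \<ge> y'" if "u \<in> {0..t}" "- fst (Z x u) \<ge> y'" "- snd (Z x u) \<ge> q'" for x u
    unfolding Z_def
  proof (rule X.left_trap[OF _ L(2) Bq(2) L(3) L(5) _ that[unfolded Z_def]])
    fix s x assume "s \<in> {0..t}" "- x \<in> I" "x \<ge> y'"
    thus "Hx (- x, - (q' * exp (- M' * s))) \<ge> - M' * (q' * exp (- M' * s))"
      by (intro L(6)) (auto intro!: image_eqI[of x uminus "- x"])
  qed (use ord in auto)
  have F0: "X.F (x0, 0) = 0"
    using clamp_box_id[of "(x0, 0)" lo hi B] ord Bpos x0 Hx0[OF x0(1)] by (auto simp: fld_def zero_prod_def)
  have Z0: "Z x0 s = (x0, 0)" if "s \<ge> 0" for s unfolding Z_def g(2) by (rule X.flow_fixed[OF F0 that])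
  \<comment> \<open>Close to x0 the Gronwall bound around the fixed point keeps the orbit in
    \<open>W\<close> and in the box up to time t, so \<open>f\<close> applies; its negative slope
    puts the end position left of x0.\<close>
  have "\<exists>x'. x0 < x' \<and> x' < xh \<and> fst (Z x' t) < x0"
  proof -
    have o: "open (W \<inter> X.obx)" using W by (intro open_Int open_Times) auto
    have in0: "(x0, 0) \<in> W \<inter> X.obx" using W ord Bpos by auto
    obtain r where r: "r > 0" "ball (x0, 0) r \<subseteq> W \<inter> X.obx" by (rule openE[OF o in0])
    define C where "C = exp (X.lipc * t)"
    have C: "C > 0" by (simp add: C_def)
    have "continuous_on I (\<lambda>x. (x, g x))" by (intro continuous_intros g)
    moreover have "r / C > 0" using r C by simp
    ultimately obtain d1 where d1: "d1 > 0" "\<And>x. x \<in> I \<Longrightarrow> dist x x0 < d1 \<Longrightarrow> dist (x, g x) (x0, g x0) < r / C"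
      using x0(1) unfolding continuous_on_iff by meson
    obtain d2 where d2: "d2 > 0" "\<And>h. 0 < h \<Longrightarrow> h < d2 \<Longrightarrow> f (x0 + h) < f x0"
      using DERIV_neg_dec_right[OF f(1,2)] by auto
    define h where "h = min (min d1 d2) (xh - x0) / 2"
    have h: "0 < h" "h < d1" "h < d2" "x0 + h < xh" using d1(1) d2(1) ord by (auto simp: h_def min_def field_simps)
    have xI: "x0 + h \<in> I" using subx h by auto
    have near: "Z (x0 + h) s \<in> W \<inter> X.obx" if s: "s \<in> {0..t}" for s
    proof -
      have "norm (Z (x0 + h) s - Z x0 s) \<le> exp (X.lipc * s) * norm ((x0 + h, g (x0 + h)) - (x0, g x0))"
        unfolding Z_def by (rule X.flow_lipschitz(1)) (use s in auto)
      also have "\<dots> \<le> C * norm ((x0 + h, g (x0 + h)) - (x0, g x0))"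
        unfolding C_def using s X.lipc_pos by (intro mult_right_mono) auto
      also have "\<dots> < C * (r / C)"
        using d1(2)[OF xI] h C by (intro mult_strict_left_mono) (auto simp: dist_norm)
      finally have "dist (x0, 0) (Z (x0 + h) s) < r" using Z0[of s] s C by (simp add: dist_norm norm_minus_commute)
      thus ?thesis using r(2) by auto
    qed
    define XX where "XX s = fst (Z (x0 + h) s)" for s
    define PP where "PP s = snd (Z (x0 + h) s)" for s
    have XP: "(XX s, PP s) = Z (x0 + h) s" for s by (simp add: XX_def PP_def)
    have "solves_on t XX PP"
      unfolding solves_on_def
    proof (intro ballI conjI)
      fix s assume s: "s \<in> {0..t}"
      have bx: "X.flow (x0 + h, g (x0 + h)) s \<in> X.bx" using near[OF s] by (auto simp: Z_def)
      show "XX s \<in> I" using near[OF s] box_I unfolding XP[symmetric] by auto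
      show "(XX has_real_derivative Hp (XX s, PP s)) (at s within {0..t})"
        "(PP has_real_derivative - Hx (XX s, PP s)) (at s within {0..t})"
        unfolding XP unfolding XX_def PP_def Z_def using X.flow_deriv_in_box[OF _ _ bx, of "{0..t}"] s by auto
    qed
    moreover have "XX 0 = x0 + h" "PP 0 = g (x0 + h)" by (simp_all add: XX_def PP_def Z_def X.flow_0)
    ultimately have "XX t = f (x0 + h)" using local[of XX PP] near by (auto simp: XP)
    thus ?thesis using d2(2)[of h] h f(3) by (intro exI[of _ "x0 + h"]) (auto simp: XX_def)
  qed
  then obtain x' where x': "x0 < x'" "x' < xh" "fst (Z x' t) < x0" by blast
  have "fst (Z xh t) \<ge> y" by (rule rtrap[OF t0]) (use xh in \<open>auto simp: Z_def X.flow_0\<close>)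
  moreover have "continuous_on {x'..xh} (\<lambda>x. fst (Z x t))"
  proof -
    have "continuous_on {x'..xh} (\<lambda>x. X.flow (x, g x) t)"
      by (rule continuous_on_uncurry[OF X.flow_cont])
         (use x' t in \<open>auto intro!: continuous_intros continuous_on_subset[OF gc]\<close>)
    thus ?thesis unfolding Z_def by (rule continuous_on_fst)
  qed
  ultimately obtain x where x: "x' \<le> x" "x \<le> xh" "fst (Z x t) = x0"
    using IVT'[of "\<lambda>x. fst (Z x t)" x' x0 xh] x' ord by auto
  have x_in: "x \<in> {x0..xh}" "x \<in> I" "x > x0" using x x' subx by auto
  have dX: "((\<lambda>s. fst (Z x s)) has_real_derivative Hp (clamp_box lo hi B (Z x s))) (at s within {0..t})" if "s \<in> {0..t}" for s
    unfolding Z_def by (rule X.flow_X) (use that in auto)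
  have up: "fst (Z x s) < b s" if s: "s \<in> {0..t}" for s
  proof (rule barrier[OF dX b(1) _ _ s])
    show "fst (Z x 0) < b 0" using b(3)[OF t0] x by (simp add: Z_def X.flow_0)
    fix s assume s: "s \<in> {0..t}" and eq: "fst (Z x s) = b s"
    \<comment> \<open>With momentum at least q at the contact the orbit would be in the corner and
      end at or beyond y, but it ends at x0 < y. Below q the barrier outruns the field.\<close>
    have pq: "snd (Z x s) < q"
    proof (rule ccontr)
      assume "\<not> ?thesis"
      hence "fst (Z x t) \<ge> y" using b(3)[OF s] eq ord by (intro rtrap[OF s]) auto
      thus False using x ord by simp
    qed
    have "clamp_box lo hi B (Z x s) = (b s, max (- B) (min B (snd (Z x s))))"
      using b_in[OF s] eq by (auto simp: clamp_box_def)
    moreover have "max (- B) (min B (snd (Z x s))) \<le> q" using pq Bpos R(2) by auto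
    ultimately show "Hp (clamp_box lo hi B (Z x s)) < b' s" using b(4)[OF s] by simp
  qed
  have down: "- fst (Z x s) < k s" if s: "s \<in> {0..t}" for s
  proof (rule barrier[OF DERIV_minus[OF dX] k(1) _ _ s])
    show "- fst (Z x 0) < k 0" using k(3)[OF t0] x_in ord by (simp add: Z_def X.flow_0)
    fix s assume s: "s \<in> {0..t}" and eq: "- fst (Z x s) = k s"
    have pq: "- snd (Z x s) < q'"
    proof (rule ccontr)
      assume "\<not> ?thesis"
      hence "- fst (Z x t) \<ge> y'" using k(3)[OF s] eq ord by (intro ltrap[OF s]) auto
      thus False using x ord by simp
    qed
    define p where "p = min B (max (- B) (- snd (Z x s)))"
    have "clamp_box lo hi B (Z x s) = (- k s, - p)"
      using k_in[OF s] eq Bpos by (auto simp: clamp_box_def p_def min_def max_def)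
    moreover have "p \<le> q'" using pq Bpos L(2) by (auto simp: p_def)
    ultimately show "- Hp (clamp_box lo hi B (Z x s)) < k' s" using k(4)[OF s, of p] by simp
  qed
  have inX: "fst (X.flow (x, g x) s) \<in> {lo<..<hi}" if "s \<in> {0..t}" for s
    using up[OF that] down[OF that] b_in[OF that] k_in[OF that] by (auto simp: Z_def)
  have inbox: "X.flow (x, g x) s \<in> X.obx" if "s \<in> {0..t}" for s
    by (rule X.stays_in_box_by_energy[OF inX E[OF x_in(1)] B that])
  \<comment> \<open>\<open>reach\<close> asks for a solution beyond t; the open box still contains
    the orbit shortly afterwards.\<close>
  have "\<exists>T>t. \<forall>s\<in>{0..<T}. X.flow (x, g x) s \<in> X.obx"
  proof -
    have o: "open X.obx" by (intro open_Times) auto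
    have tt: "X.flow (x, g x) t \<in> X.obx" using inbox t by auto
    obtain r where r: "r > 0" "ball (X.flow (x, g x) t) r \<subseteq> X.obx" by (rule openE[OF o tt])
    have t1: "t \<in> {0..}" using t by auto
    obtain d where d: "d > 0" "\<forall>s\<in>{0..}. dist s t < d \<longrightarrow> dist (X.flow (x, g x) s) (X.flow (x, g x) t) < r"
      using X.flow_cont_s[of "(x, g x)"] t1 r(1) unfolding continuous_on_iff by meson
    have "X.flow (x, g x) s \<in> X.obx" if "s \<in> {0..<t + d}" for s
    proof (cases "s \<le> t")
      case True thus ?thesis using inbox that by auto
    next
      case False
      hence "dist s t < d" using that by (auto simp: dist_real_def)
      hence "dist (X.flow (x, g x) s) (X.flow (x, g x) t) < r" using d that by auto
      thus ?thesis using subsetD[OF r(2), of "X.flow (x, g x) s"] by (simp add: dist_commute)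
    qed
    thus ?thesis using d by (intro exI[of _ "t + d"]) auto
  qed
  then obtain T where T: "T > t" "\<And>s. s \<in> {0..<T} \<Longrightarrow> X.flow (x, g x) s \<in> X.obx" by blast
  have Tb: "X.flow (x, g x) s \<in> X.bx" if "s \<in> {0..<T}" for s
    using T(2)[OF that] by (auto simp: mem_Times_iff)
  have "X.flow (x, g x) t \<in> reach g t"
    by (rule X.flow_in_reach[where g = g, OF Tb]) (use T(1) t x_in in auto)
  hence r1: "(x0, snd (Z x t)) \<in> reach g t" using x(3) by (metis Z_def prod.collapse)
  have "X.flow (x0, g x0) t \<in> reach g t"
    by (rule X.flow_in_reach[of "t + 1"]) (use t x0 ord Bpos Z0 in \<open>auto simp: Z_def\<close>)
  hence r2: "(x0, 0) \<in> reach g t" using Z0[of t] t by (simp add: Z_def)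
  have "snd (Z x t) \<noteq> 0"
  proof
    assume "snd (Z x t) = 0"
    hence "Z x t = Z x0 t" using x(3) Z0[of t] t by (simp add: prod_eq_iff)
    hence "(x, g x) = (x0, g x0)" using X.flow_inj[of t "(x, g x)" "(x0, g x0)"] t by (simp add: Z_def)
    thus False using x_in by simp
  qed
  thus ?thesis unfolding overhang_def using r1 r2 by blast
qed

end

section \<open>Corners and barriers for the individual Hamiltonians\<close>

lemma end_trapI_static:
  assumes A: "\<And>z. z \<in> I \<Longrightarrow> \<exists>y\<in>I. \<exists>q>0. y > z \<and> (\<forall>p\<ge>q. F1 y p \<ge> 0) \<and> (\<forall>x\<in>I. x \<ge> y \<longrightarrow> F2 x q \<ge> 0)"
    and B: "\<And>x q. x \<in> I \<Longrightarrow> \<exists>\<beta>\<in>I. \<beta> > x \<and> (\<forall>p\<le>q. F1 \<beta> p < 0)"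
  shows "end_trap I F1 F2"
  unfolding end_trap_def
proof (intro allI impI ballI)
  fix t z :: real assume "t > 0" and z: "z \<in> I"
  from A[OF z] obtain y q where y: "y \<in> I" "q > 0" "y > z" "\<forall>p\<ge>q. F1 y p \<ge> 0" "\<forall>x\<in>I. x \<ge> y \<longrightarrow> F2 x q \<ge> 0" by blast
  \<comment> \<open>Rate 0 makes the lower edge horizontal, and a barrier at rest works where the
    field points left for all p <= q.\<close>
  have "corner I F1 F2 t y q 0"
    unfolding corner_def
  proof (intro conjI ballI)
    fix x assume "x \<in> I"
    from B[OF this, of q] obtain \<beta> where \<beta>: "\<beta> \<in> I" "\<beta> > x" "\<forall>p\<le>q. F1 \<beta> p < 0" by blast
    show "\<exists>b b'. \<forall>s\<in>{0..t}. (b has_real_derivative b' s) (at s within {0..t}) \<and> b s \<in> I \<and> b s > x \<and> (\<forall>p\<le>q. F1 (b s) p < b' s)"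
      by (rule exI[of _ "\<lambda>_. \<beta>"], rule exI[of _ "\<lambda>_. 0"]) (use \<beta> in auto)
  qed (use y in auto)
  thus "\<exists>y q M. y > z \<and> corner I F1 F2 t y q M" using y(3) by blast
qed

text \<open>At p > 0 one has p' = p w' >= -M p, so a level decays at most at rate M. A barrier at
  rest need not exist because w may decrease; but it decreases at most linearly, so an exponentially
  moving barrier outruns every trajectory with p <= q.\<close>

lemma end_trap_gradient:
  fixes w w' :: "real \<Rightarrow> real"
  assumes M: "M \<ge> 0" and w': "\<And>x. w' x \<ge> - M" and w: "\<And>x. x \<ge> 0 \<Longrightarrow> w 0 - w x \<le> M * x"
  shows "end_trap UNIV (\<lambda>x p. p - w x) (\<lambda>x p. p * w' x)"
  unfolding end_trap_def
proof (intro allI impI ballI)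
  fix t z :: real assume t: "t > 0"
  define y where "y = z + 1"
  \<comment> \<open>Chosen so that the level has decayed to |w y| + 1 at time t, still enough for p
    - w y >= 0.\<close>
  define q where "q = (\<bar>w y\<bar> + 1) * exp (M * t)"
  have q: "q > 0" unfolding q_def by (intro mult_pos_pos) auto
  have qe: "q * exp (- M * t) = \<bar>w y\<bar> + 1" by (simp add: q_def exp_minus)
  have "corner UNIV (\<lambda>x p. p - w x) (\<lambda>x p. p * w' x) t y q M"
    unfolding corner_def
  proof (intro conjI ballI allI impI)
    fix p assume "q * exp (- M * t) \<le> p"
    thus "0 \<le> p - w y" unfolding qe by linarith
  next
    fix s x :: real
    show "- M * (q * exp (- M * s)) \<le> q * exp (- M * s) * w' x"
      using mult_left_mono[OF w'[of x], of "q * exp (- M * s)"] q by (simp add: mult.commute)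
  next
    fix x :: real
    \<comment> \<open>For positions b >= 1 the speed p - w b is at most (q + |w 0| + M) b; the extra
      1 in \<open>\<kappa>\<close> gives strictness, and \<open>\<beta>\<close> >= 1 keeps the
      barrier in this range.\<close>
    define \<beta> where "\<beta> = \<bar>x\<bar> + 1"
    define \<kappa> where "\<kappa> = q + \<bar>w 0\<bar> + M + 1"
    have \<kappa>: "\<kappa> > 0" using q M by (simp add: \<kappa>_def)
    have key: "((\<lambda>s. \<beta> * exp (\<kappa> * s)) has_real_derivative \<kappa> * (\<beta> * exp (\<kappa> * s))) (at s within {0..t}) \<and>
      \<beta> * exp (\<kappa> * s) \<in> UNIV \<and> \<beta> * exp (\<kappa> * s) > x \<and> (\<forall>p\<le>q. p - w (\<beta> * exp (\<kappa> * s)) < \<kappa> * (\<beta> * exp (\<kappa> * s)))"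
      if s: "s \<in> {0..t}" for s
    proof (intro conjI allI impI)
      show "((\<lambda>s. \<beta> * exp (\<kappa> * s)) has_real_derivative \<kappa> * (\<beta> * exp (\<kappa> * s))) (at s within {0..t})"
        by (auto intro!: derivative_eq_intros)
      have "\<beta> * 1 \<le> \<beta> * exp (\<kappa> * s)" using s \<kappa> by (intro mult_left_mono) (auto simp: \<beta>_def)
      hence bb: "\<beta> * exp (\<kappa> * s) \<ge> \<beta>" by simp
      thus "\<beta> * exp (\<kappa> * s) > x" by (simp add: \<beta>_def)
      fix p assume p: "p \<le> q"
      define b where "b = \<beta> * exp (\<kappa> * s)"
      have b1: "b \<ge> 1" using bb by (simp add: b_def \<beta>_def)
      have "p - w b \<le> (q + \<bar>w 0\<bar>) * 1 + M * b" using w[of b] b1 p by simp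
      also have "\<dots> \<le> (q + \<bar>w 0\<bar>) * b + M * b" using b1 q by (intro add_right_mono mult_left_mono) auto
      also have "\<dots> < \<kappa> * b" using b1 by (simp add: \<kappa>_def algebra_simps)
      finally show "p - w (\<beta> * exp (\<kappa> * s)) < \<kappa> * (\<beta> * exp (\<kappa> * s))" unfolding b_def .
    qed auto
    show "\<exists>b b'. \<forall>s\<in>{0..t}. (b has_real_derivative b' s) (at s within {0..t}) \<and> b s \<in> UNIV \<and> b s > x \<and> (\<forall>p\<le>q. p - w (b s) < b' s)"
      by (rule exI[of _ "\<lambda>s. \<beta> * exp (\<kappa> * s)"], rule exI[of _ "\<lambda>s. \<kappa> * (\<beta> * exp (\<kappa> * s))"],
          rule ballI, rule key)
  qed (use q M in auto)
  moreover have "y > z" by (simp add: y_def)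
  ultimately show "\<exists>y q M. y > z \<and> corner UNIV (\<lambda>x p. p - w x) (\<lambda>x p. p * w' x) t y q M" by blast
qed

text \<open>Near 1 the rate vp dies out with negative slope. At large momentum the term -vp' exp(2p)
  drives p upwards, which gives the corner; at bounded momentum the surviving rate vm drives x to
  the left, which gives barriers at rest.\<close>

lemma end_trap_two_rates:
  fixes vp vm vp' vm' :: "real \<Rightarrow> real"
  assumes c: "isCont vp 1" "isCont vm 1" "isCont vp' 1" "isCont vm' 1"
    and v1: "vp 1 = 0" "vm 1 > 0" "vp' 1 < 0" and pos: "\<And>x. x \<in> {-1<..<1} \<Longrightarrow> vp x > 0"
  shows "end_trap {-1<..<1} (\<lambda>x p. 2 * vp x * exp (2 * p) - 2 * vm x * exp (- 2 * p))
     (\<lambda>x p. - (vp' x * (exp (2 * p) - 1) + vm' x * (exp (- 2 * p) - 1)))"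
proof (rule end_trapI_static)
  fix z :: real assume z: "z \<in> {-1<..<1}"
  \<comment> \<open>By continuity vp' < -\<delta> and |vm'| <= C hold near 1.\<close>
  define \<delta> where "\<delta> = - vp' 1 / 2"
  define C where "C = \<bar>vm' 1\<bar> + 1"
  have \<delta>: "\<delta> > 0" using v1 by (simp add: \<delta>_def)
  have C: "C > 0" by (simp add: C_def)
  have "\<forall>\<^sub>F x in at 1. vp' x < - \<delta>"
    by (rule order_tendstoD(2)[OF c(3)[unfolded isCont_def]]) (use \<delta> in \<open>simp add: \<delta>_def\<close>)
  moreover have "\<forall>\<^sub>F x in at 1. dist (vm' x) (vm' 1) < 1"
    by (rule tendstoD[OF c(4)[unfolded isCont_def]]) auto
  ultimately have "\<forall>\<^sub>F x in at 1. vp' x < - \<delta> \<and> dist (vm' x) (vm' 1) < 1" by (rule eventually_conj)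
  then obtain d where d: "d > 0" "\<And>x. x \<noteq> 1 \<Longrightarrow> dist x 1 < d \<Longrightarrow> vp' x < - \<delta> \<and> dist (vm' x) (vm' 1) < 1"
    unfolding eventually_at by auto
  define y where "y = (max z (1 - d) + 1) / 2"
  have y: "z < y" "1 - d < y" "y < 1" "-1 < y" using z d(1) by (auto simp: y_def max_def)
  have vy: "vp y > 0" using pos y by auto
  \<comment> \<open>The first summand yields 2q\<delta> >= C, for the sign of p' on the lower edge;
    the second yields 2q vp y >= |vm y|, for the velocity at y. Since exp(2q) >= 1 + 2q, these
    linear bounds suffice.\<close>
  define q where "q = C / (2 * \<delta>) + \<bar>vm y\<bar> / (2 * vp y) + 1"
  have q: "q > 0" using C \<delta> vy by (auto simp: q_def intro!: add_nonneg_pos add_nonneg_nonneg)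
  have e: "exp (2 * q) \<ge> 1 + 2 * q" by (rule exp_ge_add_one_self)
  have "2 * q * \<delta> = C + (\<bar>vm y\<bar> / vp y + 2) * \<delta>" using \<delta> vy by (simp add: q_def field_simps)
  moreover have "(\<bar>vm y\<bar> / vp y + 2) * \<delta> \<ge> 0" using \<delta> vy by (intro mult_nonneg_nonneg) auto
  ultimately have q1: "\<delta> * (2 * q) \<ge> C" by (simp add: mult.commute mult.left_commute)
  have "vp y * (2 * q) = \<bar>vm y\<bar> + (C / \<delta> + 2) * vp y" using \<delta> vy by (simp add: q_def field_simps)
  moreover have "(C / \<delta> + 2) * vp y \<ge> 0" using \<delta> vy C by (intro mult_nonneg_nonneg) auto
  ultimately have q2: "vp y * (2 * q) \<ge> \<bar>vm y\<bar>" by simp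
  show "\<exists>y\<in>{-1<..<1}. \<exists>q>0. y > z \<and> (\<forall>p\<ge>q. 2 * vp y * exp (2 * p) - 2 * vm y * exp (- 2 * p) \<ge> 0) \<and>
     (\<forall>x\<in>{-1<..<1}. x \<ge> y \<longrightarrow> - (vp' x * (exp (2 * q) - 1) + vm' x * (exp (- 2 * q) - 1)) \<ge> 0)"
  proof (rule bexI[of _ y], rule exI[of _ q], intro conjI allI impI ballI)
    fix p assume p: "p \<ge> q"
    have "vm y * exp (- 2 * p) \<le> \<bar>vm y\<bar> * exp (- 2 * p)" by (intro mult_right_mono) auto
    also have "\<dots> \<le> \<bar>vm y\<bar> * 1" using p q by (intro mult_left_mono) auto
    also have "\<dots> \<le> vp y * (2 * q)" using q2 by simp
    also have "\<dots> \<le> vp y * exp (2 * p)"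
    proof (intro mult_left_mono)
      have "exp (2 * q) \<le> exp (2 * p)" using p by simp
      thus "2 * q \<le> exp (2 * p)" using e by linarith
    qed (use vy in auto)
    finally show "0 \<le> 2 * vp y * exp (2 * p) - 2 * vm y * exp (- 2 * p)" by simp
  next
    fix x assume x: "x \<in> {-1<..<1}" "x \<ge> y"
    have dx: "vp' x < - \<delta>" "dist (vm' x) (vm' 1) < 1" using d(2)[of x] x y by (auto simp: dist_real_def)
    have "C \<le> \<delta> * (exp (2 * q) - 1)"
    proof -
      have "\<delta> * (2 * q) \<le> \<delta> * (exp (2 * q) - 1)" using e \<delta> by (intro mult_left_mono) linarith+
      thus ?thesis using q1 by linarith
    qed
    also have "\<dots> \<le> (- vp' x) * (exp (2 * q) - 1)" using dx q by (intro mult_right_mono) auto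
    finally have 1: "C \<le> (- vp' x) * (exp (2 * q) - 1)" .
    have vC: "\<bar>vm' x\<bar> \<le> C" using dx(2) by (auto simp: dist_real_def C_def)
    have "\<bar>vm' x * (exp (- 2 * q) - 1)\<bar> \<le> C * 1"
      unfolding abs_mult using vC q by (intro mult_mono) (auto simp: abs_le_iff)
    thus "- (vp' x * (exp (2 * q) - 1) + vm' x * (exp (- 2 * q) - 1)) \<ge> 0" using 1 by (simp add: abs_le_iff)
  qed (use y q in auto)
next
  fix x q :: real assume x: "x \<in> {-1<..<1}"
  \<comment> \<open>The factor exp(4q) bounds the ratio of exp(2p) to exp(-2p) for p <= q.\<close>
  have "isCont (\<lambda>\<beta>. vm \<beta> - vp \<beta> * exp (4 * q)) 1" by (intro continuous_intros c)
  hence "\<forall>\<^sub>F \<beta> in at 1. vm \<beta> - vp \<beta> * exp (4 * q) > 0"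
    unfolding isCont_def by (rule order_tendstoD(1)) (use v1 in auto)
  then obtain d where d: "d > 0" "\<And>\<beta>. \<beta> \<noteq> 1 \<Longrightarrow> dist \<beta> 1 < d \<Longrightarrow> vm \<beta> - vp \<beta> * exp (4 * q) > 0"
    unfolding eventually_at by auto
  define \<beta> where "\<beta> = (max x (1 - d) + 1) / 2"
  have \<beta>: "x < \<beta>" "1 - d < \<beta>" "\<beta> < 1" "-1 < \<beta>" using x d(1) by (auto simp: \<beta>_def max_def)
  have *: "vm \<beta> > vp \<beta> * exp (4 * q)" using d(2)[of \<beta>] \<beta> by (auto simp: dist_real_def)
  show "\<exists>\<beta>\<in>{-1<..<1}. \<beta> > x \<and> (\<forall>p\<le>q. 2 * vp \<beta> * exp (2 * p) - 2 * vm \<beta> * exp (- 2 * p) < 0)"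
  proof (rule bexI[of _ \<beta>], intro conjI allI impI)
    fix p assume p: "p \<le> q"
    have "vp \<beta> * exp (2 * p) = vp \<beta> * exp (4 * p) * exp (- 2 * p)" by (simp add: mult.assoc exp_add[symmetric])
    also have "\<dots> \<le> vp \<beta> * exp (4 * q) * exp (- 2 * p)"
      using p pos[of \<beta>] \<beta> by (intro mult_right_mono mult_left_mono) auto
    also have "\<dots> < vm \<beta> * exp (- 2 * p)" using * by (intro mult_strict_right_mono) auto
    finally show "2 * vp \<beta> * exp (2 * p) - 2 * vm \<beta> * exp (- 2 * p) < 0" by simp
  qed (use \<beta> in auto)
qed

text \<open>\<open>argminH\<close> is a definite description, so a minimiser must be shown to exist,
  by coercivity, and to be unique, by strict convexity.\<close>

lemma (in hamiltonian) Hp_argminH: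
  assumes x: "x \<in> I"
  shows "Hp (x, argminH (\<lambda>x p. H (x, p)) x) = 0"
proof -
  obtain B where B: "\<And>p. H (x, p) \<le> 0 \<Longrightarrow> \<bar>p\<bar> < B" using coercive[of "{x}" 0] x by auto
  have B0: "B > 0" using B[of 0] H0[OF x] by auto
  have "continuous_on {-B..B} (\<lambda>p. H (x, p))"
    by (intro continuous_at_imp_continuous_on ballI DERIV_isCont[OF dH_p[OF x]])
  then obtain r where r: "r \<in> {-B..B}" "\<And>p. p \<in> {-B..B} \<Longrightarrow> H (x, r) \<le> H (x, p)"
    using continuous_attains_inf[OF compact_Icc, of "-B" B "\<lambda>p. H (x, p)"] B0 by force
  have min: "H (x, r) \<le> H (x, s)" for s
  proof (cases "H (x, s) \<le> 0")
    case True thus ?thesis using B[of s] by (intro r(2)) auto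
  next
    case False
    have "H (x, r) \<le> H (x, 0)" using B0 by (intro r(2)) auto
    thus ?thesis using False H0[OF x] by simp
  qed
  have crit: "Hp (x, r) = 0"
    by (rule DERIV_local_min[OF dH_p[OF x], of 1]) (use min in auto)
  have "argminH (\<lambda>x p. H (x, p)) x = r"
    unfolding argminH_def
  proof (rule the_equality)
    fix s assume "\<forall>q. H (x, s) \<le> H (x, q)"
    hence "H (x, s) \<le> H (x, r)" by blast
    thus "s = r" using H_above_tangent[OF x, of r s] crit by (cases "s = r") auto
  qed (use min in blast)
  thus ?thesis using crit by simp
qed

section \<open>The standing assumption\<close>

lemma interior_cases:
  assumes "K = UNIV \<or> K = {-1..1::real}"
  shows "interior K = (if K = UNIV then UNIV else {-1<..<1})" and "open (interior K)"
    and "is_interval (interior K)" and "uminus ` interior K = interior K"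
proof -
  have n: "{-1..1::real} \<noteq> UNIV" using not_UNIV_eq_Icc by metis
  show *: "interior K = (if K = UNIV then UNIV else {-1<..<1})" using assms n by auto
  show "open (interior K)" by simp
  show "is_interval (interior K)" unfolding * by (auto simp: is_interval_1)
  have "x \<in> uminus ` {-1<..<1}" if "-1 < x" "x < 1" for x :: real
    using that by (intro image_eqI[of _ _ "- x"]) auto
  thus "uminus ` interior K = interior K" unfolding * by (auto simp: surj_def intro: exI[of _ "- _"])
qed

lemma plus_end_eventually:
  assumes K: "K = UNIV \<or> K = {-1..1::real}" and z: "z \<in> interior K"
  shows "\<forall>\<^sub>F x in plus_end K. x \<in> interior K \<and> x > z" and "plus_end K \<noteq> bot"
proof -
  have n: "{-1..1::real} \<noteq> UNIV" using not_UNIV_eq_Icc by metis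
  show "plus_end K \<noteq> bot" by (simp add: plus_end_def trivial_limit_at_left_real)
  show "\<forall>\<^sub>F x in plus_end K. x \<in> interior K \<and> x > z"
  proof (cases "K = UNIV")
    case True thus ?thesis by (simp add: plus_end_def eventually_gt_at_top)
  next
    case False
    hence "z < 1" "z > -1" using z K by auto
    hence "\<forall>\<^sub>F x in at_left 1. x \<in> {z<..<1}" by (intro eventually_at_left_real)
    thus ?thesis using False K n \<open>z > -1\<close> by (auto simp: plus_end_def elim!: eventually_mono)
  qed
qed

lemma minus_end_eventually:
  assumes K: "K = UNIV \<or> K = {-1..1::real}" and z: "z \<in> interior K"
  shows "\<forall>\<^sub>F x in minus_end K. x \<in> interior K \<and> x < z" and "minus_end K \<noteq> bot"
proof -
  have n: "{-1..1::real} \<noteq> UNIV" using not_UNIV_eq_Icc by metis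
  show "minus_end K \<noteq> bot" by (simp add: minus_end_def trivial_limit_at_right_real)
  show "\<forall>\<^sub>F x in minus_end K. x \<in> interior K \<and> x < z"
  proof (cases "K = UNIV")
    case True thus ?thesis by (simp add: minus_end_def eventually_gt_at_bot)
  next
    case False
    hence "z < 1" "z > -1" using z K by auto
    hence "\<forall>\<^sub>F x in at_right (-1). x \<in> {-1<..<z}" by (intro eventually_at_right_real)
    thus ?thesis using False K n \<open>z < 1\<close> by (auto simp: minus_end_def elim!: eventually_mono)
  qed
qed

lemma pd_eqs:
  assumes dH: "\<And>z. fst z \<in> interior K \<Longrightarrow> ((\<lambda>z. H (fst z) (snd z)) has_derivative (\<lambda>h. Hx z * fst h + Hp z * snd h)) (at z)"
    and dHp: "\<And>z. fst z \<in> interior K \<Longrightarrow> (Hp has_derivative (\<lambda>h. Hpx z * fst h + Hpp z * snd h)) (at z)"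
    and x: "x \<in> interior K"
  shows "pd_p H x p = Hp (x, p)" and "pd_x K H x p = Hx (x, p)" and "pd_pp H x p = Hpp (x, p)"
    and "pd_xp K H x p = Hpx (x, p)"
proof -
  have dp: "pd_p H y q = Hp (y, q)" if "y \<in> interior K" for y q
    using partial_derivatives(1)[OF dH[of "(y, q)"]] that by (auto simp: pd_p_def intro: DERIV_imp_deriv)
  show "pd_p H x p = Hp (x, p)" by (rule dp[OF x])
  have at: "at x within K = at x" by (rule at_within_interior[OF x])
  have "((\<lambda>y. H y p) has_real_derivative Hx (x, p)) (at x)"
    using partial_derivatives(2)[OF dH[of "(x, p)"]] x by simp
  thus "pd_x K H x p = Hx (x, p)"
    unfolding pd_x_def at by (intro some_equality) (auto dest: DERIV_unique)
  have "((\<lambda>q. Hp (x, q)) has_real_derivative Hpp (x, p)) (at p)"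
    using partial_derivatives(1)[OF dHp[of "(x, p)"]] x by simp
  thus "pd_pp H x p = Hpp (x, p)" unfolding pd_pp_def dp[OF x] by (rule DERIV_imp_deriv)
  have "((\<lambda>y. Hp (y, p)) has_real_derivative Hpx (x, p)) (at x)"
    using partial_derivatives(2)[OF dHp[of "(x, p)"]] x by simp
  hence "((\<lambda>y. pd_p H y p) has_real_derivative Hpx (x, p)) (at x)"
    by (rule has_field_derivative_transform_within_open[OF _ open_interior x]) (simp add: dp)
  thus "pd_xp K H x p = Hpx (x, p)"
    unfolding pd_xp_def at by (intro some_equality) (auto dest: DERIV_unique)
qed

text \<open>All that the proof uses from the four alternatives of the standing assumption.\<close>
definition confining :: "real set \<Rightarrow> (real \<Rightarrow> real \<Rightarrow> real) \<Rightarrow> (real \<times> real \<Rightarrow> real) \<Rightarrow> (real \<times> real \<Rightarrow> real) \<Rightarrow>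
    (real \<times> real \<Rightarrow> real) \<Rightarrow> (real \<times> real \<Rightarrow> real) \<Rightarrow> (real \<times> real \<Rightarrow> real) \<Rightarrow> (real \<times> real \<Rightarrow> real) \<Rightarrow> bool" where
  "confining K H Hx Hp Hxx Hxp Hpx Hpp \<longleftrightarrow>
     hamiltonian (interior K) (\<lambda>z. H (fst z) (snd z)) Hx Hp Hxx Hxp Hpx Hpp \<and>
     end_trap (interior K) (\<lambda>x p. Hp (x, p)) (\<lambda>x p. - Hx (x, p)) \<and>
     end_trap (uminus ` interior K) (\<lambda>x p. - Hp (- x, - p)) (\<lambda>x p. Hx (- x, - p))"

lemma H_Ck_2_partials:
  assumes K: "K = UNIV \<or> K = {-1..1::real}" and H: "H_Ck 2 K H"
  shows "\<exists>Hx Hp Hxx Hxp Hpx Hpp.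
    (\<forall>z. fst z \<in> interior K \<longrightarrow> ((\<lambda>z. H (fst z) (snd z)) has_derivative (\<lambda>h. Hx z * fst h + Hp z * snd h)) (at z)) \<and>
    (\<forall>z. fst z \<in> interior K \<longrightarrow> (Hx has_derivative (\<lambda>h. Hxx z * fst h + Hxp z * snd h)) (at z)) \<and>
    (\<forall>z. fst z \<in> interior K \<longrightarrow> (Hp has_derivative (\<lambda>h. Hpx z * fst h + Hpp z * snd h)) (at z)) \<and>
    continuous_on (interior K \<times> UNIV) Hxx \<and> continuous_on (interior K \<times> UNIV) Hxp \<and>
    continuous_on (interior K \<times> UNIV) Hpx \<and> continuous_on (interior K \<times> UNIV) Hpp"
proof -
  have "\<exists>U Ht. interior K \<times> UNIV \<subseteq> U \<and> Ck2 2 U Ht \<and> (\<forall>x\<in>interior K. \<forall>p. Ht (x, p) = H x p)"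
  proof (cases "K = UNIV")
    case True
    thus ?thesis using H by (intro exI[of _ UNIV] exI[of _ "\<lambda>(x, p). H x p"]) (auto simp: H_Ck_def)
  next
    case False
    then obtain \<epsilon> Ht where e: "\<epsilon> > 0" "Ck2 2 ({-1-\<epsilon><..<1+\<epsilon>} \<times> UNIV) Ht" "\<forall>x\<in>K. \<forall>p. Ht (x,p) = H x p"
      using H by (auto simp: H_Ck_def)
    have "interior K = {-1<..<1}" using False K by auto
    thus ?thesis using e interior_subset[of K]
      by (intro exI[of _ "{-1-\<epsilon><..<1+\<epsilon>} \<times> UNIV"] exI[of _ Ht]) auto
  qed
  then obtain U Ht where U: "interior K \<times> UNIV \<subseteq> U" and C: "Ck2 2 U Ht"
    and eq: "\<And>x p. x \<in> interior K \<Longrightarrow> Ht (x, p) = H x p" by blast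
  from C obtain Hx Hp where 1: "Ck2 1 U Hx" "Ck2 1 U Hp"
    "\<forall>z\<in>U. (Ht has_derivative (\<lambda>h. Hx z * fst h + Hp z * snd h)) (at z)"
    by (auto simp: numeral_2_eq_2)
  from 1(1) obtain Hxx Hxp where 2: "continuous_on U Hxx" "continuous_on U Hxp"
    "\<forall>z\<in>U. (Hx has_derivative (\<lambda>h. Hxx z * fst h + Hxp z * snd h)) (at z)" by auto
  from 1(2) obtain Hpx Hpp where 3: "continuous_on U Hpx" "continuous_on U Hpp"
    "\<forall>z\<in>U. (Hp has_derivative (\<lambda>h. Hpx z * fst h + Hpp z * snd h)) (at z)" by auto
  have inU: "z \<in> U" if "fst z \<in> interior K" for z using U that by (cases z) auto
  have o: "open (interior K \<times> (UNIV :: real set))" by (intro open_Times) auto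
  have dH: "((\<lambda>z. H (fst z) (snd z)) has_derivative (\<lambda>h. Hx z * fst h + Hp z * snd h)) (at z)" if z: "fst z \<in> interior K" for z
  proof (rule has_derivative_transform_within_open[OF _ o])
    show "(Ht has_derivative (\<lambda>h. Hx z * fst h + Hp z * snd h)) (at z)" using 1(3) inU[OF z] by blast
    show "z \<in> interior K \<times> UNIV" using z by (cases z) auto
  qed (use eq in auto)
  show ?thesis
    by (rule exI[of _ Hx], rule exI[of _ Hp], rule exI[of _ Hxx], rule exI[of _ Hxp], rule exI[of _ Hpx], rule exI[of _ Hpp])
       (use dH 2 3 inU U in \<open>auto intro: continuous_on_subset\<close>)
qed

text \<open>(H3) gives coercivity and (H5) the corners, with constant level. (H4) gives the
  barriers: where the argmin exceeds q, convexity makes Hp negative for all p <= q.\<close>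

lemma cond_H_confining:
  assumes K: "K = UNIV \<or> K = {-1..1::real}" and H: "cond_H K H"
  shows "\<exists>Hx Hp Hxx Hxp Hpx Hpp. confining K H Hx Hp Hxx Hxp Hpx Hpp"
proof -
  note H = H[unfolded cond_H_def]
  have H1: "cond_H1 K H" and H3: "cond_H3 K H" and H4: "cond_H4 K H" and H5: "cond_H5 K H" using H by auto
  obtain Hx Hp Hxx Hxp Hpx Hpp where
    dH: "\<And>z. fst z \<in> interior K \<Longrightarrow> ((\<lambda>z. H (fst z) (snd z)) has_derivative (\<lambda>h. Hx z * fst h + Hp z * snd h)) (at z)"
    and dHx: "\<And>z. fst z \<in> interior K \<Longrightarrow> (Hx has_derivative (\<lambda>h. Hxx z * fst h + Hxp z * snd h)) (at z)"
    and dHp: "\<And>z. fst z \<in> interior K \<Longrightarrow> (Hp has_derivative (\<lambda>h. Hpx z * fst h + Hpp z * snd h)) (at z)"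
    and c: "continuous_on (interior K \<times> UNIV) Hxx" "continuous_on (interior K \<times> UNIV) Hxp"
      "continuous_on (interior K \<times> UNIV) Hpx" "continuous_on (interior K \<times> UNIV) Hpp"
    using H_Ck_2_partials[OF K, of H] H1 unfolding cond_H1_def by blast
  have pd: "pd_p H x p = Hp (x, p)" "pd_x K H x p = Hx (x, p)" "pd_pp H x p = Hpp (x, p)"
    if "x \<in> interior K" for x p
    by (rule pd_eqs[of K H Hx Hp Hpx Hpp]; use dH dHp that in blast)+
  have IK: "interior K \<subseteq> K" by (rule interior_subset)
  have coer: "\<exists>B. \<forall>x\<in>C. \<forall>p. H (fst (x, p)) (snd (x, p)) \<le> E \<longrightarrow> \<bar>p\<bar> < B" if C: "compact C" "C \<subseteq> interior K" for C E
  proof -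
    have "eventually (\<lambda>p. \<forall>x\<in>C. H x p / \<bar>p\<bar> \<ge> 1) at_infinity" using H3 C unfolding cond_H3_def by blast
    then obtain b where b: "\<And>p. \<bar>p\<bar> \<ge> b \<Longrightarrow> \<forall>x\<in>C. H x p / \<bar>p\<bar> \<ge> 1" unfolding eventually_at_infinity by auto
    have "\<bar>p\<bar> < max (max b 1) E + 1" if "x \<in> C" "H x p \<le> E" for x p
    proof (rule ccontr)
      assume n: "\<not> ?thesis"
      hence p: "\<bar>p\<bar> \<ge> b" "\<bar>p\<bar> > 0" "\<bar>p\<bar> > E" by linarith+
      have "H x p / \<bar>p\<bar> \<ge> 1" using b[OF p(1)] that by blast
      hence "H x p \<ge> \<bar>p\<bar>" using p(2) by (simp add: field_simps)
      thus False using that p(3) by linarith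
    qed
    thus ?thesis by (intro exI[of _ "max (max b 1) E + 1"]) auto
  qed
  interpret h: hamiltonian "interior K" "\<lambda>z. H (fst z) (snd z)" Hx Hp Hxx Hxp Hpx Hpp
  proof
    show "open (interior K)" "is_interval (interior K)" using interior_cases[OF K] by auto
    show "H (fst (x, 0)) (snd (x, 0)) = 0" if "x \<in> interior K" for x using H that IK by auto
    show "Hpp z > 0" if "fst z \<in> interior K" for z
      using H1 pd(3)[OF that, of "snd z"] subsetD[OF IK that] unfolding cond_H1_def by (metis prod.collapse)
  qed ((rule dH dHx dHp c coer; assumption)+)
  have argm: "Hp (x, p) < 0" if "x \<in> interior K" "argminH H x > q" "p \<le> q" for x q p
    using h.Hp_argminH[of x] h.Hp_less_iff[of x p "argminH H x"] that by simp
  have argm': "Hp (x, p) > 0" if "x \<in> interior K" "argminH H x < q" "p \<ge> q" for x q p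
    using h.Hp_argminH[of x] h.Hp_less_iff[of x "argminH H x" p] that by simp
  have R: "end_trap (interior K) (\<lambda>x p. Hp (x, p)) (\<lambda>x p. - Hx (x, p))"
  proof (rule end_trapI_static)
    fix z assume z: "z \<in> interior K"
    from H5[unfolded cond_H5_def, THEN conjunct1]
    obtain y q :: "nat \<Rightarrow> real" where "\<forall>n. y n \<in> interior K \<and> q n > 0" "filterlim y (plus_end K) sequentially"
      "\<forall>n. \<forall>r\<ge>q n. pd_p H (y n) r \<ge> 0" "\<forall>n. \<forall>z\<in>K. z \<ge> y n \<longrightarrow> - pd_x K H z (q n) \<ge> 0"
      by (elim exE conjE)
    hence y: "\<And>n. y n \<in> interior K \<and> q n > 0" "filterlim y (plus_end K) sequentially"
      "\<And>n r. r \<ge> q n \<Longrightarrow> pd_p H (y n) r \<ge> 0" "\<And>n z. z \<in> K \<Longrightarrow> z \<ge> y n \<Longrightarrow> - pd_x K H z (q n) \<ge> 0"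
      by blast+
    have "eventually (\<lambda>n. y n \<in> interior K \<and> y n > z) sequentially"
      using y(2) plus_end_eventually(1)[OF K z] unfolding filterlim_iff by blast
    then obtain n where n: "y n > z" unfolding eventually_sequentially by blast
    have 1: "Hp (y n, p) \<ge> 0" if "p \<ge> q n" for p
      using y(3)[where n = n and r = p] that pd(1)[of "y n" p] y(1)[of n] by simp
    have 2: "- Hx (x, q n) \<ge> 0" if "x \<in> interior K" "x \<ge> y n" for x
      using y(4)[of x n] that pd(2)[of x "q n"] subsetD[OF IK that(1)] by auto
    show "\<exists>y\<in>interior K. \<exists>q>0. y > z \<and> (\<forall>p\<ge>q. Hp (y, p) \<ge> 0) \<and> (\<forall>x\<in>interior K. x \<ge> y \<longrightarrow> - Hx (x, q) \<ge> 0)"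
      by (rule bexI[of _ "y n"], rule exI[of _ "q n"]) (use 1 2 n y(1)[of n] in auto)
  next
    fix x q assume x: "x \<in> interior K"
    have "eventually (\<lambda>\<beta>. argminH H \<beta> > q) (plus_end K)"
      using H4 unfolding cond_H4_def filterlim_at_top_dense by blast
    with plus_end_eventually(1)[OF K x] have "eventually (\<lambda>\<beta>. (\<beta> \<in> interior K \<and> \<beta> > x) \<and> argminH H \<beta> > q) (plus_end K)"
      by (rule eventually_conj)
    then obtain \<beta> where "\<beta> \<in> interior K" "\<beta> > x" "argminH H \<beta> > q"
      using eventually_happens'[OF plus_end_eventually(2)[OF K x]] by blast
    thus "\<exists>\<beta>\<in>interior K. \<beta> > x \<and> (\<forall>p\<le>q. Hp (\<beta>, p) < 0)" using argm by blast
  qed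
  have L: "end_trap (uminus ` interior K) (\<lambda>x p. - Hp (- x, - p)) (\<lambda>x p. Hx (- x, - p))"
    unfolding interior_cases(4)[OF K]
  proof (rule end_trapI_static)
    have neg: "- z \<in> interior K" if "z \<in> interior K" for z using interior_cases(4)[OF K] that by blast
    fix z assume "z \<in> interior K"
    hence z: "- z \<in> interior K" by (rule neg)
    from H5[unfolded cond_H5_def, THEN conjunct2]
    obtain y q :: "nat \<Rightarrow> real" where "\<forall>n. y n \<in> interior K \<and> q n < 0" "filterlim y (minus_end K) sequentially"
      "\<forall>n. \<forall>r\<le>q n. pd_p H (y n) r \<le> 0" "\<forall>n. \<forall>z\<in>K. z \<le> y n \<longrightarrow> - pd_x K H z (q n) \<le> 0"
      by (elim exE conjE)
    hence y: "\<And>n. y n \<in> interior K \<and> q n < 0" "filterlim y (minus_end K) sequentially"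
      "\<And>n r. r \<le> q n \<Longrightarrow> pd_p H (y n) r \<le> 0" "\<And>n z. z \<in> K \<Longrightarrow> z \<le> y n \<Longrightarrow> - pd_x K H z (q n) \<le> 0"
      by blast+
    have "eventually (\<lambda>n. y n \<in> interior K \<and> y n < - z) sequentially"
      using y(2) minus_end_eventually(1)[OF K z] unfolding filterlim_iff by blast
    then obtain n where n: "y n < - z" unfolding eventually_sequentially by blast
    have 1: "- Hp (- (- y n), - p) \<ge> 0" if "p \<ge> - q n" for p
      using y(3)[where n = n and r = "- p"] that pd(1)[of "y n" "- p"] y(1)[of n] by simp
    have 2: "Hx (- x, - (- q n)) \<ge> 0" if "x \<in> interior K" "x \<ge> - y n" for x
      using y(4)[of "- x" n] that pd(2)[of "- x" "q n"] neg[OF that(1)] subsetD[OF IK neg[OF that(1)]] by auto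
    show "\<exists>y\<in>interior K. \<exists>q>0. y > z \<and> (\<forall>p\<ge>q. - Hp (- y, - p) \<ge> 0) \<and> (\<forall>x\<in>interior K. x \<ge> y \<longrightarrow> Hx (- x, - q) \<ge> 0)"
      by (rule bexI[of _ "- y n"], rule exI[of _ "- q n"]) (use 1 2 n neg y(1)[of n] in auto)
  next
    fix x q assume "x \<in> interior K"
    hence x: "- x \<in> interior K" using interior_cases(4)[OF K] by blast
    have "eventually (\<lambda>\<beta>. argminH H \<beta> < - q) (minus_end K)"
      using H4 unfolding cond_H4_def filterlim_at_bot_dense by blast
    with minus_end_eventually(1)[OF K x] have "eventually (\<lambda>\<beta>. (\<beta> \<in> interior K \<and> \<beta> < - x) \<and> argminH H \<beta> < - q) (minus_end K)"
      by (rule eventually_conj)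
    then obtain \<beta> where \<beta>: "\<beta> \<in> interior K" "\<beta> < - x" "argminH H \<beta> < - q"
      using eventually_happens'[OF minus_end_eventually(2)[OF K x]] by blast
    have "- Hp (- (- \<beta>), - p) < 0" if "p \<le> q" for p using argm'[OF \<beta>(1,3), of "- p"] that by simp
    moreover have "- \<beta> \<in> interior K" using interior_cases(4)[OF K] \<beta> by blast
    ultimately show "\<exists>\<beta>\<in>interior K. \<beta> > x \<and> (\<forall>p\<le>q. - Hp (- \<beta>, - p) < 0)" using \<beta>(2) by (intro bexI[of _ "- \<beta>"]) auto
  qed
  have "confining K H Hx Hp Hxx Hxp Hpx Hpp"
    unfolding confining_def using h.hamiltonian_axioms R L by blast
  thus ?thesis by blast
qed

lemma has_derivative_compose_fst:
  fixes f :: "real \<Rightarrow> real" and z :: "real \<times> real"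
  assumes "(f has_real_derivative f') (at (fst z))"
  shows "((\<lambda>z. f (fst z)) has_derivative (\<lambda>h. f' * fst h)) (at z)"
  using has_derivative_compose[OF has_derivative_fst[OF has_derivative_ident] assms[unfolded has_field_derivative_def]]
  by simp

lemma gradient_confining:
  assumes W: "Ck1 3 UNIV W" and H: "\<And>x p. H x p = p\<^sup>2 / 2 - p * deriv W x"
    and M: "M \<ge> 0" "\<And>x y. x > y \<Longrightarrow> - (deriv W x - deriv W y) \<le> M * (x - y)"
  shows "\<exists>Hx Hp Hxx Hxp Hpx Hpp. confining UNIV H Hx Hp Hxx Hxp Hpx Hpp"
proof -
  from W obtain f1 f2 f3 where
    d0: "\<And>x. (W has_real_derivative f1 x) (at x)" and d1: "\<And>x. (f1 has_real_derivative f2 x) (at x)"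
    and d2: "\<And>x. (f2 has_real_derivative f3 x) (at x)" and c3: "continuous_on UNIV f3"
    by (auto simp: numeral_3_eq_3)
  have dW: "deriv W = f1" using d0 by (auto intro: DERIV_imp_deriv)
  note H = H[unfolded dW] and M = M[unfolded dW]
  note e1 = has_derivative_compose_fst[OF d1] and e2 = has_derivative_compose_fst[OF d2]
  have f2c: "continuous_on UNIV f2" using d2 by (meson DERIV_isCont continuous_at_imp_continuous_on)
  have f1c: "continuous_on UNIV f1" using d1 by (meson DERIV_isCont continuous_at_imp_continuous_on)
  have f2M: "f2 x \<ge> - M" for x
  proof -
    \<comment> \<open>One-sided Lipschitz continuity of -W' says that W'(x) + Mx is
      monotone.\<close>
    have "mono_on UNIV (\<lambda>x. f1 x + M * x)"
    proof (rule mono_onI)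
      fix r s :: real assume "r \<le> s"
      thus "f1 r + M * r \<le> f1 s + M * s" using M(2)[of r s] by (cases "r = s") (auto simp: algebra_simps)
    qed
    moreover have "((\<lambda>x. f1 x + M * x) has_real_derivative f2 x + M) (at x)"
      by (auto intro!: derivative_eq_intros d1)
    ultimately have "f2 x + M \<ge> 0" by (rule mono_on_imp_deriv_nonneg) auto
    thus ?thesis by simp
  qed
  have "hamiltonian UNIV (\<lambda>z. H (fst z) (snd z)) (\<lambda>z. - snd z * f2 (fst z)) (\<lambda>z. snd z - f1 (fst z))
     (\<lambda>z. - snd z * f3 (fst z)) (\<lambda>z. - f2 (fst z)) (\<lambda>z. - f2 (fst z)) (\<lambda>z. 1)"
  proof
    fix z :: "real \<times> real"
    have 1: "((\<lambda>z. snd z * f1 (fst z)) has_derivative (\<lambda>h. snd z * (f2 (fst z) * fst h) + snd h * f1 (fst z))) (at z)"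
      by (rule has_derivative_mult[OF has_derivative_snd[OF has_derivative_ident] e1])
    have 2: "((\<lambda>z. snd z * f2 (fst z)) has_derivative (\<lambda>h. snd z * (f3 (fst z) * fst h) + snd h * f2 (fst z))) (at z)"
      by (rule has_derivative_mult[OF has_derivative_snd[OF has_derivative_ident] e2])
    have 3: "((\<lambda>z. (snd z)\<^sup>2 / 2) has_derivative (\<lambda>h. snd z * snd h)) (at z)"
      by (auto intro!: derivative_eq_intros)
    show "((\<lambda>z. H (fst z) (snd z)) has_derivative (\<lambda>h. - snd z * f2 (fst z) * fst h + (snd z - f1 (fst z)) * snd h)) (at z)"
      unfolding H using has_derivative_diff[OF 3 1] by (simp add: algebra_simps)
    show "((\<lambda>z. - snd z * f2 (fst z)) has_derivative (\<lambda>h. - snd z * f3 (fst z) * fst h + - f2 (fst z) * snd h)) (at z)"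
      using has_derivative_minus[OF 2] by (simp add: algebra_simps)
    show "((\<lambda>z. snd z - f1 (fst z)) has_derivative (\<lambda>h. - f2 (fst z) * fst h + 1 * snd h)) (at z)"
      using has_derivative_diff[OF has_derivative_snd[OF has_derivative_ident] e1[of z]] by (simp add: algebra_simps)
  next
    fix C :: "real set" and E assume C: "compact C"
    have "bounded (f1 ` C)" by (intro compact_imp_bounded compact_continuous_image C continuous_on_subset[OF f1c]) auto
    then obtain D where D: "\<And>x. x \<in> C \<Longrightarrow> \<bar>f1 x\<bar> \<le> D" by (auto simp: bounded_iff)
    \<comment> \<open>The energy bound gives p^2/2 - |p| |D| <= |E|; beyond this constant the
      quadratic term wins.\<close>
    have "\<bar>p\<bar> < 2 * \<bar>D\<bar> + 2 * \<bar>E\<bar> + 2" if x: "x \<in> C" and e: "H x p \<le> E" for x p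
    proof (rule ccontr)
      assume n: "\<not> ?thesis"
      define r where "r = \<bar>p\<bar>"
      have r: "r \<ge> 2 * \<bar>D\<bar> + 2 * \<bar>E\<bar> + 2" using n by (simp add: r_def)
      have "p * f1 x \<le> \<bar>p\<bar> * \<bar>f1 x\<bar>" by (metis abs_ge_self abs_mult)
      also have "\<dots> \<le> r * \<bar>D\<bar>" unfolding r_def using D[OF x] by (intro mult_left_mono) auto
      finally have "r\<^sup>2 / 2 - r * \<bar>D\<bar> \<le> \<bar>E\<bar>" using e unfolding H r_def by simp
      moreover have "r * (2 * \<bar>D\<bar> + 2 * \<bar>E\<bar> + 2) \<le> r * r" using r by (intro mult_left_mono) auto
      moreover have "1 * (2 * \<bar>E\<bar> + 2) \<le> r * (2 * \<bar>E\<bar> + 2)" using r by (intro mult_right_mono) auto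
      ultimately show False by (simp add: power2_eq_square algebra_simps)
    qed
    thus "\<exists>B. \<forall>x\<in>C. \<forall>p. H (fst (x, p)) (snd (x, p)) \<le> E \<longrightarrow> \<bar>p\<bar> < B" by auto
  qed (auto simp: H is_interval_univ intro!: continuous_intros continuous_on_compose2[OF f2c] continuous_on_compose2[OF c3])
  moreover have "end_trap UNIV (\<lambda>x p. p - f1 x) (\<lambda>x p. p * f2 x)"
  proof (rule end_trap_gradient[OF M(1) f2M])
    fix x :: real assume "x \<ge> 0"
    thus "f1 0 - f1 x \<le> M * x" using M(2)[of 0 x] by (cases "x = 0") auto
  qed
  \<comment> \<open>Reflection replaces w(x) by -w(-x), whose derivative has the same lower
    bound.\<close>
  moreover have "end_trap UNIV (\<lambda>x p. p - (- f1 (- x))) (\<lambda>x p. p * f2 (- x))"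
  proof (rule end_trap_gradient[OF M(1) f2M])
    fix x :: real assume "x \<ge> 0"
    thus "- f1 (- 0) - - f1 (- x) \<le> M * x" using M(2)[of "- x" 0] by (cases "x = 0") auto
  qed
  ultimately have "confining UNIV H (\<lambda>z. - snd z * f2 (fst z)) (\<lambda>z. snd z - f1 (fst z))
     (\<lambda>z. - snd z * f3 (fst z)) (\<lambda>z. - f2 (fst z)) (\<lambda>z. - f2 (fst z)) (\<lambda>z. 1)"
    unfolding confining_def by (simp add: surj_uminus add.commute)
  thus ?thesis by blast
qed

lemma two_rates_confining:
  assumes U: "open U" "{-1..1} \<subseteq> U" and v: "Ck1 2 U vp" "Ck1 2 U vm"
    and H: "\<And>x p. x \<in> {-1..1} \<Longrightarrow> H x p = vp x * (exp (2*p) - 1) + vm x * (exp (-2*p) - 1)"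
    and m: "vm (-1) = 0" "\<And>x. x \<in> {-1<..1} \<Longrightarrow> vm x > 0"
    and p: "vp 1 = 0" "\<And>x. x \<in> {-1..<1} \<Longrightarrow> vp x > 0"
    and d: "deriv vp 1 < 0" "deriv vm (-1) > 0"
  shows "\<exists>Hx Hp Hxx Hxp Hpx Hpp. confining {-1..1} H Hx Hp Hxx Hxp Hpx Hpp"
proof -
  from v(1) obtain a1 a2 where a: "\<And>x. x \<in> U \<Longrightarrow> (vp has_real_derivative a1 x) (at x)"
    "\<And>x. x \<in> U \<Longrightarrow> (a1 has_real_derivative a2 x) (at x)" "continuous_on U a2" by (auto simp: numeral_2_eq_2)
  from v(2) obtain b1 b2 where b: "\<And>x. x \<in> U \<Longrightarrow> (vm has_real_derivative b1 x) (at x)"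
    "\<And>x. x \<in> U \<Longrightarrow> (b1 has_real_derivative b2 x) (at x)" "continuous_on U b2" by (auto simp: numeral_2_eq_2)
  have IU: "x \<in> U" if "x \<in> {-1<..<1}" for x using U that by auto
  have ends: "1 \<in> U" "-1 \<in> U" using U by auto
  have d1: "a1 1 < 0" "b1 (-1) > 0" using d DERIV_imp_deriv[OF a(1)[OF ends(1)]] DERIV_imp_deriv[OF b(1)[OF ends(2)]] by auto
  have cc: "isCont vp x" "isCont vm x" "isCont a1 x" "isCont b1 x" if "x \<in> U" for x
    using DERIV_isCont[OF a(1)[OF that]] DERIV_isCont[OF a(2)[OF that]] DERIV_isCont[OF b(1)[OF that]] DERIV_isCont[OF b(2)[OF that]] by auto
  have int: "interior {-1..1::real} = {-1<..<1}" by simp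
  have ct: "continuous_on ({-1<..<1} \<times> UNIV) (\<lambda>z. f (fst z))" if "\<And>x. x \<in> U \<Longrightarrow> isCont f x" for f :: "real \<Rightarrow> real"
    by (rule continuous_on_compose2[OF continuous_at_imp_continuous_on[of "{-1<..<1}"]])
       (use that IU in \<open>auto intro!: continuous_intros\<close>)
  have c2: "continuous_on ({-1<..<1} \<times> UNIV) (\<lambda>z. a2 (fst z))" "continuous_on ({-1<..<1} \<times> UNIV) (\<lambda>z. b2 (fst z))"
    by (rule continuous_on_compose2[OF a(3)] continuous_on_compose2[OF b(3)]; use IU in \<open>auto intro!: continuous_intros\<close>)+
  note c1 = ct[OF cc(1)] ct[OF cc(2)] ct[OF cc(3)] ct[OF cc(4)]
  define Hx :: "real \<times> real \<Rightarrow> real" where "Hx z = a1 (fst z) * (exp (2 * snd z) - 1) + b1 (fst z) * (exp (- 2 * snd z) - 1)" for z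
  define Hp :: "real \<times> real \<Rightarrow> real" where "Hp z = 2 * vp (fst z) * exp (2 * snd z) - 2 * vm (fst z) * exp (- 2 * snd z)" for z
  define Hxx :: "real \<times> real \<Rightarrow> real" where "Hxx z = a2 (fst z) * (exp (2 * snd z) - 1) + b2 (fst z) * (exp (- 2 * snd z) - 1)" for z
  define Hxp :: "real \<times> real \<Rightarrow> real" where "Hxp z = 2 * a1 (fst z) * exp (2 * snd z) - 2 * b1 (fst z) * exp (- 2 * snd z)" for z
  define Hpp :: "real \<times> real \<Rightarrow> real" where "Hpp z = 4 * vp (fst z) * exp (2 * snd z) + 4 * vm (fst z) * exp (- 2 * snd z)" for z
  have "hamiltonian {-1<..<1} (\<lambda>z. H (fst z) (snd z)) Hx Hp Hxx Hxp Hxp Hpp"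
  proof
    have o: "open ({-1<..<1} \<times> UNIV :: (real \<times> real) set)" by (intro open_Times) auto
    fix z :: "real \<times> real" assume z: "fst z \<in> {-1<..<1}"
    note zU = IU[OF z]
    have "((\<lambda>z. vp (fst z) * (exp (2 * snd z) - 1) + vm (fst z) * (exp (- 2 * snd z) - 1)) has_derivative (\<lambda>h. Hx z * fst h + Hp z * snd h)) (at z)"
      by (rule derivative_eq_intros has_derivative_compose_fst[OF a(1)[OF zU]] has_derivative_compose_fst[OF b(1)[OF zU]] refl)+ (auto simp: algebra_simps Hx_def Hp_def)
    thus "((\<lambda>z. H (fst z) (snd z)) has_derivative (\<lambda>h. Hx z * fst h + Hp z * snd h)) (at z)"
      by (rule has_derivative_transform_within_open[OF _ o])
         (use z H in \<open>auto simp: mem_Times_iff\<close>)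
    show "(Hx has_derivative (\<lambda>h. Hxx z * fst h + Hxp z * snd h)) (at z)"
      unfolding Hx_def[abs_def]
      by (rule derivative_eq_intros has_derivative_compose_fst[OF a(2)[OF zU]] has_derivative_compose_fst[OF b(2)[OF zU]] refl)+ (auto simp: algebra_simps Hxx_def Hxp_def)
    show "(Hp has_derivative (\<lambda>h. Hxp z * fst h + Hpp z * snd h)) (at z)"
      unfolding Hp_def[abs_def]
      by (rule derivative_eq_intros has_derivative_compose_fst[OF a(1)[OF zU]] has_derivative_compose_fst[OF b(1)[OF zU]] refl)+ (auto simp: algebra_simps Hpp_def Hxp_def)
    show "Hpp z > 0" unfolding Hpp_def using p(2)[of "fst z"] m(2)[of "fst z"] z by (intro add_pos_pos mult_pos_pos) auto
  next
    fix C :: "real set" and E assume C: "compact C" "C \<subseteq> {-1<..<1}"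
    show "\<exists>B. \<forall>x\<in>C. \<forall>p. H (fst (x, p)) (snd (x, p)) \<le> E \<longrightarrow> \<bar>p\<bar> < B"
    proof (cases "C = {}")
      case False
      have CU: "C \<subseteq> U" using C IU by blast
      have cv: "continuous_on C vp" "continuous_on C vm" using cc CU by (auto intro!: continuous_at_imp_continuous_on)
      have "continuous_on C (\<lambda>x. min (vp x) (vm x))" by (intro continuous_intros cv)
      from continuous_attains_inf[OF C(1) False this] obtain x0 where
        x0: "x0 \<in> C" "\<forall>x\<in>C. min (vp x0) (vm x0) \<le> min (vp x) (vm x)" by blast
      \<comment> \<open>Both rates are at least \<delta> on C. Whatever the sign of p, one of the
        two exponentials is exp(2|p|), which makes H grow.\<close>
      define \<delta> where "\<delta> = min (vp x0) (vm x0)"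
      have \<delta>: "\<delta> > 0" using p(2)[of x0] m(2)[of x0] x0(1) C by (auto simp: \<delta>_def)
      have "continuous_on C (\<lambda>x. vp x + vm x)" by (intro continuous_intros cv)
      from continuous_attains_sup[OF C(1) False this] obtain D where D: "\<forall>x\<in>C. vp x + vm x \<le> D" by blast
      have "\<bar>p\<bar> < (\<bar>E\<bar> + \<bar>D\<bar>) / \<delta> + 1" if x: "x \<in> C" and e: "H x p \<le> E" for x p
      proof -
        have xv: "\<delta> \<le> vp x" "\<delta> \<le> vm x" using x0(2) x by (auto simp: \<delta>_def)
        have "\<delta> * exp (2 * \<bar>p\<bar>) \<le> vp x * exp (2 * p) + vm x * exp (- 2 * p)"
        proof (cases "p \<ge> 0")
          case True
          have "\<delta> * exp (2 * p) \<le> vp x * exp (2 * p)" using xv by (intro mult_right_mono) auto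
          moreover have "0 \<le> vm x * exp (- 2 * p)" using xv \<delta> by (intro mult_nonneg_nonneg) auto
          moreover have eq: "2 * \<bar>p\<bar> = 2 * p" using True by simp
          ultimately show ?thesis unfolding eq by linarith
        next
          case False
          have "\<delta> * exp (- 2 * p) \<le> vm x * exp (- 2 * p)" using xv by (intro mult_right_mono) auto
          moreover have "0 \<le> vp x * exp (2 * p)" using xv \<delta> by (intro mult_nonneg_nonneg) auto
          moreover have eq: "2 * \<bar>p\<bar> = - 2 * p" using False by simp
          ultimately show ?thesis unfolding eq by linarith
        qed
        also have "\<dots> = H x p + (vp x + vm x)" using H[of x p] x C by (force simp: algebra_simps)
        also have "\<dots> \<le> \<bar>E\<bar> + \<bar>D\<bar>" using e D x by force
        finally have 1: "\<delta> * exp (2 * \<bar>p\<bar>) \<le> \<bar>E\<bar> + \<bar>D\<bar>" .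
        have "\<bar>p\<bar> \<le> exp (2 * \<bar>p\<bar>)" using exp_ge_add_one_self[of "2 * \<bar>p\<bar>"] by linarith
        hence "\<delta> * \<bar>p\<bar> \<le> \<delta> * exp (2 * \<bar>p\<bar>)" using \<delta> by (intro mult_left_mono) auto
        hence "\<delta> * \<bar>p\<bar> \<le> \<bar>E\<bar> + \<bar>D\<bar>" using 1 by (rule order_trans)
        hence "\<bar>p\<bar> \<le> (\<bar>E\<bar> + \<bar>D\<bar>) / \<delta>" using \<delta> by (simp add: field_simps)
        thus ?thesis by simp
      qed
      thus ?thesis by auto
    qed auto
  next
    show "continuous_on ({-1<..<1} \<times> UNIV) Hxx" unfolding Hxx_def[abs_def] by (intro continuous_intros c2)
    show "continuous_on ({-1<..<1} \<times> UNIV) Hxp" unfolding Hxp_def[abs_def] by (intro continuous_intros c1)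
    show "continuous_on ({-1<..<1} \<times> UNIV) Hpp" unfolding Hpp_def[abs_def] by (intro continuous_intros c1)
    show "is_interval {-1<..<1::real}" by (auto simp: is_interval_1)
    show "H (fst (x, 0)) (snd (x, 0)) = 0" if "x \<in> {-1<..<1}" for x using H[of x 0] that by auto
  qed auto
  moreover have "end_trap {-1<..<1} (\<lambda>x p. Hp (x, p)) (\<lambda>x p. - Hx (x, p))"
    unfolding Hp_def Hx_def fst_conv snd_conv
    by (rule end_trap_two_rates[OF cc[OF ends(1)] p(1) _ d1(1)]) (use m p in auto)
  \<comment> \<open>Under reflection the two rates exchange their roles, so the left end becomes a
    right end for vm(-x) and vp(-x).\<close>
  moreover have "end_trap {-1<..<1} (\<lambda>x p. - Hp (- x, - p)) (\<lambda>x p. Hx (- x, - p))"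
  proof -
    have cr: "isCont (\<lambda>x. f (- x)) 1" if "isCont f (-1)" for f :: "real \<Rightarrow> real"
      by (rule isCont_o2[where g = f]) (use that in auto)
    have "end_trap {-1<..<1} (\<lambda>x p. 2 * vm (- x) * exp (2 * p) - 2 * vp (- x) * exp (- 2 * p))
     (\<lambda>x p. - ((- b1 (- x)) * (exp (2 * p) - 1) + (- a1 (- x)) * (exp (- 2 * p) - 1)))"
      by (rule end_trap_two_rates) (use cr cc[OF ends(2)] m p d1 in \<open>auto intro!: continuous_intros\<close>)
    moreover have "(\<lambda>x p. - Hp (- x, - p)) = (\<lambda>x p. 2 * vm (- x) * exp (2 * p) - 2 * vp (- x) * exp (- 2 * p))"
      by (auto simp: Hp_def fun_eq_iff)
    moreover have "(\<lambda>x p. Hx (- x, - p)) = (\<lambda>x p. - ((- b1 (- x)) * (exp (2 * p) - 1) + (- a1 (- x)) * (exp (- 2 * p) - 1)))"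
      by (auto simp: Hx_def fun_eq_iff)
    ultimately show ?thesis by simp
  qed
  ultimately have "confining {-1..1} H Hx Hp Hxx Hxp Hxp Hpp"
    unfolding confining_def using interior_cases(4)[of "{-1..1}"] by (simp add: int)
  thus ?thesis by blast
qed

lemma SA_confining:
  assumes "SA K H I0"
  shows "K = UNIV \<or> K = {-1..1}" and "\<exists>Hx Hp Hxx Hxp Hpx Hpp. confining K H Hx Hp Hxx Hxp Hpx Hpp"
proof -
  show "K = UNIV \<or> K = {-1..1}" using assms unfolding SA_def by blast
  from assms[unfolded SA_def, THEN conjunct2]
  \<comment> \<open>(R-b) and (C-b) are taken together: both enter through condition (H).\<close>
  consider (Ra) W M where "K = UNIV" "Ck1 3 UNIV W" "\<forall>x p. H x p = p^2/2 - p * deriv W x"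
      "M \<ge> 0" "\<forall>x y. x > y \<longrightarrow> - (deriv W x - deriv W y) \<le> M * (x - y)"
    | (H) "K = UNIV \<or> K = {-1..1}" "cond_H K H"
    | (Ca) vp vm U where "K = {-1..1}" "open U" "{-1..1} \<subseteq> U" "Ck1 2 U vp" "Ck1 2 U vm"
          "\<forall>x\<in>{-1..1}. \<forall>p. H x p = vp x * (exp (2*p) - 1) + vm x * (exp (-2*p) - 1)"
          "vm (-1) = 0" "\<forall>x\<in>{-1<..1}. vm x > 0" "vp 1 = 0" "\<forall>x\<in>{-1..<1}. vp x > 0"
          "deriv vp 1 < 0" "deriv vm (-1) > 0"
    by blast
  thus "\<exists>Hx Hp Hxx Hxp Hpx Hpp. confining K H Hx Hp Hxx Hxp Hpx Hpp"
  proof cases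
    case Ra
    have "\<exists>Hx Hp Hxx Hxp Hpx Hpp. confining UNIV H Hx Hp Hxx Hxp Hpx Hpp"
      by (rule gradient_confining[OF Ra(2) _ Ra(4)]) (use Ra in auto)
    thus ?thesis using Ra by simp
  next
    case H thus ?thesis by (rule cond_H_confining)
  next
    case Ca
    have "\<exists>Hx Hp Hxx Hxp Hpx Hpp. confining {-1..1} H Hx Hp Hxx Hxp Hpx Hpp"
      by (rule two_rates_confining[OF Ca(2-5)]) (use Ca in blast)+
    thus ?thesis using Ca by simp
  qed
qed

section \<open>Linearized flow and the main theorem\<close>

text \<open>The integral of exp(-2mr) over [0, s], the weight with which the initial momentum enters
  the position in the linear system. The case m = 0 is separate because division by 0 yields
  0.\<close>

definition exp_mean :: "real \<Rightarrow> real \<Rightarrow> real" where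
  "exp_mean m s = (if m = 0 then s else (1 - exp (- 2 * m * s)) / (2 * m))"

lemma has_real_derivative_exp_mean: "(exp_mean m has_real_derivative exp (- 2 * m * s)) (at s within S)"
proof (cases "m = 0")
  case True
  have "exp_mean m = (\<lambda>s. s)" using True by (auto simp: exp_mean_def)
  thus ?thesis using True by simp
next
  case False
  have "exp_mean m = (\<lambda>s. (1 - exp (- 2 * m * s)) / (2 * m))" using False by (auto simp: exp_mean_def)
  thus ?thesis using False by (auto intro!: derivative_eq_intros)
qed

lemma linear_flow:
  assumes \<xi>: "\<And>s. s \<in> {0..t} \<Longrightarrow> (\<xi> has_real_derivative m * (\<xi> s - x0) + c * \<zeta> s) (at s within {0..t})"
    and \<zeta>: "\<And>s. s \<in> {0..t} \<Longrightarrow> (\<zeta> has_real_derivative - m * \<zeta> s) (at s within {0..t})" and t: "t \<ge> 0"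
  shows "\<zeta> t = exp (- m * t) * \<zeta> 0"
    and "\<xi> t = x0 + exp (m * t) * (\<xi> 0 - x0 + c * exp_mean m t * \<zeta> 0)"
proof -
  have z: "\<zeta> s = exp (- m * s) * \<zeta> 0" if s: "s \<in> {0..t}" for s
  proof -
    have "((\<lambda>s. exp (m * s) * \<zeta> s) has_real_derivative 0) (at s within {0..t})" if "s \<in> {0..t}" for s
      by (rule derivative_eq_intros \<zeta>[OF that] refl)+ (simp add: algebra_simps)
    then obtain k where "\<And>s. s \<in> {0..t} \<Longrightarrow> exp (m * s) * \<zeta> s = k"
      using has_field_derivative_zero_constant[of "{0..t}" "\<lambda>s. exp (m * s) * \<zeta> s"] by auto
    from this[OF s] this[of 0] t have "\<zeta> 0 = exp (m * s) * \<zeta> s" by simp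
    thus ?thesis by (simp add: exp_minus)
  qed
  show "\<zeta> t = exp (- m * t) * \<zeta> 0" using z[of t] t by simp
  \<comment> \<open>Variation of constants: the position pulled back by exp(-ms), minus the
    accumulated contribution of the momentum, does not change.\<close>
  have "((\<lambda>s. exp (- m * s) * (\<xi> s - x0) - c * \<zeta> 0 * exp_mean m s) has_real_derivative 0) (at s within {0..t})"
    if s: "s \<in> {0..t}" for s
  proof -
    have e: "exp (- 2 * m * s) = exp (- m * s) * exp (- m * s)" by (simp add: exp_add[symmetric])
    have "((\<lambda>s. exp (- m * s) * (\<xi> s - x0) - c * \<zeta> 0 * exp_mean m s) has_real_derivative
      exp (- m * s) * (- m) * (\<xi> s - x0) + exp (- m * s) * (m * (\<xi> s - x0) + c * \<zeta> s) - c * \<zeta> 0 * exp (- 2 * m * s)) (at s within {0..t})"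
      by (rule derivative_eq_intros \<xi>[OF s] has_real_derivative_exp_mean refl)+ (simp add: algebra_simps)
    also have "exp (- m * s) * (- m) * (\<xi> s - x0) + exp (- m * s) * (m * (\<xi> s - x0) + c * \<zeta> s) - c * \<zeta> 0 * exp (- 2 * m * s) = 0"
      unfolding e z[OF s] by (simp add: algebra_simps)
    finally show ?thesis .
  qed
  then obtain k where k: "\<And>s. s \<in> {0..t} \<Longrightarrow> exp (- m * s) * (\<xi> s - x0) - c * \<zeta> 0 * exp_mean m s = k"
    using has_field_derivative_zero_constant[of "{0..t}" "\<lambda>s. exp (- m * s) * (\<xi> s - x0) - c * \<zeta> 0 * exp_mean m s"] by auto
  have "exp_mean m 0 = 0" by (simp add: exp_mean_def)
  with k[of t] k[of 0] t have "exp (- m * t) * (\<xi> t - x0) = \<xi> 0 - x0 + c * exp_mean m t * \<zeta> 0" by (simp add: algebra_simps)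
  hence "exp (m * t) * (exp (- m * t) * (\<xi> t - x0)) = exp (m * t) * (\<xi> 0 - x0 + c * exp_mean m t * \<zeta> 0)" by simp
  moreover have "exp (m * t) * (exp (- m * t) * (\<xi> t - x0)) = \<xi> t - x0" by (simp add: exp_minus)
  ultimately show "\<xi> t = x0 + exp (m * t) * (\<xi> 0 - x0 + c * exp_mean m t * \<zeta> 0)" by simp
qed

text \<open>For m nonzero, t0 solves exp(-2mt) = 1 + 2m/(c I2), which says that 1 + c
  \<open>exp_mean m t\<close> I2 vanishes; the bound c I2 < -2m makes the argument of the logarithm
  positive. As \<open>exp_mean\<close> increases in t and I2 < 0, the expression is negative
  afterwards.\<close>

lemma past_focal_time:
  fixes m c I2 t :: real
  assumes c: "c > 0" and I2: "I2 < min (- 2 * m / c) 0"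
    and t: "t > (if m \<noteq> 0 then - (1 / (2 * m)) * ln (1 + inverse (c / (2 * m) * I2)) else - 1 / (c * I2))"
  shows "1 + c * exp_mean m t * I2 < 0" and "t > 0"
proof -
  define r where "r = c * I2"
  have r: "r < 0" "r < - 2 * m" using c I2 by (auto simp: r_def mult_less_0_iff field_simps)
  have D: "1 + r * exp_mean m t < 0"
  proof (cases "m = 0")
    case True
    hence "t > - 1 / r" using t by (simp add: r_def)
    thus ?thesis using True r by (simp add: exp_mean_def field_simps)
  next
    case False
    define A where "A = 1 + 2 * m / r"
    have A: "A > 0" using r by (simp add: A_def field_simps)
    have "inverse (c / (2 * m) * I2) = 2 * m / r" using False r by (simp add: r_def field_simps)
    hence tA: "t > - (1 / (2 * m)) * ln A" using t False by (simp add: A_def)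
    show ?thesis
    proof (cases "m > 0")
      case True
      have "- 2 * m * t < ln A" using tA True by (simp add: field_simps)
      from exp_less_mono[OF this, unfolded exp_ln[OF A]] have "exp (- 2 * m * t) < 1 + 2 * m / r" by (simp add: A_def)
      hence "1 - exp (- 2 * m * t) > - (2 * m / r)" by simp
      hence "r * (1 - exp (- 2 * m * t)) < r * (- (2 * m / r))" using r by (intro mult_strict_left_mono_neg)
      hence "r * (1 - exp (- 2 * m * t)) < - (2 * m)" using r by simp
      hence "r * (1 - exp (- 2 * m * t)) / (2 * m) < - (2 * m) / (2 * m)" using True by (intro divide_strict_right_mono) auto
      thus ?thesis using False by (simp add: exp_mean_def)
    next
      case neg: False
      hence m: "m < 0" using False by simp
      have "- 2 * m * t > ln A" using tA m by (simp add: field_simps)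
      from exp_less_mono[OF this, unfolded exp_ln[OF A]] have "exp (- 2 * m * t) > 1 + 2 * m / r" by (simp add: A_def)
      hence "1 - exp (- 2 * m * t) < - (2 * m / r)" by simp
      hence "r * (1 - exp (- 2 * m * t)) > r * (- (2 * m / r))" using r by (intro mult_strict_left_mono_neg)
      hence "r * (1 - exp (- 2 * m * t)) > - (2 * m)" using r by simp
      hence "r * (1 - exp (- 2 * m * t)) / (2 * m) < - (2 * m) / (2 * m)" using m by (intro divide_strict_right_mono_neg) auto
      thus ?thesis using False by (simp add: exp_mean_def)
    qed
  qed
  thus "1 + c * exp_mean m t * I2 < 0" by (simp add: r_def mult.commute mult.left_commute)
  \<comment> \<open>For t <= 0 \<open>exp_mean\<close> is nonpositive, and the expression would be
    at least 1.\<close>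
  show "t > 0"
  proof (rule ccontr)
    assume n: "\<not> t > 0"
    have "exp_mean m t \<le> 0"
    proof (cases "m = 0")
      case True thus ?thesis using n by (simp add: exp_mean_def)
    next
      case False
      show ?thesis
      proof (cases "m > 0")
        case True
        have "m * t \<le> 0" using True n by (intro mult_nonneg_nonpos) auto
        thus ?thesis using True by (auto simp: exp_mean_def divide_nonpos_pos)
      next
        case neg: False
        have "m * t \<ge> 0" using neg n by (intro mult_nonpos_nonpos) auto
        thus ?thesis using False neg by (auto simp: exp_mean_def divide_nonneg_neg)
      qed
    qed
    hence "r * exp_mean m t \<ge> 0" using r by (intro mult_nonpos_nonpos) auto
    thus False using D by simp
  qed
qed

text \<open>In linearizing coordinates the time-t map is explicit and affine, so \<open>f\<close>
  conjugates it by \<Psi> and applies it to the initial graph. \<Psi>, and hence its inverse, has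
  the identity as derivative at the equilibrium, so the conjugation does not change the slope at
  x0.\<close>

lemma linearized_time_map:
  assumes lin: "C1_linearization K H x0"
    and g: "(g has_real_derivative I2) (at x0)" "g x0 = 0" and t: "t > 0"
    and m: "m = pd_xp K H x0 0" and c: "c = pd_pp H x0 0"
  shows "\<exists>U f. open U \<and> (x0, 0) \<in> U \<and> f x0 = x0 \<and>
     (f has_real_derivative exp (m * t) * (1 + c * exp_mean m t * I2)) (at x0) \<and>
     (\<forall>X P. ham_sol K H {0..t} X P \<longrightarrow> (\<forall>s\<in>{0..t}. (X s, P s) \<in> U) \<longrightarrow> P 0 = g (X 0) \<longrightarrow> X t = f (X 0))"
proof -
  from lin obtain U V and \<Psi> \<Phi> :: "real \<times> real \<Rightarrow> real \<times> real" where
    o: "open U" "open V" "(x0, 0) \<in> U" "(x0, 0) \<in> V" and inv: "\<forall>z\<in>U. \<Phi> (\<Psi> z) = z"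
    and C: "Ck2 1 V (\<lambda>w. fst (\<Phi> w))" "Ck2 1 V (\<lambda>w. snd (\<Phi> w))"
    and fix0: "\<Psi> (x0, 0) = (x0, 0)" and d\<Psi>: "(\<Psi> has_derivative id) (at (x0, 0))"
    and conj: "\<forall>J \<gamma> \<eta>. is_interval J \<and> (\<forall>t\<in>J. (\<gamma> t, \<eta> t) \<in> U) \<longrightarrow>
        (ham_sol K H J \<gamma> \<eta> \<longleftrightarrow>
          (let \<xi> = (\<lambda>t. fst (\<Psi> (\<gamma> t, \<eta> t))); \<zeta> = (\<lambda>t. snd (\<Psi> (\<gamma> t, \<eta> t)));
               m = pd_xp K H x0 0; c = pd_pp H x0 0 in
           \<forall>t\<in>J. (\<xi> has_real_derivative m * (\<xi> t - x0) + c * \<zeta> t) (at t within J) \<and>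
                  (\<zeta> has_real_derivative - m * \<zeta> t) (at t within J)))"
    unfolding C1_linearization_def by (elim exE conjE)
  note d\<Psi> = d\<Psi>[unfolded id_def]
  have "\<exists>D. (\<Phi> has_derivative D) (at (x0, 0))"
  proof -
    obtain D1 where "((\<lambda>w. fst (\<Phi> w)) has_derivative D1) (at (x0, 0))" using C(1) o(4) by auto
    moreover obtain D2 where "((\<lambda>w. snd (\<Phi> w)) has_derivative D2) (at (x0, 0))" using C(2) o(4) by auto
    ultimately have "((\<lambda>w. (fst (\<Phi> w), snd (\<Phi> w))) has_derivative (\<lambda>h. (D1 h, D2 h))) (at (x0, 0))"
      by (rule has_derivative_Pair)
    thus ?thesis by auto
  qed
  then obtain D where D: "(\<Phi> has_derivative D) (at (x0, 0))" by blast
  \<comment> \<open>Differentiating \<Phi>(\<Psi> z) = z at the fixed point determines the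
    derivative of \<Phi> there.\<close>
  have "((\<lambda>z. \<Phi> (\<Psi> z)) has_derivative (\<lambda>h. D h)) (at (x0, 0))"
    by (rule has_derivative_compose[OF d\<Psi>]) (use D fix0 in simp)
  hence "((\<lambda>z. z) has_derivative (\<lambda>h. D h)) (at (x0, 0))"
    by (rule has_derivative_transform_within_open[OF _ o(1) o(3)]) (use inv in auto)
  hence "D = (\<lambda>h. h)" by (rule has_derivative_unique[OF _ has_derivative_ident])
  with D have d\<Phi>: "(\<Phi> has_derivative (\<lambda>h. h)) (at (x0, 0))" by simp
  define a where "a = exp (m * t)"
  define k where "k = c * exp_mean m t"
  define A :: "real \<times> real \<Rightarrow> real \<times> real" where
    "A w = (x0 + a * (fst w - x0 + k * snd w), exp (- m * t) * snd w)" for w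
  define f where "f x = fst (\<Phi> (A (\<Psi> (x, g x))))" for x
  have A0: "A (x0, 0) = (x0, 0)" by (simp add: A_def)
  have fx0: "f x0 = x0" using inv[rule_format, OF o(3)] fix0 by (simp add: f_def g A0)
  have 1: "((\<lambda>x. (x, g x)) has_derivative (\<lambda>h. (h, I2 * h))) (at x0)"
    by (rule has_derivative_Pair[OF has_derivative_ident g(1)[unfolded has_field_derivative_def]])
  have 2: "((\<lambda>x. \<Psi> (x, g x)) has_derivative (\<lambda>h. (h, I2 * h))) (at x0)"
    by (rule has_derivative_compose[OF 1]) (use d\<Psi> g in simp)
  have dA: "(A has_derivative (\<lambda>h. (a * (fst h + k * snd h), exp (- m * t) * snd h))) (at w)" for w
    unfolding A_def[abs_def] by (auto intro!: derivative_eq_intros simp: algebra_simps)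
  have 3: "((\<lambda>x. A (\<Psi> (x, g x))) has_derivative (\<lambda>h. (a * (fst ((h, I2 * h)) + k * snd ((h, I2 * h))), exp (- m * t) * snd ((h, I2 * h))))) (at x0)"
    by (rule has_derivative_compose[OF 2 dA])
  have 4: "((\<lambda>x. \<Phi> (A (\<Psi> (x, g x)))) has_derivative (\<lambda>h. (a * (fst ((h, I2 * h)) + k * snd ((h, I2 * h))), exp (- m * t) * snd ((h, I2 * h))))) (at x0)"
    by (rule has_derivative_compose[OF 3]) (use d\<Phi> g fix0 A0 in simp)
  have "(f has_derivative (\<lambda>h. a * (h + k * (I2 * h)))) (at x0)"
    unfolding f_def[abs_def] using has_derivative_fst[OF 4] by simp
  moreover have "(\<lambda>h. a * (h + k * (I2 * h))) = (*) (a * (1 + k * I2))" by (auto simp: algebra_simps)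
  ultimately have df: "(f has_real_derivative a * (1 + k * I2)) (at x0)" by (simp add: has_field_derivative_def)
  have map: "X t = f (X 0)" if sol: "ham_sol K H {0..t} X P" and U: "\<forall>s\<in>{0..t}. (X s, P s) \<in> U" and P0: "P 0 = g (X 0)" for X P
  proof -
    define \<xi> where "\<xi> s = fst (\<Psi> (X s, P s))" for s
    define \<zeta> where "\<zeta> s = snd (\<Psi> (X s, P s))" for s
    have lin': "\<forall>s\<in>{0..t}. (\<xi> has_real_derivative m * (\<xi> s - x0) + c * \<zeta> s) (at s within {0..t}) \<and>
                  (\<zeta> has_real_derivative - m * \<zeta> s) (at s within {0..t})"
      using conj[rule_format, of "{0..t}" X P] U sol unfolding Let_def m c \<xi>_def[abs_def] \<zeta>_def[abs_def]
      by (simp add: is_interval_cc)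
    have l: "\<zeta> t = exp (- m * t) * \<zeta> 0" "\<xi> t = x0 + exp (m * t) * (\<xi> 0 - x0 + c * exp_mean m t * \<zeta> 0)"
      by (rule linear_flow[of t \<xi> m x0 c \<zeta>]; use lin' t in auto)+
    have "\<Psi> (X t, P t) = A (\<Psi> (X 0, P 0))"
      using l unfolding \<xi>_def \<zeta>_def A_def a_def k_def by (simp add: prod_eq_iff)
    moreover have "\<Phi> (\<Psi> (X t, P t)) = (X t, P t)" using inv U t by auto
    ultimately show ?thesis by (simp add: f_def P0)
  qed
  show ?thesis
    by (rule exI[of _ U], rule exI[of _ f]) (use o fx0 df map in \<open>auto simp: a_def k_def\<close>)
qed

theorem mainTheorem5:
  fixes K :: "real set" and H :: "real \<Rightarrow> real \<Rightarrow> real" and I0 :: "real \<Rightarrow> real"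
  assumes "SA K H I0"
  shows "(\<forall>x0. x0 \<in> interior K \<and> deriv I0 x0 = 0 \<and> pd_p H x0 0 = 0 \<and>
            (\<exists>U. open U \<and> x0 \<in> U \<and> Ck1 2 U I0) \<and>
            deriv (deriv I0) x0 < min (- 2 * pd_xp K H x0 0 / pd_pp H x0 0) 0 \<and>
            C1_linearization K H x0 \<longrightarrow>
           (let m = pd_xp K H x0 0; c = pd_pp H x0 0; I2 = deriv (deriv I0) x0;
                t0 = (if m \<noteq> 0 then - (1 / (2 * m)) * ln (1 + inverse (c / (2 * m) * I2))
                      else - 1 / (c * I2))
            in \<forall>t>t0. overhang (Gt K H I0 t) x0))
       \<and>
         (\<forall>m1 m2. H_Ck 3 K H \<and> m1 \<in> interior K \<and> m2 \<in> interior K \<and> m1 < m2 \<and>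
            pd_p H m1 0 = 0 \<and> pd_p H m2 0 = 0 \<and> (\<forall>x\<in>{m1<..<m2}. pd_p H x 0 \<noteq> 0) \<and>
            pd_xp K H m1 0 \<noteq> 0 \<and> pd_xp K H m2 0 \<noteq> 0 \<and>
            Gset K I0 \<inter> {(x, p). x \<in> {m1<..<m2} \<and> H x p < 0} \<noteq> {} \<longrightarrow>
           (\<exists>t0>0. \<exists>x0\<in>{m1<..<m2}. \<forall>t\<ge>t0. overhang (Gt K H I0 t) x0))"
proof -
  note K = SA_confining(1)[OF assms]
  obtain Hx Hp Hxx Hxp Hpx Hpp where conf: "confining K H Hx Hp Hxx Hxp Hpx Hpp"
    using SA_confining(2)[OF assms] by blast
  interpret h: hamiltonian "interior K" "\<lambda>z. H (fst z) (snd z)" Hx Hp Hxx Hxp Hpx Hpp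
    using conf by (simp add: confining_def)
  have trapR: "end_trap (interior K) (\<lambda>x p. Hp (x, p)) (\<lambda>x p. - Hx (x, p))"
    and trapL: "end_trap (uminus ` interior K) (\<lambda>x p. - Hp (- x, - p)) (\<lambda>x p. Hx (- x, - p))"
    using conf by (simp_all add: confining_def)
  have pd: "pd_p H x p = Hp (x, p)" "pd_x K H x p = Hx (x, p)" "pd_pp H x p = Hpp (x, p)" "pd_xp K H x p = Hpx (x, p)"
    if "x \<in> interior K" for x p
    by (rule pd_eqs[of K H Hx Hp Hpx Hpp]; use h.dH h.dHp that in blast)+
  have IK: "interior K \<subseteq> K" by (rule interior_subset)
  define g where "g = deriv I0"
  have C1: "C1_boundary K I0" using assms by (simp add: SA_def)
  have gc: "continuous_on (interior K) g"
  proof -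
    obtain f' where f': "\<forall>x\<in>interior K. (I0 has_real_derivative f' x) (at x)" "continuous_on (interior K) f'"
      using C1 by (auto simp: C1_boundary_def)
    have "g x = f' x" if "x \<in> interior K" for x using f'(1) that by (auto simp: g_def intro: DERIV_imp_deriv)
    thus ?thesis using f'(2) by (simp cong: continuous_on_cong)
  qed
  have steep: "\<exists>x\<in>interior K. x > z \<and> g x \<ge> q" if z: "z \<in> interior K" for z q
  proof -
    have "eventually (\<lambda>x. g x \<ge> q) (plus_end K)"
      using C1 unfolding C1_boundary_def filterlim_at_top g_def by blast
    with plus_end_eventually(1)[OF K z] have "eventually (\<lambda>x. (x \<in> interior K \<and> x > z) \<and> g x \<ge> q) (plus_end K)"
      by (rule eventually_conj)
    from eventually_happens'[OF plus_end_eventually(2)[OF K z] this] show ?thesis by blast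
  qed
  have reach: "h.reach g t \<subseteq> Gt K H I0 t" for t
  proof
    fix w assume "w \<in> h.reach g t"
    then obtain X P x T where w: "w = (X t, P t)" "x \<in> interior K" "T > t" "h.traj T X P" "X 0 = x" "P 0 = g x"
      unfolding h.reach_def by blast
    have "ham_sol K H {0..<T} X P"
      unfolding ham_sol_def
    proof (intro ballI)
      fix s assume "s \<in> {0..<T}"
      with w(4) have s: "X s \<in> interior K" "(X has_real_derivative Hp (X s, P s)) (at s within {0..<T})"
        "(P has_real_derivative - Hx (X s, P s)) (at s within {0..<T})" unfolding h.traj_def by blast+
      show "X s \<in> K \<and> (X has_real_derivative pd_p H (X s) (P s)) (at s within {0..<T}) \<and>
        (P has_real_derivative - pd_x K H (X s) (P s)) (at s within {0..<T})"
        using s pd(1,2)[OF s(1)] subsetD[OF IK s(1)] by simp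
    qed
    thus "w \<in> Gt K H I0 t" unfolding Gt_def using w g_def by blast
  qed
  have over: "overhang (Gt K H I0 t) x" if "overhang (h.reach g t) x" for t x
    using that reach[of t] unfolding overhang_def by blast
  show ?thesis
  proof (intro conjI allI impI)
    fix x0
    assume a: "x0 \<in> interior K \<and> deriv I0 x0 = 0 \<and> pd_p H x0 0 = 0 \<and>
            (\<exists>U. open U \<and> x0 \<in> U \<and> Ck1 2 U I0) \<and>
            deriv (deriv I0) x0 < min (- 2 * pd_xp K H x0 0 / pd_pp H x0 0) 0 \<and>
            C1_linearization K H x0"
    have x0: "x0 \<in> interior K" "g x0 = 0" "Hp (x0, 0) = 0" and lin: "C1_linearization K H x0"
      using a pd(1) by (auto simp: g_def)
    define m where "m = pd_xp K H x0 0"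
    define c where "c = pd_pp H x0 0"
    define I2 where "I2 = deriv g x0"
    have I2: "I2 < min (- 2 * m / c) 0" using a by (simp add: I2_def g_def m_def c_def)
    have c: "c > 0" using pd(3)[OF x0(1)] h.Hpp_pos[of "(x0, 0)"] x0(1) by (simp add: c_def)
    \<comment> \<open>\<open>deriv\<close> is total, so that \<open>I2\<close> is a genuine
      derivative of g has to be extracted from the C^2 hypothesis near x0.\<close>
    have dg: "(g has_real_derivative I2) (at x0)"
    proof -
      obtain U f1 f2 where U: "open U" "x0 \<in> U" "\<forall>x\<in>U. (I0 has_real_derivative f1 x) (at x)" "\<forall>x\<in>U. (f1 has_real_derivative f2 x) (at x)"
        using a by (auto simp: numeral_2_eq_2)
      have "g x = f1 x" if "x \<in> U" for x using U(3) that by (auto simp: g_def intro: DERIV_imp_deriv)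
      hence "(g has_real_derivative f2 x0) (at x0)"
        by (intro has_field_derivative_transform_within_open[OF U(4)[rule_format, OF U(2)] U(1,2)]) auto
      thus ?thesis unfolding I2_def using DERIV_imp_deriv by metis
    qed
    have "overhang (Gt K H I0 t) x0"
      if t: "t > (if m \<noteq> 0 then - (1 / (2 * m)) * ln (1 + inverse (c / (2 * m) * I2)) else - 1 / (c * I2))" for t
    proof -
      have D: "1 + c * exp_mean m t * I2 < 0" and t0: "t > 0" using past_focal_time[OF c I2 t] by auto
      obtain U f where U: "open U" "(x0, 0) \<in> U" "f x0 = x0"
        "(f has_real_derivative exp (m * t) * (1 + c * exp_mean m t * I2)) (at x0)"
        "\<forall>X P. ham_sol K H {0..t} X P \<longrightarrow> (\<forall>s\<in>{0..t}. (X s, P s) \<in> U) \<longrightarrow> P 0 = g (X 0) \<longrightarrow> X t = f (X 0)"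
        using linearized_time_map[OF lin dg x0(2) t0 m_def c_def] by blast
      have "overhang (h.reach g t) x0"
      proof (rule h.overhang_at_equilibrium[OF x0(1,3) gc x0(2) t0 trapR trapL steep U(1,2) U(4) _ U(3)])
        show "exp (m * t) * (1 + c * exp_mean m t * I2) < 0" using D by (simp add: mult_pos_neg)
        fix X P assume s: "h.solves_on t X P" "\<forall>s\<in>{0..t}. (X s, P s) \<in> U" "P 0 = g (X 0)"
        have "ham_sol K H {0..t} X P"
          unfolding ham_sol_def
        proof (intro ballI)
          fix s' assume "s' \<in> {0..t}"
          with s(1) have s': "X s' \<in> interior K" "(X has_real_derivative Hp (X s', P s')) (at s' within {0..t})"
            "(P has_real_derivative - Hx (X s', P s')) (at s' within {0..t})" unfolding h.solves_on_def by blast+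
          show "X s' \<in> K \<and> (X has_real_derivative pd_p H (X s') (P s')) (at s' within {0..t}) \<and>
            (P has_real_derivative - pd_x K H (X s') (P s')) (at s' within {0..t})"
            using s' pd(1,2)[OF s'(1)] subsetD[OF IK s'(1)] by simp
        qed
        thus "X t = f (X 0)" using U(5) s by blast
      qed
      thus ?thesis by (rule over)
    qed
    thus "let m = pd_xp K H x0 0; c = pd_pp H x0 0; I2 = deriv (deriv I0) x0;
                t0 = (if m \<noteq> 0 then - (1 / (2 * m)) * ln (1 + inverse (c / (2 * m) * I2))
                      else - 1 / (c * I2))
            in \<forall>t>t0. overhang (Gt K H I0 t) x0"
      unfolding Let_def m_def c_def I2_def g_def by blast
  next
    fix m1 m2
    assume a: "H_Ck 3 K H \<and> m1 \<in> interior K \<and> m2 \<in> interior K \<and> m1 < m2 \<and>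
            pd_p H m1 0 = 0 \<and> pd_p H m2 0 = 0 \<and> (\<forall>x\<in>{m1<..<m2}. pd_p H x 0 \<noteq> 0) \<and>
            pd_xp K H m1 0 \<noteq> 0 \<and> pd_xp K H m2 0 \<noteq> 0 \<and>
            Gset K I0 \<inter> {(x, p). x \<in> {m1<..<m2} \<and> H x p < 0} \<noteq> {}"
    hence m: "m1 \<in> interior K" "m2 \<in> interior K" "m1 < m2" by auto
    have e: "Hp (m1, 0) = 0" "Hp (m2, 0) = 0" "Hpx (m1, 0) \<noteq> 0" "Hpx (m2, 0) \<noteq> 0"
      using a pd(1,4)[OF m(1)] pd(1,4)[OF m(2)] by auto
    have b: "Hp (x, 0) \<noteq> 0" if x: "x \<in> {m1<..<m2}" for x
    proof -
      have "x \<in> interior K" using h.Icc_subset[OF m(1,2)] x by auto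
      thus ?thesis using a x pd(1)[of x 0] by auto
    qed
    obtain y where y: "y \<in> {m1<..<m2}" "H y (g y) < 0" using a by (auto simp: Gset_def g_def)
    have "\<exists>t0>0. \<exists>c\<in>{m1<..<m2}. \<forall>t\<ge>t0. overhang (h.reach g t) c"
      by (rule h.overhang_between_equilibria[OF m e(1,2) b e(3,4) gc y(1)]) (use y in auto)
    thus "\<exists>t0>0. \<exists>x0\<in>{m1<..<m2}. \<forall>t\<ge>t0. overhang (Gt K H I0 t) x0" using over by blast
  qed
qed

end
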